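(* Let $N\geq 2$, $d\geq 1$ and $i\geq 2$ be integers such that $N=\frac{d(d+i)}{i-1}$. Let $\alpha,\beta\in[A,B]=\overline X_{N,d,i}$ with $\alpha<\beta$ be arbitrary. Then the dynamical systems $(\Omega_\alpha,\bar{\mathcal B}_\alpha,\bar\mu_\alpha,\mathcal T_\alpha)$ and $(\Omega_\beta,\bar{\mathcal B}_\beta,\bar\mu_\beta,\mathcal T_\beta)$ are metrically isomorphic.
   Context: For an integer $N\ge 2$ and a real $\alpha$ with $0<\alpha\le\sqrt N-1$, put $I_\alpha=[\alpha,\alpha+1]$ and define $T_\alpha:I_\alpha\to[\alpha,\alpha+1)$ by $T_\alpha(x)=\frac Nx-d(x)$, where $d(x)=\lfloor \frac Nx-\alpha\rfloor$ (the dependence on $N$ is suppressed). The values of $d(\cdot)$ are the digits; they form a finite set of consecutive integers $\{d,d+1,\dots,d+i\}$ with smallest digit $d=d(\alpha+1)$ and largest digit $d+i$. The cylinders are $I_k=\{x\in I_\alpha : d(x)=k\}$; the largest digit is always chosen so that every cylinder is an interval (in the exceptional case that $N/\alpha-\alpha$ is an integer, the single point $\alpha$ is given the digit $N/\alpha-\alpha-1$, so that $T_\alpha(\alpha)=\alpha+1$). The interior of $I_k$ is denoted $I_k^{o}$. For positive integers $d,i$, let $\mathcal A_{N,d,i}$ be the set of all $\alpha\in(0,\sqrt N-1]$ for which $T_\alpha$ has digit set $\{d,d+1,\dots,d+i\}$, and let $X_{N,d,i}=\{\alpha\in\mathcal A_{N,d,i} : T_\alpha(\alpha)\in I_d^{o},\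 T_\alpha(\alpha+1)\in I_{d+i}^{o}\}$; $\overline X_{N,d,i}$ is its closure. Put $A=\frac{-(d+i+1)+\sqrt{(d+i+1)^2+4N}}{2}$, $E=A+1$, $B=\frac{-(d+1)+\sqrt{(d-1)^2+4N}}{2}$, $F=B+1$, $C=\frac{N(-(d+i-1)+\sqrt{(d+i+1)^2+4N})}{2(d+i+N)}$, $D=\frac{N(-(d+1)+\sqrt{(d-1)^2+4N})}{2(N-d)}$. $\Omega_\alpha$ is the polygon bounded by the straight line segments between the vertices (in clockwise order) $(\alpha,A)$, $(T_\alpha^2(\alpha+1),A)$, $(T_\alpha^2(\alpha+1),B)$, $(T_\alpha(\alpha),B)$, $(T_\alpha(\alpha),C)$, $(\alpha+1,C)$, $(\alpha+1,F)$, $(T_\alpha^2(\alpha),F)$, $(T_\alpha^2(\alpha),E)$, $(T_\alpha(\alpha+1),E)$, $(T_\alpha(\alpha+1),D)$, $(\alpha,D)$, and back to $(\alpha,A)$. For $\alpha\in X_{N,d,i}$ the orbit points here are $T_\alpha(\alpha)=\frac N\alpha-(d+i)$, $T_\alpha^2(\alpha)=\frac{N}{T_\alpha(\alpha)}-d$, $T_\alpha(\alpha+1)=\frac{N}{\alpha+1}-d$, $T_\alpha^2(\alpha+1)=\frac{N}{T_\alpha(\alpha+1)}-(d+i)$; for $\alpha\in\{A,B\}$ these four symbols in the polygon are understood to be given by the same formulas, and the polygon may be degenerate in that some consecutive vertices coincide. The map $\mathcal T_\alpha:\Omega_\alpha\to\Omega_\alpha$ is $\mathcal T_\alpha(x,y)=\left(T_\alpha(x),\frac{N}{d(x)+y}\right)$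 (defined almost everywhere), $\bar{\mathcal B}_\alpha$ is the Borel $\sigma$-algebra of $\Omega_\alpha$, and $\bar\mu_\alpha$ is the $\mathcal T_\alpha$-invariant probability measure on $\Omega_\alpha$ with density $H\frac{N}{(N+xy)^2}\mathbf 1_{\Omega_\alpha}(x,y)$, $H$ the normalising constant. *)

theory Defs
  imports "HOL-Probability.Probability"
begin

section \<open>The maps $T_\alpha$, cylinders and parameter sets\<close>

text \<open>The first branch is the exceptional convention for the left endpoint: if \<open>N / \<alpha> - \<alpha>\<close> is
  an integer, then \<open>\<alpha>\<close> gets the digit \<open>N / \<alpha> - \<alpha> - 1\<close>, so that it is not a cylinder on its own.\<close>

definition digit :: "int \<Rightarrow> real \<Rightarrow> real \<Rightarrow> int" where
  "digit N \<alpha> x =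
     (if x = \<alpha> \<and> of_int N / \<alpha> - \<alpha> \<in> \<int> then \<lfloor>of_int N / \<alpha> - \<alpha>\<rfloor> - 1
      else \<lfloor>of_int N / x - \<alpha>\<rfloor>)"

definition Tmap :: "int \<Rightarrow> real \<Rightarrow> real \<Rightarrow> real" where
  "Tmap N \<alpha> x = of_int N / x - of_int (digit N \<alpha> x)"

definition cylinder :: "int \<Rightarrow> real \<Rightarrow> int \<Rightarrow> real set" where
  "cylinder N \<alpha> k = {x \<in> {\<alpha>..\<alpha> + 1}. digit N \<alpha> x = k}"

definition digit_params :: "int \<Rightarrow> int \<Rightarrow> int \<Rightarrow> real set" where
  "digit_params N d i =
     {\<alpha> \<in> {0<..sqrt (of_int N) - 1}. digit N \<alpha> ` {\<alpha>..\<alpha> + 1} = {d..d + i}}"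

definition X_set :: "int \<Rightarrow> int \<Rightarrow> int \<Rightarrow> real set" where
  "X_set N d i =
     {\<alpha> \<in> digit_params N d i.
        Tmap N \<alpha> \<alpha> \<in> interior (cylinder N \<alpha> d) \<and>
        Tmap N \<alpha> (\<alpha> + 1) \<in> interior (cylinder N \<alpha> (d + i))}"

section \<open>The polygon $\Omega_\alpha$\<close>

definition ptA :: "int \<Rightarrow> int \<Rightarrow> int \<Rightarrow> real" where
  "ptA N d i = (- (d + i + 1) + sqrt ((d + i + 1)\<^sup>2 + 4 * N)) / 2"

definition ptB :: "int \<Rightarrow> int \<Rightarrow> int \<Rightarrow> real" where
  "ptB N d i = (- (d + 1) + sqrt ((d - 1)\<^sup>2 + 4 * N)) / 2"

definition ptC :: "int \<Rightarrow> int \<Rightarrow> int \<Rightarrow> real" where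
  "ptC N d i = N * (- (d + i - 1) + sqrt ((d + i + 1)\<^sup>2 + 4 * N)) / (2 * (d + i + N))"

definition ptD :: "int \<Rightarrow> int \<Rightarrow> int \<Rightarrow> real" where
  "ptD N d i = N * (- (d + 1) + sqrt ((d - 1)\<^sup>2 + 4 * N)) / (2 * (N - d))"

definition ptE :: "int \<Rightarrow> int \<Rightarrow> int \<Rightarrow> real" where
  "ptE N d i = ptA N d i + 1"

definition ptF :: "int \<Rightarrow> int \<Rightarrow> int \<Rightarrow> real" where
  "ptF N d i = ptB N d i + 1"

text \<open>The first two iterates of \<open>\<alpha>\<close> (\<open>lo1\<close>, \<open>lo2\<close>) and of \<open>\<alpha> + 1\<close> (\<open>hi1\<close>, \<open>hi2\<close>), given by fixed
  formulas so that they also make sense at the endpoints of the parameter interval. On \<open>X_set\<close>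
  they are the true iterates, see \<open>orbit_points_X\<close> below.\<close>

definition lo1 :: "int \<Rightarrow> int \<Rightarrow> int \<Rightarrow> real \<Rightarrow> real" where
  "lo1 N d i \<alpha> = N / \<alpha> - (d + i)"

definition lo2 :: "int \<Rightarrow> int \<Rightarrow> int \<Rightarrow> real \<Rightarrow> real" where
  "lo2 N d i \<alpha> = N / lo1 N d i \<alpha> - d"

definition hi1 :: "int \<Rightarrow> int \<Rightarrow> int \<Rightarrow> real \<Rightarrow> real" where
  "hi1 N d i \<alpha> = N / (\<alpha> + 1) - d"

definition hi2 :: "int \<Rightarrow> int \<Rightarrow> int \<Rightarrow> real \<Rightarrow> real" where
  "hi2 N d i \<alpha> = N / hi1 N d i \<alpha> - (d + i)"

lemma digit_antimono:
  assumes "N > 0" "\<alpha> > 0" "\<alpha> \<le> x" "x \<le> y"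
  shows "digit N \<alpha> y \<le> digit N \<alpha> x"
proof (cases "x = y")
  case False
  then have xy: "x < y" "y \<noteq> \<alpha>" using assms by auto
  have less: "of_int N / y < of_int N / x"
    using assms xy by (intro divide_strict_left_mono) auto
  show ?thesis
  proof (cases "x = \<alpha> \<and> of_int N / \<alpha> - \<alpha> \<in> \<int>")
    case False
    have "\<lfloor>of_int N / y - \<alpha>\<rfloor> \<le> \<lfloor>of_int N / x - \<alpha>\<rfloor>"
      using less by (intro floor_mono) auto
    with False xy show ?thesis by (auto simp: digit_def)
  next
    case True
    then obtain m where m: "of_int N / \<alpha> - \<alpha> = of_int m" by (elim conjE Ints_cases)
    have "of_int N / y - \<alpha> < of_int m" using less m True by simp
    then have "\<lfloor>of_int N / y - \<alpha>\<rfloor> < m" by (simp add: floor_less_iff)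
    with True xy m show ?thesis by (auto simp: digit_def)
  qed
qed simp

lemma orbit_points_X:
  assumes "N > 0" "\<alpha> \<in> X_set N d i"
  shows "lo1 N d i \<alpha> = Tmap N \<alpha> \<alpha>"
    and "lo2 N d i \<alpha> = Tmap N \<alpha> (Tmap N \<alpha> \<alpha>)"
    and "hi1 N d i \<alpha> = Tmap N \<alpha> (\<alpha> + 1)"
    and "hi2 N d i \<alpha> = Tmap N \<alpha> (Tmap N \<alpha> (\<alpha> + 1))"
proof -
  have pos: "\<alpha> > 0" and img: "digit N \<alpha> ` {\<alpha>..\<alpha> + 1} = {d..d + i}"
    using assms by (auto simp: X_set_def digit_params_def)
  have "Tmap N \<alpha> \<alpha> \<in> cylinder N \<alpha> d" "Tmap N \<alpha> (\<alpha> + 1) \<in> cylinder N \<alpha> (d + i)"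
    using assms interior_subset by (fastforce simp: X_set_def)+
  then have second: "digit N \<alpha> (Tmap N \<alpha> \<alpha>) = d" "digit N \<alpha> (Tmap N \<alpha> (\<alpha> + 1)) = d + i"
    by (auto simp: cylinder_def)
  have mem: "digit N \<alpha> \<alpha> \<in> {d..d + i}" "digit N \<alpha> (\<alpha> + 1) \<in> {d..d + i}"
    unfolding img[symmetric] by auto
  then have "d \<in> digit N \<alpha> ` {\<alpha>..\<alpha> + 1}" "d + i \<in> digit N \<alpha> ` {\<alpha>..\<alpha> + 1}"
    unfolding img by auto
  then obtain x y where "x \<in> {\<alpha>..\<alpha> + 1}" "digit N \<alpha> x = d" "y \<in> {\<alpha>..\<alpha> + 1}" "digit N \<alpha> y = d + i"
    by fastforce
  then have first: "digit N \<alpha> \<alpha> = d + i" "digit N \<alpha> (\<alpha> + 1) = d"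
    using mem digit_antimono[of N \<alpha> \<alpha> y] digit_antimono[of N \<alpha> x "\<alpha> + 1"] assms pos by auto
  show 1: "lo1 N d i \<alpha> = Tmap N \<alpha> \<alpha>" and 2: "hi1 N d i \<alpha> = Tmap N \<alpha> (\<alpha> + 1)"
    by (simp_all add: lo1_def hi1_def Tmap_def first)
  show "lo2 N d i \<alpha> = Tmap N \<alpha> (Tmap N \<alpha> \<alpha>)"
    unfolding lo2_def 1 Tmap_def[of N \<alpha> "Tmap N \<alpha> \<alpha>"] second by simp
  show "hi2 N d i \<alpha> = Tmap N \<alpha> (Tmap N \<alpha> (\<alpha> + 1))"
    unfolding hi2_def 2 Tmap_def[of N \<alpha> "Tmap N \<alpha> (\<alpha> + 1)"] second by simp
qed

definition vertices :: "int \<Rightarrow> int \<Rightarrow> int \<Rightarrow> real \<Rightarrow> (real \<times> real) list" where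
  "vertices N d i \<alpha> =
     [(\<alpha>, ptA N d i), (hi2 N d i \<alpha>, ptA N d i), (hi2 N d i \<alpha>, ptB N d i),
      (lo1 N d i \<alpha>, ptB N d i), (lo1 N d i \<alpha>, ptC N d i), (\<alpha> + 1, ptC N d i),
      (\<alpha> + 1, ptF N d i), (lo2 N d i \<alpha>, ptF N d i), (lo2 N d i \<alpha>, ptE N d i),
      (hi1 N d i \<alpha>, ptE N d i), (hi1 N d i \<alpha>, ptD N d i), (\<alpha>, ptD N d i)]"

definition polygon_boundary :: "(real \<times> real) list \<Rightarrow> (real \<times> real) set" where
  "polygon_boundary vs =
     (\<Union>j<length vs. closed_segment (vs ! j) (vs ! (Suc j mod length vs)))"

definition polygon_region :: "(real \<times> real) list \<Rightarrow> (real \<times> real) set" where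
  "polygon_region vs = polygon_boundary vs \<union> inside (polygon_boundary vs)"

definition Omega :: "int \<Rightarrow> int \<Rightarrow> int \<Rightarrow> real \<Rightarrow> (real \<times> real) set" where
  "Omega N d i \<alpha> = polygon_region (vertices N d i \<alpha>)"

section \<open>The natural extension and its measure\<close>

text \<open>\<open>natext\<close> is a total function on the plane; it maps \<open>Omega\<close> to itself only almost
  everywhere.\<close>

definition natext :: "int \<Rightarrow> real \<Rightarrow> real \<times> real \<Rightarrow> real \<times> real" where
  "natext N \<alpha> = (\<lambda>(x, y). (Tmap N \<alpha> x, of_int N / (of_int (digit N \<alpha> x) + y)))"

definition norm_const :: "int \<Rightarrow> int \<Rightarrow> int \<Rightarrow> real \<Rightarrow> real" where
  "norm_const N d i \<alpha> = 1 / (LINT (x, y) : Omega N d i \<alpha> | lborel. N / (N + x * y)\<^sup>2)"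

text \<open>The measure lives on \<open>Omega\<close>, with the Borel sets of \<open>Omega\<close> as \<open>\<sigma>\<close>-algebra.\<close>

definition mu :: "int \<Rightarrow> int \<Rightarrow> int \<Rightarrow> real \<Rightarrow> (real \<times> real) measure" where
  "mu N d i \<alpha> =
     density (restrict_space lborel (Omega N d i \<alpha>))
       (\<lambda>(x, y). ennreal (norm_const N d i \<alpha> * (N / (N + x * y)\<^sup>2)))"

lemma space_mu: "space (mu N d i \<alpha>) = Omega N d i \<alpha>"
  by (simp add: mu_def space_restrict_space)

lemma sets_mu: "sets (mu N d i \<alpha>) = sets (restrict_space borel (Omega N d i \<alpha>))"
  by (simp add: mu_def cong: sets_restrict_space_cong)

section \<open>Metric isomorphism of dynamical systems\<close>

text \<open>Taking \<open>S = space M\<close> shows that \<open>T\<close> maps almost every point of \<open>space M\<close> to \<open>space M\<close>; nothing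
  is required of \<open>T\<close> on the remaining null set.\<close>

definition dynamical_system :: "'a measure \<Rightarrow> ('a \<Rightarrow> 'a) \<Rightarrow> bool" where
  "dynamical_system M T \<longleftrightarrow>
     prob_space M \<and>
     (\<forall>S \<in> sets M. T -` S \<inter> space M \<in> sets M \<and>
        emeasure M (T -` S \<inter> space M) = emeasure M S)"

definition metrically_isomorphic ::
  "'a measure \<Rightarrow> ('a \<Rightarrow> 'a) \<Rightarrow> 'b measure \<Rightarrow> ('b \<Rightarrow> 'b) \<Rightarrow> bool" where
  "metrically_isomorphic M T M' T' \<longleftrightarrow>
     dynamical_system M T \<and> dynamical_system M' T' \<and>
     (\<exists>X Y \<psi>. X \<in> sets M \<and> Y \<in> sets M' \<and>
        emeasure M (space M - X) = 0 \<and> emeasure M' (space M' - Y) = 0 \<and>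
        T ` X \<subseteq> X \<and> T' ` Y \<subseteq> Y \<and>
        bij_betw \<psi> X Y \<and>
        \<psi> \<in> restrict_space M X \<rightarrow>\<^sub>M restrict_space M' Y \<and>
        inv_into X \<psi> \<in> restrict_space M' Y \<rightarrow>\<^sub>M restrict_space M X \<and>
        (\<forall>S \<in> sets M'. S \<subseteq> Y \<longrightarrow> emeasure M (\<psi> -` S \<inter> X) = emeasure M' S) \<and>
        (\<forall>x \<in> X. \<psi> (T x) = T' (\<psi> x)))"

end

theory Submission
  imports Defs
begin

text \<open>Everything is a word in two maps of the open quadrant,
  \<open>J (x, y) = (N / x, N / y)\<close> and \<open>S (x, y) = (x + 1, N / (N / y - 1))\<close>. In the coordinates
  \<open>(x, - N / y)\<close> they act by the same Moebius map (\<open>u \<mapsto> N / u\<close>, respectively \<open>u \<mapsto> u + 1\<close>) on both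
  coordinates, and \<open>N / (N + x y)\<^sup>2 dx dy\<close> is invariant under this diagonal action. The
  branch of the natural extension with digit \<open>k\<close> is \<open>S\<^sup>-\<^sup>k J\<close>. Hence a bijection that is pieced
  together from such words preserves the measure (\<open>nu_isomorphism_countable_pieces\<close>), and what
  remains is to find the right bijections.

  Two bijections are needed. At the left end \<open>\<alpha> = A\<close> of the parameter interval the domain is, up
  to a null set, the square \<open>[A, A + 1] \<times> [B, B + 1]\<close> without a corner. There the digit of a point
  can be read off its image, because \<open>N / y' - k\<close> must lie in a window of length one; so the natural
  extension is invertible and preserves the measure (\<open>nu_isomorphism_base\<close>).

  For every other parameter \<open>\<gamma>\<close> there is a bijection \<open>\<psi>\<close> from this domain to \<open>Omega\<close> of \<open>\<gamma>\<close> that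
  conjugates the two natural extensions (\<open>psi_correct\<close>, \<open>psi_inv_correct\<close>, \<open>conjugacy\<close>). Points
  with \<open>x < \<gamma>\<close> have to leave and are translated by \<open>S\<close>. Write \<open>e = d + i\<close>. In one system the first
  two iterates of such a strip are taken with the digits \<open>e, d\<close>, in the other one those of its
  translate with the digits \<open>d, e\<close>, so two further strips must be moved, the second one by \<open>J S J\<close>.
  After that nothing has to be moved: the condition \<open>N (i - 1) = d e\<close> makes the orbits of \<open>\<alpha>\<close> and
  \<open>\<alpha> + 1\<close> match after three steps, in the form \<open>N / T\<^sup>2(\<alpha> + 1) = N / T\<^sup>2(\<alpha>) + 1\<close>
  (\<open>orbit_matching\<close>), and digits that differ by one absorb the difference. Composing the bijections
  for two parameters gives the isomorphism between their systems, and equal total mass makes the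
  normalising constants agree.

  All identities are to hold at every point of a forward invariant set of full measure. This is
  arranged by removing the points with a coordinate in a countable set \<open>K\<close> that contains all corner
  coordinates and is closed under \<open>u \<mapsto> u \<plusminus> 1\<close> and \<open>u \<mapsto> N / u\<close>: words in \<open>S\<close> and \<open>J\<close> carry the
  remaining points to remaining points, and every comparison with a corner is strict.\<close>

section \<open>The invariant measure of the quadrant and its partial symmetries\<close>

definition nu :: "real \<Rightarrow> (real \<times> real) measure" where
  "nu n = density lborel (\<lambda>(x, y). ennreal (n / (n + x * y)\<^sup>2))"

lemma sets_nu [simp, measurable_cong]: "sets (nu n) = sets borel"
  by (simp add: nu_def)

text \<open>With the projections measurable for the Borel sets of the plane itself, measurability is derived
  without passing through the product algebra.\<close>

lemma measurable_fst_snd_plane [measurable]: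
  "fst \<in> borel_measurable (borel :: (real \<times> real) measure)"
  "snd \<in> borel_measurable (borel :: (real \<times> real) measure)"
  by (auto intro!: borel_measurable_continuous_onI continuous_intros)

lemma nu_density_borel:
  "(\<lambda>(x, y). ennreal (n / (n + x * y)\<^sup>2)) \<in> borel_measurable (borel :: (real \<times> real) measure)"
  unfolding case_prod_beta by measurable

lemma emeasure_nu:
  assumes "S \<in> sets borel"
  shows "emeasure (nu n) S =
    (\<integral>\<^sup>+z. (case z of (x, y) \<Rightarrow> ennreal (n / (n + x * y)\<^sup>2)) * indicator S z \<partial>lborel)"
  unfolding nu_def by (rule emeasure_density) (simp_all add: assms nu_density_borel)

lemma lebesgue_integral_nu:
  assumes [measurable]: "S \<in> sets borel" and n: "n \<ge> 0"
  shows "(LINT (x, y) : S | lborel. n / (n + x * y)\<^sup>2) = enn2real (emeasure (nu n) S)"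
  unfolding set_lebesgue_integral_def
proof (subst integral_eq_nn_integral)
  let ?f = "\<lambda>z :: real \<times> real. indicator S z *\<^sub>R (case z of (x, y) \<Rightarrow> n / (n + x * y)\<^sup>2)"
  show "?f \<in> borel_measurable lborel"
    unfolding case_prod_beta by measurable
  show "AE z in lborel. 0 \<le> ?f z"
    using n by (intro AE_I2) (simp split: prod.split)
  have "(\<integral>\<^sup>+z. ennreal (?f z) \<partial>lborel) = emeasure (nu n) S"
    unfolding emeasure_nu[OF assms(1)]
    by (intro nn_integral_cong) (simp add: indicator_def split: prod.split)
  then show "enn2real (\<integral>\<^sup>+z. ennreal (?f z) \<partial>lborel) = enn2real (emeasure (nu n) S)"
    by (simp only:)
qed

lemma emeasure_nu_le:
  assumes "S \<in> sets borel" "n > 0" and nonneg: "\<And>x y. (x, y) \<in> S \<Longrightarrow> 0 \<le> x * y"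
  shows "emeasure (nu n) S \<le> ennreal (1 / n) * emeasure lborel S"
proof -
  have "n / (n + x * y)\<^sup>2 \<le> 1 / n" if "(x, y) \<in> S" for x y
  proof -
    have "n\<^sup>2 \<le> (n + x * y)\<^sup>2"
      using assms(2) nonneg[OF that] by (intro power_mono) auto
    then have "n / (n + x * y)\<^sup>2 \<le> n / n\<^sup>2"
      using assms(2) nonneg[OF that] by (intro divide_left_mono) (auto intro!: mult_pos_pos add_pos_nonneg)
    then show ?thesis
      using assms(2) by (simp add: power2_eq_square)
  qed
  then have "emeasure (nu n) S \<le> (\<integral>\<^sup>+z. ennreal (1 / n) * indicator S z \<partial>lborel)"
    unfolding emeasure_nu[OF assms(1)]
    by (intro nn_integral_mono) (auto simp: indicator_def intro: ennreal_leI)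
  also have "\<dots> = ennreal (1 / n) * emeasure lborel S"
    using assms(1) by (intro nn_integral_cmult_indicator) simp
  finally show ?thesis .
qed

lemma nu_null:
  assumes "S \<in> null_sets lborel"
  shows "S \<in> null_sets (nu n)"
proof -
  have "AE z\<in>S in lborel. (\<lambda>(x, y). ennreal (n / (n + x * y)\<^sup>2)) z = 0"
    using AE_not_in[OF assms] by (rule AE_mp) auto
  then show ?thesis
    using assms nu_density_borel unfolding nu_def by (subst null_sets_density_iff) auto
qed

text \<open>A change of variables \<open>g\<close> from \<open>P\<close> to \<open>R\<close> with Jacobian \<open>w\<close>, in a form that is closed under
  composition and restriction, so that only the reciprocal and the translation need calculus.\<close>

definition line_substitution ::
  "(real \<Rightarrow> real) \<Rightarrow> (real \<Rightarrow> real) \<Rightarrow> real set \<Rightarrow> real set \<Rightarrow> bool" where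
  "line_substitution g w P R \<longleftrightarrow>
     g \<in> borel_measurable borel \<and> w \<in> borel_measurable borel \<and> (\<forall>x. 0 \<le> w x) \<and>
     P \<in> sets borel \<and> R \<in> sets borel \<and>
     (\<forall>f :: real \<Rightarrow> ennreal. f \<in> borel_measurable borel \<longrightarrow>
        (\<integral>\<^sup>+x. f (g x) * ennreal (w x) * indicator P x \<partial>lborel) =
        (\<integral>\<^sup>+x. f x * indicator R x \<partial>lborel))"

text \<open>The library substitution rule covers increasing maps on compact intervals. It is applied to
  \<open>x \<mapsto> - n / x\<close> on intervals that exhaust the half-line.\<close>

lemma line_substitution_reciprocal:
  assumes n: "n > 0"
  shows "line_substitution (\<lambda>x. n / x) (\<lambda>x. n / x\<^sup>2) {0<..} {0<..}"
proof -
  have "(\<integral>\<^sup>+x. f (n / x) * ennreal (n / x\<^sup>2) * indicator {0<..} x \<partial>lborel) =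
        (\<integral>\<^sup>+x. f x * indicator {0<..} x \<partial>lborel)"
    if f [measurable]: "f \<in> borel_measurable borel" for f :: "real \<Rightarrow> ennreal"
  proof -
    \<comment> \<open>The offset 2 keeps the endpoints of the exhausting intervals distinct.\<close>
    define I where "I = (\<lambda>k. {1 / real (k + 2)..real (k + 2)})"
    define I' where "I' = (\<lambda>k. {n / real (k + 2)..n * real (k + 2)})"
    have [measurable]: "I k \<in> sets borel" "I' k \<in> sets borel" for k
      by (auto simp: I_def I'_def)
    have piece: "(\<integral>\<^sup>+x. f (n / x) * ennreal (n / x\<^sup>2) * indicator (I k) x \<partial>lborel) =
        (\<integral>\<^sup>+x. f x * indicator (I' k) x \<partial>lborel)" for k
    proof -
      let ?a = "1 / real (k + 2)" and ?b = "real (k + 2)"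
      have ab: "0 < ?a" "?a < ?b"
        by (auto simp: field_simps add_pos_nonneg)
      have "(\<integral>\<^sup>+x. f (- x) * indicator {- n / ?a..- n / ?b} x \<partial>lborel) =
          (\<integral>\<^sup>+x. f (- (- n / x)) * ennreal (n / x\<^sup>2) * indicator {?a..?b} x \<partial>lborel)"
      proof (rule nn_integral_substitution_aux[where g = "\<lambda>x. - n / x" and g' = "\<lambda>x. n / x\<^sup>2"])
        show "((\<lambda>x. - n / x) has_real_derivative n / x\<^sup>2) (at x)" if "x \<in> {?a..?b}" for x
          using that ab by (auto intro!: derivative_eq_intros simp: power2_eq_square)
        show "continuous_on {?a..?b} (\<lambda>x. n / x\<^sup>2)"
          using ab by (auto intro!: continuous_intros)
      qed (use n ab in auto)
      moreover have "(\<integral>\<^sup>+x. f x * indicator (I' k) x \<partial>lborel) =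
          (\<integral>\<^sup>+x. f (- x) * indicator (I' k) (- x) \<partial>lborel)"
        by (subst nn_integral_real_affine[where c = "-1" and t = 0]) auto
      moreover have "indicator (I' k) (- x) = (indicator {- n / ?a..- n / ?b} x :: ennreal)" for x
        by (auto simp: I'_def indicator_def)
      ultimately show ?thesis
        by (simp add: I_def)
    qed
    have lim: "(\<integral>\<^sup>+x. f x * indicator {0<..} x \<partial>lborel) =
        (SUP k. \<integral>\<^sup>+x. f x * indicator (J k) x \<partial>lborel)"
      if [measurable]: "f \<in> borel_measurable borel" "\<And>k. J k \<in> sets borel"
        and J: "incseq J" "(\<Union>k. J k) = {0<..}" for f :: "real \<Rightarrow> ennreal" and J
    proof (subst nn_integral_monotone_convergence_SUP[symmetric])
      show "incseq (\<lambda>k x. f x * indicator (J k) x)"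
        using J(1) by (auto simp: incseq_def le_fun_def indicator_def)
      have "f x * indicator {0<..} x = (SUP k. f x * indicator (J k) x)" for x
      proof (rule antisym)
        show "f x * indicator {0<..} x \<le> (SUP k. f x * indicator (J k) x)"
          unfolding J(2)[symmetric]
          by (cases "\<exists>k. x \<in> J k") (auto simp: indicator_def intro: SUP_upper2)
        show "(SUP k. f x * indicator (J k) x) \<le> f x * indicator {0<..} x"
          unfolding J(2)[symmetric] by (intro SUP_least) (auto simp: indicator_def)
      qed
      then show "(\<integral>\<^sup>+x. f x * indicator {0<..} x \<partial>lborel) =
          (\<integral>\<^sup>+x. (SUP k. f x * indicator (J k) x) \<partial>lborel)"
        by simp
    qed auto
    have cover: "incseq (\<lambda>k. {c / real (k + 2)..c * real (k + 2)}) \<and>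
        (\<Union>k. {c / real (k + 2)..c * real (k + 2)}) = {0<..}" if c: "c > 0" for c :: real
    proof
      show "incseq (\<lambda>k. {c / real (k + 2)..c * real (k + 2)})"
      proof (rule monoI)
        fix k l :: nat assume "k \<le> l"
        then have "c / real (l + 2) \<le> c / real (k + 2)" "c * real (k + 2) \<le> c * real (l + 2)"
          using c by (auto intro!: divide_left_mono mult_left_mono)
        then show "{c / real (k + 2)..c * real (k + 2)} \<subseteq> {c / real (l + 2)..c * real (l + 2)}"
          by auto
      qed
      have "\<exists>k. x \<in> {c / real (k + 2)..c * real (k + 2)}" if x: "x > 0" for x
      proof -
        obtain k where "max (c / x) (x / c) < real k"
          using reals_Archimedean2 by blast
        then have "c / x < real (k + 2)" "x / c < real (k + 2)"
          by auto
        then have "x \<in> {c / real (k + 2)..c * real (k + 2)}"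
          using c x by (auto simp: field_simps)
        then show ?thesis ..
      qed
      moreover have "0 < x" if "c / real (k + 2) \<le> x" for x k
        using that c by (intro less_le_trans[OF _ that]) simp
      ultimately show "(\<Union>k. {c / real (k + 2)..c * real (k + 2)}) = {0<..}"
        by (auto simp del: of_nat_add)
    qed
    have I: "incseq I" "(\<Union>k. I k) = {0<..}" and I': "incseq I'" "(\<Union>k. I' k) = {0<..}"
      using cover[of 1] cover[OF n] by (simp_all add: I_def I'_def)
    show ?thesis
      using lim[of "\<lambda>x. f (n / x) * ennreal (n / x\<^sup>2)" I] lim[of f I'] I I' piece by simp
  qed
  then show ?thesis
    using n by (auto simp: line_substitution_def)
qed

lemma line_substitution_comp:
  assumes 1: "line_substitution g w P R" and 2: "line_substitution g' w' R U"
  shows "line_substitution (\<lambda>x. g' (g x)) (\<lambda>x. w' (g x) * w x) P U"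
proof -
  have [measurable]: "g \<in> borel_measurable borel" "w \<in> borel_measurable borel"
    "g' \<in> borel_measurable borel" "w' \<in> borel_measurable borel"
    using 1 2 by (auto simp: line_substitution_def)
  have "(\<integral>\<^sup>+x. f (g' (g x)) * ennreal (w' (g x) * w x) * indicator P x \<partial>lborel) =
      (\<integral>\<^sup>+x. f x * indicator U x \<partial>lborel)"
    if [measurable]: "f \<in> borel_measurable borel" for f :: "real \<Rightarrow> ennreal"
  proof -
    have "(\<integral>\<^sup>+x. f (g' (g x)) * ennreal (w' (g x) * w x) * indicator P x \<partial>lborel) =
        (\<integral>\<^sup>+x. f (g' (g x)) * ennreal (w' (g x)) * ennreal (w x) * indicator P x \<partial>lborel)"
      using 1 2 by (intro nn_integral_cong) (auto simp: line_substitution_def ennreal_mult mult_ac)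
    also have "\<dots> = (\<integral>\<^sup>+x. f (g' x) * ennreal (w' x) * indicator R x \<partial>lborel)"
      using 1 unfolding line_substitution_def
      by (elim conjE allE[of _ "\<lambda>x. f (g' x) * ennreal (w' x)"]) simp
    also have "\<dots> = (\<integral>\<^sup>+x. f x * indicator U x \<partial>lborel)"
      using 2 by (simp add: line_substitution_def)
    finally show ?thesis .
  qed
  then show ?thesis
    using 1 2 by (auto simp: line_substitution_def)
qed

lemma line_substitution_restrict:
  assumes 1: "line_substitution g w P R" and [measurable]: "V \<in> sets borel"
  shows "line_substitution g w (P \<inter> g -` V) (R \<inter> V)"
proof -
  have [measurable]: "g \<in> borel_measurable borel" "P \<in> sets borel" "R \<in> sets borel"
    using 1 by (auto simp: line_substitution_def)
  have "P \<inter> g -` V \<in> sets borel" "R \<inter> V \<in> sets borel"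
    using measurable_sets[of g borel borel V] by auto
  moreover have "(\<integral>\<^sup>+x. f (g x) * ennreal (w x) * indicator (P \<inter> g -` V) x \<partial>lborel) =
      (\<integral>\<^sup>+x. f x * indicator (R \<inter> V) x \<partial>lborel)"
    if [measurable]: "f \<in> borel_measurable borel" for f :: "real \<Rightarrow> ennreal"
  proof -
    have "(\<integral>\<^sup>+x. f (g x) * ennreal (w x) * indicator (P \<inter> g -` V) x \<partial>lborel) =
        (\<integral>\<^sup>+x. f (g x) * indicator V (g x) * ennreal (w x) * indicator P x \<partial>lborel)"
      by (intro nn_integral_cong) (auto simp: indicator_def)
    also have "\<dots> = (\<integral>\<^sup>+x. f x * indicator V x * indicator R x \<partial>lborel)"
      using 1 unfolding line_substitution_def
      by (elim conjE allE[of _ "\<lambda>x. f x * indicator V x"]) simp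
    also have "\<dots> = (\<integral>\<^sup>+x. f x * indicator (R \<inter> V) x \<partial>lborel)"
      by (intro nn_integral_cong) (auto simp: indicator_def)
    finally show ?thesis .
  qed
  ultimately show ?thesis
    using 1 by (auto simp: line_substitution_def)
qed

lemma line_substitution_shift: "line_substitution (\<lambda>x. x + k) (\<lambda>x. 1) UNIV UNIV"
proof -
  have "(\<integral>\<^sup>+x. f (x + k) \<partial>lborel) = (\<integral>\<^sup>+x. f x \<partial>lborel)"
    if "f \<in> borel_measurable borel" for f :: "real \<Rightarrow> ennreal"
    using nn_integral_real_affine[OF that, of 1 k] by (simp add: add.commute)
  then show ?thesis
    by (simp add: line_substitution_def)
qed

lemma line_substitution_cong:
  assumes "line_substitution g w P R" "w' \<in> borel_measurable borel" "\<And>x. 0 \<le> w' x"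
    "\<And>x. x \<in> P \<Longrightarrow> w x = w' x"
  shows "line_substitution g w' P R"
proof -
  have "(\<integral>\<^sup>+x. f (g x) * ennreal (w' x) * indicator P x \<partial>lborel) =
      (\<integral>\<^sup>+x. f (g x) * ennreal (w x) * indicator P x \<partial>lborel)" for f :: "real \<Rightarrow> ennreal"
    using assms by (intro nn_integral_cong) (auto simp: indicator_def)
  then show ?thesis
    using assms by (auto simp: line_substitution_def)
qed

text \<open>Tonelli reduces a product map to its two factors; the pointwise condition on the Jacobians says
  that the two changes of variables together reproduce the density.\<close>

lemma nu_product_substitution:
  assumes n: "n > 0"
    and 1: "line_substitution g w P R" and 2: "line_substitution g' w' P' R'"
    and density: "\<And>x y. x \<in> P \<Longrightarrow> y \<in> P' \<Longrightarrow>
      n / (n + g x * g' y)\<^sup>2 * (w x * w' y) = n / (n + x * y)\<^sup>2"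
    and E: "E \<in> sets borel" "E \<subseteq> R \<times> R'"
  shows "emeasure (nu n) (map_prod g g' -` E \<inter> P \<times> P') = emeasure (nu n) E"
proof -
  have [measurable]: "g \<in> borel_measurable borel" "w \<in> borel_measurable borel"
    "g' \<in> borel_measurable borel" "w' \<in> borel_measurable borel"
    "P \<in> sets borel" "P' \<in> sets borel" "R \<in> sets borel" "R' \<in> sets borel"
    and w: "0 \<le> w x" "0 \<le> w' x" for x
    using 1 2 by (auto simp: line_substitution_def)
  have [measurable]: "E \<in> sets (borel \<Otimes>\<^sub>M borel)"
    unfolding borel_prod by (rule E(1))
  have [measurable]: "map_prod g g' \<in> borel \<Otimes>\<^sub>M borel \<rightarrow>\<^sub>M borel \<Otimes>\<^sub>M borel"
    unfolding map_prod_def by measurable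
  define h where "h = (\<lambda>x y. ennreal (n / (n + x * y)\<^sup>2))"
  have meas [measurable]: "case_prod h \<in> borel_measurable (borel \<Otimes>\<^sub>M borel)"
    unfolding h_def by measurable
  have iter: "emeasure (nu n) S = (\<integral>\<^sup>+x. \<integral>\<^sup>+y. h x y * indicator S (x, y) \<partial>lborel \<partial>lborel)"
    if [measurable]: "S \<in> sets (borel \<Otimes>\<^sub>M borel)" for S
  proof -
    have "emeasure (nu n) S = (\<integral>\<^sup>+z. case_prod h z * indicator S z \<partial>(lborel \<Otimes>\<^sub>M lborel))"
      unfolding nu_def h_def lborel_prod
      using that by (subst emeasure_density) (simp_all add: meas[unfolded h_def borel_prod] flip: borel_prod)
    also have "\<dots> = (\<integral>\<^sup>+x. \<integral>\<^sup>+y. h x y * indicator S (x, y) \<partial>lborel \<partial>lborel)"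
      by (subst lborel.nn_integral_fst[symmetric]) auto
    finally show ?thesis .
  qed
  have swap1: "(\<integral>\<^sup>+x. f (g x) * ennreal (w x) * indicator P x \<partial>lborel) =
      (\<integral>\<^sup>+x. f x * indicator R x \<partial>lborel)"
    if "f \<in> borel_measurable borel" for f :: "real \<Rightarrow> ennreal"
    using that 1 by (simp add: line_substitution_def)
  have swap2: "(\<integral>\<^sup>+x. f (g' x) * ennreal (w' x) * indicator P' x \<partial>lborel) =
      (\<integral>\<^sup>+x. f x * indicator R' x \<partial>lborel)"
    if "f \<in> borel_measurable borel" for f :: "real \<Rightarrow> ennreal"
    using that 2 by (simp add: line_substitution_def)
  have "map_prod g g' -` E \<inter> P \<times> P' \<in> sets (borel \<Otimes>\<^sub>M borel)"
    using measurable_sets[of "map_prod g g'" "borel \<Otimes>\<^sub>M borel" "borel \<Otimes>\<^sub>M borel" E]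
    by (auto simp: space_pair_measure)
  then have "emeasure (nu n) (map_prod g g' -` E \<inter> P \<times> P') =
      (\<integral>\<^sup>+x. \<integral>\<^sup>+y. h x y * indicator (map_prod g g' -` E \<inter> P \<times> P') (x, y) \<partial>lborel \<partial>lborel)"
    by (rule iter)
  also have "\<dots> = (\<integral>\<^sup>+x. (\<integral>\<^sup>+y. h (g x) (g' y) * indicator E (g x, g' y) * ennreal (w' y)
      * indicator P' y \<partial>lborel) * ennreal (w x) * indicator P x \<partial>lborel)"
  proof (rule nn_integral_cong, goal_cases)
    case (1 x)
    have "h x y * indicator (map_prod g g' -` E \<inter> P \<times> P') (x, y) =
        h (g x) (g' y) * indicator E (g x, g' y) * ennreal (w' y) * indicator P' y
          * (ennreal (w x) * indicator P x)" for y
    proof (cases "x \<in> P \<and> y \<in> P'")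
      case True
      then have "h x y = h (g x) (g' y) * ennreal (w' y) * ennreal (w x)"
        using density[of x y] w(1)[of x] w(2)[of y] n
        by (simp add: h_def ennreal_mult'[symmetric] mult.assoc mult.commute[of "w x"])
      then show ?thesis
        using True by (simp add: indicator_def)
    qed (auto simp: indicator_def)
    then have "(\<integral>\<^sup>+y. h x y * indicator (map_prod g g' -` E \<inter> P \<times> P') (x, y) \<partial>lborel) =
        (\<integral>\<^sup>+y. h (g x) (g' y) * indicator E (g x, g' y) * ennreal (w' y) * indicator P' y
          * (ennreal (w x) * indicator P x) \<partial>lborel)"
      by (simp only:)
    also have "\<dots> = (\<integral>\<^sup>+y. h (g x) (g' y) * indicator E (g x, g' y) * ennreal (w' y)
        * indicator P' y \<partial>lborel) * (ennreal (w x) * indicator P x)"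
      by (rule nn_integral_multc) measurable
    finally show ?case
      by (simp only: mult.assoc)
  qed
  also have "\<dots> = (\<integral>\<^sup>+x. (\<integral>\<^sup>+y. h (g x) y * indicator E (g x, y) * indicator R' y \<partial>lborel)
      * ennreal (w x) * indicator P x \<partial>lborel)"
    by (subst swap2) auto
  also have "\<dots> = (\<integral>\<^sup>+x. (\<integral>\<^sup>+y. h x y * indicator E (x, y) * indicator R' y \<partial>lborel)
      * indicator R x \<partial>lborel)"
    by (rule swap1) measurable
  also have "\<dots> = (\<integral>\<^sup>+x. \<integral>\<^sup>+y. h x y * indicator E (x, y) \<partial>lborel \<partial>lborel)"
  proof (intro nn_integral_cong, goal_cases)
    case (1 x)
    have "(\<integral>\<^sup>+y. h x y * indicator E (x, y) * indicator R' y \<partial>lborel) * indicator R x =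
        (\<integral>\<^sup>+y. h x y * indicator E (x, y) * indicator R' y * indicator R x \<partial>lborel)"
      by (simp add: nn_integral_multc)
    also have "\<dots> = (\<integral>\<^sup>+y. h x y * indicator E (x, y) \<partial>lborel)"
      using E(2) by (intro nn_integral_cong) (auto simp: indicator_def)
    finally show ?case .
  qed
  also have "\<dots> = emeasure (nu n) E"
    by (rule iter[symmetric]) simp
  finally show ?thesis .
qed

text \<open>A measure preserving Borel bijection \<open>g\<close> between Borel sets \<open>P\<close> and \<open>R\<close>. The inverse \<open>h\<close> is part
  of the data; hence images of Borel sets are preimages under \<open>h\<close> and cause no measurability problem.\<close>

definition nu_isomorphism where
  "nu_isomorphism n P g R h \<longleftrightarrow>
     P \<in> sets borel \<and> R \<in> sets borel \<and>
     g \<in> borel_measurable borel \<and> h \<in> borel_measurable borel \<and>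
     (\<forall>z\<in>P. g z \<in> R \<and> h (g z) = z) \<and> (\<forall>z\<in>R. h z \<in> P \<and> g (h z) = z) \<and>
     (\<forall>E\<in>sets borel. E \<subseteq> R \<longrightarrow> emeasure (nu n) (g -` E \<inter> P) = emeasure (nu n) E)"

lemma nu_isomorphism_id: "P \<in> sets borel \<Longrightarrow> nu_isomorphism n P (\<lambda>z. z) P (\<lambda>z. z)"
  by (auto simp: nu_isomorphism_def Int_absorb2)

lemma nu_isomorphism_sym:
  assumes "nu_isomorphism n P g R h"
  shows "nu_isomorphism n R h P g"
proof -
  note iso = assms[unfolded nu_isomorphism_def]
  have "emeasure (nu n) (h -` E \<inter> R) = emeasure (nu n) E" if E: "E \<in> sets borel" "E \<subseteq> P" for E
  proof -
    have "h -` E \<inter> R \<in> sets borel"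
      using measurable_sets[of h borel borel E] iso E by auto
    then have "emeasure (nu n) (h -` E \<inter> R) = emeasure (nu n) (g -` (h -` E \<inter> R) \<inter> P)"
      using iso by auto
    also have "g -` (h -` E \<inter> R) \<inter> P = E"
      using iso E by auto
    finally show ?thesis .
  qed
  then show ?thesis
    using iso by (simp add: nu_isomorphism_def)
qed

lemma nu_isomorphism_comp:
  assumes 1: "nu_isomorphism n P g R h" and 2: "nu_isomorphism n P' g' R' h'"
  shows "nu_isomorphism n (P \<inter> g -` P') (\<lambda>z. g' (g z)) (R' \<inter> h' -` R) (\<lambda>z. h (h' z))"
proof -
  note 1 = 1[unfolded nu_isomorphism_def] and 2 = 2[unfolded nu_isomorphism_def]
  have [measurable]: "g \<in> borel_measurable borel" "h \<in> borel_measurable borel"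
    "g' \<in> borel_measurable borel" "h' \<in> borel_measurable borel"
    using 1 2 by auto
  have "P \<inter> g -` P' \<in> sets borel" "R' \<inter> h' -` R \<in> sets borel"
    using 1 2 measurable_sets[of g borel borel P'] measurable_sets[of h' borel borel R] by auto
  moreover have "emeasure (nu n) ((\<lambda>z. g' (g z)) -` E \<inter> (P \<inter> g -` P')) = emeasure (nu n) E"
    if E: "E \<in> sets borel" "E \<subseteq> R' \<inter> h' -` R" for E
  proof -
    have "g' -` E \<inter> P' \<in> sets borel"
      using measurable_sets[of g' borel borel E] E 2 by auto
    moreover have "g' -` E \<inter> P' \<subseteq> R"
      using E 2 by fastforce
    ultimately have "emeasure (nu n) (g -` (g' -` E \<inter> P') \<inter> P) = emeasure (nu n) (g' -` E \<inter> P')"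
      using 1 by auto
    also have "\<dots> = emeasure (nu n) E"
      using 2 E by auto
    also have "g -` (g' -` E \<inter> P') \<inter> P = (\<lambda>z. g' (g z)) -` E \<inter> (P \<inter> g -` P')"
      by auto
    finally show ?thesis .
  qed
  ultimately show ?thesis
    using 1 2 by (auto simp: nu_isomorphism_def)
qed

lemma nu_isomorphism_comp_exact:
  assumes 1: "nu_isomorphism n P g R h" and 2: "nu_isomorphism n R g' U h'"
  shows "nu_isomorphism n P (\<lambda>z. g' (g z)) U (\<lambda>z. h (h' z))"
proof -
  have "P \<inter> g -` R = P" "U \<inter> h' -` R = U"
    using 1 2 unfolding nu_isomorphism_def by blast+
  then show ?thesis
    using nu_isomorphism_comp[OF 1 2] by (simp only:)
qed

lemma nu_isomorphism_emeasure:
  assumes "nu_isomorphism n P g R h"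
  shows "emeasure (nu n) P = emeasure (nu n) R"
proof -
  have "g -` R \<inter> P = P"
    using assms unfolding nu_isomorphism_def by blast
  then show ?thesis
    using assms unfolding nu_isomorphism_def by (metis order_refl)
qed

lemma nu_isomorphism_cong:
  assumes 1: "nu_isomorphism n P g R h" and 2: "g' \<in> borel_measurable borel" "\<And>z. z \<in> P \<Longrightarrow> g' z = g z"
  shows "nu_isomorphism n P g' R h"
proof -
  have "g' -` E \<inter> P = g -` E \<inter> P" for E
    using 2 by auto
  moreover have "\<forall>z\<in>P. g' z \<in> R \<and> h (g' z) = z" "\<forall>z\<in>R. h z \<in> P \<and> g' (h z) = z"
    using 1 2(2) unfolding nu_isomorphism_def by metis+
  ultimately show ?thesis
    using 1 2(1) unfolding nu_isomorphism_def by (simp only:) blast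
qed

text \<open>A bijection that agrees on each of countably many Borel sets with some measure preserving map
  preserves the measure: after making the sets disjoint, the corresponding pieces of the target
  are disjoint as well, and the measures add up.\<close>

lemma nu_isomorphism_piecewise:
  fixes P R :: "nat \<Rightarrow> (real \<times> real) set"
  assumes pieces: "\<And>k. nu_isomorphism n (P k) (g k) (R k) (h k)"
    and X: "X \<in> sets borel" "\<psi> \<in> borel_measurable borel"
    and Y: "Y \<in> sets borel" "\<phi> \<in> borel_measurable borel"
    and inverse: "\<And>z. z \<in> X \<Longrightarrow> \<psi> z \<in> Y \<and> \<phi> (\<psi> z) = z" "\<And>z. z \<in> Y \<Longrightarrow> \<phi> z \<in> X \<and> \<psi> (\<phi> z) = z"
    and cover: "\<And>z. z \<in> X \<Longrightarrow> \<exists>k. z \<in> P k \<and> \<psi> z = g k z"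
  shows "nu_isomorphism n X \<psi> Y \<phi>"
proof -
  have Pk: "P k \<in> sets borel" "g k \<in> borel_measurable borel" for k
    using pieces[of k] by (auto simp: nu_isomorphism_def)
  define X' where "X' = (\<lambda>k. {z \<in> X. z \<in> P k \<and> \<psi> z = g k z})"
  define D where "D = disjointed X'"
  have X': "X' k \<in> sets borel" for k
  proof -
    have "(\<lambda>z. dist (\<psi> z) (g k z)) \<in> borel_measurable borel"
      using X(2) Pk(2) by (rule borel_measurable_dist)
    from measurable_sets[OF this, of "{0}"] have "{z. \<psi> z = g k z} \<in> sets borel"
      by (simp add: vimage_def)
    then have "X \<inter> P k \<inter> {z. \<psi> z = g k z} \<in> sets borel"
      using X(1) Pk(1) by auto
    then show ?thesis
      by (auto simp: X'_def Collect_conj_eq Int_assoc)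
  qed
  then have D: "D k \<in> sets borel" for k
    unfolding D_def using sets.range_disjointed_sets[of X' borel] by auto
  have D_sub: "z \<in> X" "z \<in> P k" "\<psi> z = g k z" if "z \<in> D k" for z k
    using that disjointed_subset[of X' k] by (auto simp: D_def X'_def)
  have D_disj: "disjoint_family D"
    unfolding D_def by (rule disjoint_family_disjointed)
  have D_Un: "(\<Union>k. D k) = X"
    using cover by (auto simp: D_def UN_disjointed_eq X'_def)
  have "emeasure (nu n) (\<psi> -` E \<inter> X) = emeasure (nu n) E" if E: "E \<in> sets borel" "E \<subseteq> Y" for E
  proof -
    define F where "F = (\<lambda>k. E \<inter> \<phi> -` D k)"
    have F: "F k \<in> sets borel" for k
      using measurable_sets[OF Y(2) D[of k]] E by (auto simp: F_def)
    have Fsub: "F k \<subseteq> R k" for k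
    proof
      fix w assume "w \<in> F k"
      then have w: "w \<in> Y" "\<phi> w \<in> D k"
        using E by (auto simp: F_def)
      then have "w = g k (\<phi> w)" "\<phi> w \<in> P k"
        using inverse(2)[of w] D_sub[of "\<phi> w" k] by auto
      then show "w \<in> R k"
        using pieces[of k] unfolding nu_isomorphism_def by metis
    qed
    have eq: "g k -` F k \<inter> P k = \<psi> -` E \<inter> D k" for k
    proof (intro set_eqI iffI)
      fix z assume z: "z \<in> g k -` F k \<inter> P k"
      then have w: "g k z \<in> Y" "\<phi> (g k z) \<in> D k"
        using E by (auto simp: F_def)
      then have *: "g k (\<phi> (g k z)) = g k z" "\<phi> (g k z) \<in> P k"
        using inverse(2)[of "g k z"] D_sub[of "\<phi> (g k z)" k] by auto
      then have "\<phi> (g k z) = z"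
        using pieces[of k] z unfolding nu_isomorphism_def by (metis IntD2)
      then show "z \<in> \<psi> -` E \<inter> D k"
        using w z D_sub[of z k] by (auto simp: F_def)
    next
      fix z assume z: "z \<in> \<psi> -` E \<inter> D k"
      then show "z \<in> g k -` F k \<inter> P k"
        using D_sub[of z k] inverse(1)[of z] by (auto simp: F_def)
    qed
    have "emeasure (nu n) (\<psi> -` E \<inter> D k) = emeasure (nu n) (F k)" for k
      using pieces[of k] F[of k] Fsub[of k] unfolding nu_isomorphism_def eq[symmetric] by blast
    moreover have "emeasure (nu n) (\<psi> -` E \<inter> X) = (\<Sum>k. emeasure (nu n) (\<psi> -` E \<inter> D k))"
    proof (subst suminf_emeasure)
      have "\<psi> -` E \<in> sets borel"
        using measurable_sets[OF X(2) E(1)] by simp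
      then show "range (\<lambda>k. \<psi> -` E \<inter> D k) \<subseteq> sets (nu n)"
        using D by auto
      show "disjoint_family (\<lambda>k. \<psi> -` E \<inter> D k)"
        using D_disj by (auto simp: disjoint_family_on_def)
      show "emeasure (nu n) (\<psi> -` E \<inter> X) = emeasure (nu n) (\<Union>k. \<psi> -` E \<inter> D k)"
        by (simp flip: D_Un)
    qed
    moreover have "emeasure (nu n) E = (\<Sum>k. emeasure (nu n) (F k))"
    proof (subst suminf_emeasure)
      show "range F \<subseteq> sets (nu n)"
        using F by auto
      show "disjoint_family F"
        using D_disj unfolding disjoint_family_on_def F_def by blast
      have "E = (\<Union>k. F k)"
      proof (intro set_eqI iffI)
        fix w assume w: "w \<in> E"
        then have "\<phi> w \<in> (\<Union>k. D k)"
          using inverse(2)[of w] E(2) by (auto simp: D_Un)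
        then show "w \<in> (\<Union>k. F k)"
          using w by (auto simp: F_def)
      qed (auto simp: F_def)
      then show "emeasure (nu n) E = emeasure (nu n) (\<Union>k. F k)"
        by simp
    qed
    ultimately show ?thesis
      by simp
  qed
  then show ?thesis
    using X Y inverse by (auto simp: nu_isomorphism_def)
qed

text \<open>For the pieces of a larger map only the map itself matters, not its range or its inverse.\<close>

definition nu_local :: "real \<Rightarrow> (real \<times> real) set \<Rightarrow> (real \<times> real \<Rightarrow> real \<times> real) \<Rightarrow> bool" where
  "nu_local n P g \<longleftrightarrow> (\<exists>R h. nu_isomorphism n P g R h)"

lemma nu_local_comp:
  assumes "nu_local n P g" "nu_local n P' g'"
  shows "nu_local n (P \<inter> g -` P') (\<lambda>z. g' (g z))"
  using assms nu_isomorphism_comp unfolding nu_local_def by blast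

lemma nu_isomorphism_countable_pieces:
  assumes "countable \<P>" and pieces: "\<And>P g. (P, g) \<in> \<P> \<Longrightarrow> nu_local n P g"
    and X: "X \<in> sets borel" "\<psi> \<in> borel_measurable borel"
    and Y: "Y \<in> sets borel" "\<phi> \<in> borel_measurable borel"
    and inverse: "\<And>z. z \<in> X \<Longrightarrow> \<psi> z \<in> Y \<and> \<phi> (\<psi> z) = z" "\<And>z. z \<in> Y \<Longrightarrow> \<phi> z \<in> X \<and> \<psi> (\<phi> z) = z"
    and cover: "\<And>z. z \<in> X \<Longrightarrow> \<exists>(P, g)\<in>\<P>. z \<in> P \<and> \<psi> z = g z"
  shows "nu_isomorphism n X \<psi> Y \<phi>"
proof -
  \<comment> \<open>The identity piece only makes the collection nonempty, so that it can be enumerated.\<close>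
  define \<P>' where "\<P>' = insert (UNIV, \<lambda>z. z) \<P>"
  define p where "p = from_nat_into \<P>'"
  have \<P>': "countable \<P>'" "\<P>' \<noteq> {}"
    using assms(1) by (auto simp: \<P>'_def)
  have "nu_local n P g" if "(P, g) \<in> \<P>'" for P g
    using that pieces nu_isomorphism_id[of UNIV n] by (auto simp: \<P>'_def nu_local_def)
  then have "nu_local n (fst (p k)) (snd (p k))" for k
    using from_nat_into[OF \<P>'(2), of k] by (auto simp: p_def)
  then obtain R h where piece: "nu_isomorphism n (fst (p k)) (snd (p k)) (R k) (h k)" for k
    unfolding nu_local_def by metis
  show ?thesis
  proof (rule nu_isomorphism_piecewise[OF piece X Y inverse])
    fix z assume "z \<in> X"
    then obtain P g where Pg: "(P, g) \<in> \<P>" "z \<in> P" "\<psi> z = g z"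
      using cover by blast
    then have "(P, g) \<in> range p"
      using range_from_nat_into[OF \<P>'(2,1)] by (auto simp: p_def \<P>'_def)
    then obtain k where "p k = (P, g)"
      by (metis imageE)
    then show "\<exists>k. z \<in> fst (p k) \<and> \<psi> z = snd (p k) z"
      using Pg by (intro exI[of _ k]) simp
  qed
qed

text \<open>\<open>inversion\<close> and \<open>shift\<close> are the maps \<open>J\<close> and \<open>S\<^sup>k\<close>. The second coordinate of \<open>shift\<close> is the
  translation \<open>u \<mapsto> u - k\<close> conjugated by \<open>y \<mapsto> n / y\<close>; on \<open>shift_dom\<close> both coordinates of the image
  are positive.\<close>

definition inversion :: "real \<Rightarrow> real \<times> real \<Rightarrow> real \<times> real" where
  "inversion n = map_prod (\<lambda>x. n / x) (\<lambda>y. n / y)"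

definition shift :: "real \<Rightarrow> real \<Rightarrow> real \<times> real \<Rightarrow> real \<times> real" where
  "shift n k = map_prod (\<lambda>x. x + k) (\<lambda>y. n / (n / y - k))"

definition quadrant :: "(real \<times> real) set" where
  "quadrant = {0<..} \<times> {0<..}"

definition shift_dom :: "real \<Rightarrow> real \<Rightarrow> (real \<times> real) set" where
  "shift_dom n k = ({0<..} \<inter> {- k<..}) \<times> ({0<..} \<inter> (\<lambda>y. n / y) -` {k<..})"

lemma measurable_map_prod_borel:
  fixes g g' :: "real \<Rightarrow> real"
  assumes [measurable]: "g \<in> borel_measurable borel" "g' \<in> borel_measurable borel"
  shows "map_prod g g' \<in> borel_measurable borel"
proof -
  have "map_prod g g' \<in> borel \<Otimes>\<^sub>M borel \<rightarrow>\<^sub>M borel \<Otimes>\<^sub>M borel"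
    unfolding map_prod_def by measurable
  then show ?thesis
    by (simp add: borel_prod)
qed

lemma nu_isomorphism_inversion:
  assumes n: "n > 0"
  shows "nu_isomorphism n quadrant (inversion n) quadrant (inversion n)"
proof -
  have "emeasure (nu n) (inversion n -` E \<inter> quadrant) = emeasure (nu n) E"
    if E: "E \<in> sets borel" "E \<subseteq> quadrant" for E
    unfolding inversion_def quadrant_def
  proof (rule nu_product_substitution[OF n line_substitution_reciprocal[OF n]
        line_substitution_reciprocal[OF n] _ E[unfolded quadrant_def]])
    fix x y :: real assume "x \<in> {0<..}" "y \<in> {0<..}"
    then have pos: "x > 0" "y > 0" "n + x * y > 0"
      using n by (auto intro!: add_pos_pos mult_pos_pos)
    define c where "c = n + x * y"
    have "n + n / x * (n / y) = n * c / (x * y)"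
      using pos by (simp add: c_def distrib_left add_divide_distrib)
    moreover have "n / (n * c / (x * y))\<^sup>2 * (n / x\<^sup>2 * (n / y\<^sup>2)) = n / c\<^sup>2"
      using pos n by (simp add: power_mult_distrib power_divide power2_eq_square flip: c_def)
    ultimately show "n / (n + n / x * (n / y))\<^sup>2 * (n / x\<^sup>2 * (n / y\<^sup>2)) = n / (n + x * y)\<^sup>2"
      by (simp add: c_def)
  qed
  moreover have "quadrant \<in> sets borel"
    by (auto simp: quadrant_def simp flip: borel_prod)
  moreover have "inversion n \<in> borel_measurable borel"
    unfolding inversion_def by (intro measurable_map_prod_borel) auto
  ultimately show ?thesis
    using n by (auto simp: nu_isomorphism_def) (auto simp: inversion_def quadrant_def)
qed

lemma nu_isomorphism_shift:
  assumes n: "n > 0"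
  shows "nu_isomorphism n (shift_dom n k) (shift n k) (shift_dom n (- k)) (shift n (- k))"
proof -
  let ?w = "\<lambda>y. n\<^sup>2 / (n - k * y)\<^sup>2"
  have x: "line_substitution (\<lambda>x. x + k) (\<lambda>x. 1) ({0<..} \<inter> {- k<..}) ({0<..} \<inter> {- (- k)<..})"
  proof -
    have "(UNIV \<inter> (\<lambda>x. x + k) -` ({0<..} \<inter> {k<..})) = ({0<..} \<inter> {- k<..})"
      by auto
    then show ?thesis
      using line_substitution_restrict[OF line_substitution_shift[of k], of "{0<..} \<inter> {k<..}"]
      by simp
  qed
  have y: "line_substitution (\<lambda>y. n / (n / y - k)) ?w
      ({0<..} \<inter> (\<lambda>y. n / y) -` {k<..}) ({0<..} \<inter> (\<lambda>y. n / y) -` {- k<..})"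
  proof -
    have 1: "line_substitution (\<lambda>y. n / y) (\<lambda>y. n / y\<^sup>2) ({0<..} \<inter> (\<lambda>y. n / y) -` {k<..}) ({0<..} \<inter> {k<..})"
      by (rule line_substitution_restrict[OF line_substitution_reciprocal[OF n]]) auto
    have "(UNIV \<inter> (\<lambda>x. x + (- k)) -` ({0<..} \<inter> {- k<..})) = ({0<..} \<inter> {k<..})"
      by auto
    then have 2: "line_substitution (\<lambda>x. x + (- k)) (\<lambda>x. 1) ({0<..} \<inter> {k<..}) ({0<..} \<inter> {- k<..})"
      using line_substitution_restrict[OF line_substitution_shift[of "- k"], of "{0<..} \<inter> {- k<..}"]
      by simp
    have 3: "line_substitution (\<lambda>y. n / y) (\<lambda>y. n / y\<^sup>2) ({0<..} \<inter> {- k<..}) ({0<..} \<inter> (\<lambda>y. n / y) -` {- k<..})"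
    proof -
      have "{0<..} \<inter> (\<lambda>y. n / y) -` ((\<lambda>y. n / y) -` {- k<..}) = {0<..} \<inter> {- k<..}"
        using n by auto
      then show ?thesis
        using line_substitution_restrict[OF line_substitution_reciprocal[OF n], of "(\<lambda>y. n / y) -` {- k<..}"]
          measurable_sets[of "\<lambda>y. n / y" borel borel "{- k<..}"] by simp
    qed
    show ?thesis
    proof (rule line_substitution_cong)
      show "line_substitution (\<lambda>y. n / (n / y - k))
          (\<lambda>y. n / (n / y - k)\<^sup>2 * (1 * (n / y\<^sup>2)))
          ({0<..} \<inter> (\<lambda>y. n / y) -` {k<..}) ({0<..} \<inter> (\<lambda>y. n / y) -` {- k<..})"
        using line_substitution_comp[OF line_substitution_comp[OF 1 2] 3] by simp
      fix y assume "y \<in> {0<..} \<inter> (\<lambda>y. n / y) -` {k<..}"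
      then have y: "y > 0" "n - k * y > 0"
        by (auto simp: field_simps)
      then have "n / y - k = (n - k * y) / y"
        by (simp add: field_simps)
      then show "n / (n / y - k)\<^sup>2 * (1 * (n / y\<^sup>2)) = n\<^sup>2 / (n - k * y)\<^sup>2"
        using y by (simp add: power_divide power2_eq_square)
    qed auto
  qed
  have "emeasure (nu n) (shift n k -` E \<inter> shift_dom n k) = emeasure (nu n) E"
    if E: "E \<in> sets borel" "E \<subseteq> shift_dom n (- k)" for E
    unfolding shift_def shift_dom_def
  proof (rule nu_product_substitution[OF n x y _ E[unfolded shift_dom_def]])
    fix x y assume "x \<in> {0<..} \<inter> {- k<..}" "y \<in> {0<..} \<inter> (\<lambda>y. n / y) -` {k<..}"
    then have pos: "x > 0" "y > 0" "n - k * y > 0"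
      using n by (auto simp: field_simps)
    then have "n + x * y > 0"
      using n by (intro add_pos_pos mult_pos_pos)
    define c b where "c = n + x * y" and "b = n - k * y"
    have "n / y - k = b / y"
      using pos by (simp add: b_def diff_divide_distrib)
    moreover have "n + (x + k) * (n / (b / y)) = n * c / b"
      using pos unfolding b_def c_def by (simp add: divide_simps) (simp add: algebra_simps)
    moreover have "n / (n * c / b)\<^sup>2 * (1 * (n\<^sup>2 / b\<^sup>2)) = n / c\<^sup>2"
      using pos n \<open>n + x * y > 0\<close>
      by (simp add: power_mult_distrib power_divide power2_eq_square flip: c_def b_def)
    ultimately show "n / (n + (x + k) * (n / (n / y - k)))\<^sup>2 * (1 * ?w y) = n / (n + x * y)\<^sup>2"
      by (simp add: c_def b_def)
  qed
  moreover have "shift_dom n k \<in> sets borel" for k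
    using measurable_sets[of "\<lambda>y. n / y" borel borel "{k<..}"]
    by (auto simp: shift_dom_def simp flip: borel_prod)
  moreover have "shift n k \<in> borel_measurable borel" for k
    unfolding shift_def by (intro measurable_map_prod_borel) auto
  moreover have "shift n l z \<in> shift_dom n (- l) \<and> shift n (- l) (shift n l z) = z"
    if z: "z \<in> shift_dom n l" for l z
  proof -
    obtain x y where xy: "z = (x, y)" "x > 0" "x + l > 0" "y > 0" "n / y - l > 0"
      using z by (cases z) (auto simp: shift_dom_def)
    have eq: "n / (n / (n / y - l)) = n / y - l" "n / (n / y) = y"
      using n by simp_all
    have "n / (n / y - l) > 0"
      using n xy by (intro divide_pos_pos) auto
    moreover have "n / y > 0"
      using n xy by simp
    ultimately show ?thesis
      using xy eq by (simp add: shift_def shift_dom_def)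
  qed
  from this[of _ k] this[of _ "- k"] have
    "\<forall>z\<in>shift_dom n k. shift n k z \<in> shift_dom n (- k) \<and> shift n (- k) (shift n k z) = z"
    "\<forall>z\<in>shift_dom n (- k). shift n (- k) z \<in> shift_dom n k \<and> shift n k (shift n (- k) z) = z"
    by auto
  ultimately show ?thesis
    by (simp add: nu_isomorphism_def)
qed

section \<open>The polygon as a staircase region\<close>

text \<open>A rectangle without two corner steps at the lower right and two at the upper left. The
  description by conditions stays correct when steps degenerate to length zero.\<close>

definition staircase :: "real \<Rightarrow> real \<Rightarrow> real \<Rightarrow> real \<Rightarrow> real \<Rightarrow> real \<Rightarrow>
    real \<Rightarrow> real \<Rightarrow> real \<Rightarrow> real \<Rightarrow> real \<Rightarrow> real \<Rightarrow> (real \<times> real) set" where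
  "staircase a b h2 l1 l2 h1 A B C D E F =
     {(x, y). a \<le> x \<and> x \<le> b \<and> A \<le> y \<and> y \<le> F \<and> (h2 < x \<longrightarrow> B \<le> y) \<and> (l1 < x \<longrightarrow> C \<le> y) \<and>
        (x < l2 \<longrightarrow> y \<le> E) \<and> (x < h1 \<longrightarrow> y \<le> D)}"

lemma closed_segment_horizontal:
  fixes a b y :: real
  shows "closed_segment (a, y) (b, y) = closed_segment a b \<times> {y}"
  by (force simp: closed_segment_def algebra_simps)

lemma closed_segment_vertical:
  fixes x a b :: real
  shows "closed_segment (x, a) (x, b) = {x} \<times> closed_segment a b"
  by (force simp: closed_segment_def algebra_simps)

text \<open>A point outside the staircase escapes to infinity along a vertical ray, up or down, that avoids
  the staircase and so the boundary. A component of the complement of the boundary that meets the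
  staircase cannot leave it, because the staircase minus the boundary is open.\<close>

lemma polygon_region_staircase:
  assumes y: "A < B" "B < C" "C < E" "E < F" "B < D" "D < E"
    and x: "a \<le> h2" "h2 \<le> l1" "l1 \<le> b" "a \<le> h1" "h1 \<le> l2" "l2 \<le> b" "h2 < l2" "h1 \<le> l1" "a < b"
  shows "polygon_region [(a, A), (h2, A), (h2, B), (l1, B), (l1, C), (b, C),
      (b, F), (l2, F), (l2, E), (h1, E), (h1, D), (a, D)] = staircase a b h2 l1 l2 h1 A B C D E F"
    and "compact (staircase a b h2 l1 l2 h1 A B C D E F)"
proof -
  let ?vs = "[(a, A), (h2, A), (h2, B), (l1, B), (l1, C), (b, C),
      (b, F), (l2, F), (l2, E), (h1, E), (h1, D), (a, D)]"
  define S where "S = polygon_boundary ?vs"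
  define G where "G = staircase a b h2 l1 l2 h1 A B C D E F"
  \<comment> \<open>The staircase with all inequalities strict.\<close>
  define U where "U = {a<..<b} \<times> {A<..<F} \<inter> ({..<h2} \<times> UNIV \<union> UNIV \<times> {B<..}) \<inter>
    ({..<l1} \<times> UNIV \<union> UNIV \<times> {C<..}) \<inter> ({l2<..} \<times> UNIV \<union> UNIV \<times> {..<E}) \<inter>
    ({h1<..} \<times> UNIV \<union> UNIV \<times> {..<D})"
  have G_eq: "G = {a..b} \<times> {A..F} \<inter> ({..h2} \<times> UNIV \<union> UNIV \<times> {B..}) \<inter>
    ({..l1} \<times> UNIV \<union> UNIV \<times> {C..}) \<inter> ({l2..} \<times> UNIV \<union> UNIV \<times> {..E}) \<inter>
    ({h1..} \<times> UNIV \<union> UNIV \<times> {..D})"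
    by (auto simp: G_def staircase_def)
  have "compact ({a..b} \<times> {A..F})"
    by (intro compact_Times) auto
  then have compact_G: "compact G"
    unfolding G_eq Int_assoc
    by (rule compact_Int_closed) (intro closed_Int closed_Un closed_Times; simp)
  have open_U: "open U"
    unfolding U_def by (intro open_Int open_Un open_Times; simp)
  have S: "S = {a..h2} \<times> {A} \<union> {h2} \<times> {A..B} \<union> {h2..l1} \<times> {B} \<union> {l1} \<times> {B..C} \<union>
      {l1..b} \<times> {C} \<union> {b} \<times> {C..F} \<union> {l2..b} \<times> {F} \<union> {l2} \<times> {E..F} \<union>
      {h1..l2} \<times> {E} \<union> {h1} \<times> {D..E} \<union> {a..h1} \<times> {D} \<union> {a} \<times> {A..D}"
  proof -
    have "{..<length ?vs} = {0, 1, 2, 3, 4, 5, 6, 7, 8, 9, 10, 11}"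
      by (auto simp: numeral_eq_Suc less_Suc_eq)
    then show ?thesis
      using x y unfolding S_def polygon_boundary_def
      by (simp add: closed_segment_horizontal closed_segment_vertical closed_segment_eq_real_ivl
          Un_assoc)
  qed
  have SG: "S \<subseteq> G"
    using x y by (auto simp: S G_eq)
  have UG: "U \<subseteq> G"
    by (auto simp: U_def G_eq)
  have US: "U \<inter> S = {}"
    using x y by (auto simp: U_def S)
  have GSU: "G - S \<subseteq> U"
  proof
    fix p assume "p \<in> G - S"
    then obtain u v where p: "p = (u, v)" "(u, v) \<in> G" "(u, v) \<notin> S"
      by (cases p) auto
    show "p \<in> U"
    proof (rule ccontr)
      assume "p \<notin> U"
      then have "u \<le> a \<or> b \<le> u \<or> v \<le> A \<or> F \<le> v \<or> (h2 \<le> u \<and> v \<le> B) \<or> (l1 \<le> u \<and> v \<le> C) \<or>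
          (u \<le> l2 \<and> E \<le> v) \<or> (u \<le> h1 \<and> D \<le> v)"
        using p(1) by (auto simp: U_def)
      moreover have "a \<le> u" "u \<le> b" "A \<le> v" "v \<le> F" "u \<le> h2 \<or> B \<le> v" "u \<le> l1 \<or> C \<le> v"
          "l2 \<le> u \<or> v \<le> E" "h1 \<le> u \<or> v \<le> D"
        using p(2) by (auto simp: G_eq)
      moreover have "\<not> (u \<le> h2 \<and> a \<le> u \<and> v = A)" "\<not> (u = h2 \<and> A \<le> v \<and> v \<le> B)"
          "\<not> (h2 \<le> u \<and> u \<le> l1 \<and> v = B)" "\<not> (u = l1 \<and> B \<le> v \<and> v \<le> C)"
          "\<not> (l1 \<le> u \<and> u \<le> b \<and> v = C)" "\<not> (u = b \<and> C \<le> v \<and> v \<le> F)"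
          "\<not> (l2 \<le> u \<and> u \<le> b \<and> v = F)" "\<not> (u = l2 \<and> E \<le> v \<and> v \<le> F)"
          "\<not> (h1 \<le> u \<and> u \<le> l2 \<and> v = E)" "\<not> (u = h1 \<and> D \<le> v \<and> v \<le> E)"
          "\<not> (a \<le> u \<and> u \<le> h1 \<and> v = D)" "\<not> (u = a \<and> A \<le> v \<and> v \<le> D)"
        using p(3) by (auto simp: S)
      ultimately show False
        using x y by (smt (verit))
    qed
  qed
  have unbounded: "\<not> bounded {v..}" "\<not> bounded {..v}" for v :: real
  proof -
    have "\<exists>t\<ge>v. c < \<bar>t\<bar>" for c
      by (rule exI[of _ "\<bar>v\<bar> + \<bar>c\<bar> + 1"]) linarith
    moreover have "\<exists>t\<le>v. c < \<bar>t\<bar>" for c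
      by (rule exI[of _ "- \<bar>v\<bar> - \<bar>c\<bar> - 1"]) linarith
    ultimately show "\<not> bounded {v..}" "\<not> bounded {..v}"
      by (auto simp: bounded_real not_le)
  qed
  have outside: "p \<in> outside S" if p: "p \<notin> G" for p
  proof -
    obtain u v where uv: "p = (u, v)"
      by (cases p)
    have "(u < a \<or> b < u \<or> F < v \<or> (u < l2 \<and> E < v) \<or> (u < h1 \<and> D < v)) \<or>
        (v < A \<or> (h2 < u \<and> v < B) \<or> (l1 < u \<and> v < C))"
      using p unfolding uv G_def staircase_def mem_Collect_eq case_prod_conv by argo
    then have "({u} \<times> {v..} \<inter> G = {}) \<or> ({u} \<times> {..v} \<inter> G = {})"
    proof
      assume "u < a \<or> b < u \<or> F < v \<or> (u < l2 \<and> E < v) \<or> (u < h1 \<and> D < v)"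
      then have "(u, t) \<notin> G" if "v \<le> t" for t
        using that by (auto simp: G_def staircase_def)
      then show ?thesis
        by blast
    next
      assume "v < A \<or> (h2 < u \<and> v < B) \<or> (l1 < u \<and> v < C)"
      then have "(u, t) \<notin> G" if "t \<le> v" for t
        using that by (auto simp: G_def staircase_def)
      then show ?thesis
        by blast
    qed
    then have "\<exists>R. p \<in> R \<and> connected R \<and> \<not> bounded R \<and> R \<inter> G = {}"
    proof
      assume "{u} \<times> {v..} \<inter> G = {}"
      moreover have "connected ({u} \<times> {v..})"
        by (intro connected_Times) (auto intro: convex_connected)
      moreover have "\<not> bounded ({u} \<times> {v..})"
        using unbounded[of v] by (auto dest: bounded_snd)
      ultimately show ?thesis
        using uv by (intro exI[of _ "{u} \<times> {v..}"]) auto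
    next
      assume "{u} \<times> {..v} \<inter> G = {}"
      moreover have "connected ({u} \<times> {..v})"
        by (intro connected_Times) (auto intro: convex_connected)
      moreover have "\<not> bounded ({u} \<times> {..v})"
        using unbounded[of v] by (auto dest: bounded_snd)
      ultimately show ?thesis
        using uv by (intro exI[of _ "{u} \<times> {..v}"]) auto
    qed
    then obtain R where R: "p \<in> R" "connected R" "\<not> bounded R" "R \<inter> G = {}"
      by blast
    then have "R \<subseteq> connected_component_set (- S) p"
      using SG by (intro connected_component_maximal) auto
    then show ?thesis
      using R(3) bounded_subset unfolding outside by blast
  qed
  have inside: "p \<in> inside S" if p: "p \<in> G - S" for p
  proof -
    let ?K = "connected_component_set (- S) p"
    have "?K \<subseteq> U \<union> - G"
      using connected_component_subset[of "- S" p] GSU by auto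
    moreover have "p \<in> ?K" "p \<in> U"
      using p GSU by auto
    moreover have "connected ?K" "open U" "open (- G)"
      using open_U compact_imp_closed[OF compact_G] by auto
    ultimately have "?K \<inter> - G = {}"
      using connectedD[of ?K U "- G"] UG by blast
    then have "bounded ?K"
      using compact_imp_bounded[OF compact_G] by (blast intro: bounded_subset)
    then show ?thesis
      using p by (simp add: inside_def)
  qed
  have "S \<union> inside S = G"
  proof
    show "S \<union> inside S \<subseteq> G"
      using SG outside inside_Int_outside[of S] by blast
    show "G \<subseteq> S \<union> inside S"
      using inside by blast
  qed
  then show "polygon_region ?vs = staircase a b h2 l1 l2 h1 A B C D E F"
    by (simp add: polygon_region_def S_def G_def)
  show "compact (staircase a b h2 l1 l2 h1 A B C D E F)"
    using compact_G by (simp add: G_def)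
qed

section \<open>Constants and orbits of the matching family\<close>

lemma reciprocal_antimono:
  fixes n :: real
  assumes "n > 0" "x > 0" "y > 0"
  shows "n / x < n / y \<longleftrightarrow> y < x" "n / x \<le> n / y \<longleftrightarrow> y \<le> x"
  using assms by (auto simp: field_simps)

lemma positive_quadratic_root:
  fixes b c :: real
  assumes "c > 0"
  defines "r \<equiv> (- b + sqrt (b\<^sup>2 + 4 * c)) / 2"
  shows "r > 0" "r * (r + b) = c"
proof -
  have "\<bar>b\<bar> < sqrt (b\<^sup>2 + 4 * c)"
    using assms by (intro real_less_rsqrt) simp
  then show "r > 0"
    by (simp add: r_def)
  have "r * (r + b) = ((sqrt (b\<^sup>2 + 4 * c))\<^sup>2 - b\<^sup>2) / 4"
    by (simp add: r_def power2_eq_square field_simps)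
  also have "\<dots> = c"
    using assms by simp
  finally show "r * (r + b) = c" .
qed

text \<open>The integrality condition \<open>N = d (d + i) / (i - 1)\<close> without the quotient. The constants of the
  polygon are all determined by their reciprocals \<open>n / A = A + 1 + e\<close>, \<open>n / B = e + D\<close>,
  \<open>n / C = e + A\<close>, \<open>n / D = d' + 1 + B\<close>, \<open>n / (A + 1) = d' + C\<close> and \<open>n / (B + 1) = d' + B\<close>.
  Once these are known, the explicit square roots are irrelevant, and inequalities between words in \<open>S\<close> and
  \<open>J\<close> become linear.\<close>

locale matching_family =
  fixes N d i :: int
  assumes N: "N \<ge> 2" and d: "d \<ge> 1" and i: "i \<ge> 2" and matching: "N * (i - 1) = d * (d + i)"
begin

abbreviation "n \<equiv> real_of_int N"
abbreviation "e \<equiv> real_of_int d + real_of_int i"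
abbreviation "d' \<equiv> real_of_int d"
abbreviation "A \<equiv> ptA N d i"
abbreviation "B \<equiv> ptB N d i"
abbreviation "C \<equiv> ptC N d i"
abbreviation "D \<equiv> ptD N d i"

lemma n_pos: "n > 0" and d_pos: "d' \<ge> 1" and e_gt: "e \<ge> d' + 2"
  and matching_real: "d' * e = n * (e - d' - 1)"
proof -
  show "n > 0" "d' \<ge> 1" "e \<ge> d' + 2"
    using N d i by auto
  have "real_of_int (N * (i - 1)) = real_of_int (d * (d + i))"
    by (simp only: matching)
  then show "d' * e = n * (e - d' - 1)"
    by (simp add: algebra_simps)
qed

lemma n_gt_d: "n > d'"
proof -
  have "d' * (e - d' - 1) < d' * e"
    using d_pos by (intro mult_strict_left_mono) auto
  then have "d' * (e - d' - 1) < n * (e - d' - 1)"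
    by (simp add: matching_real)
  then show ?thesis
    using e_gt by (simp add: mult_less_cancel_right)
qed

lemma A_pos: "A > 0" and A_eq1: "A * (A + 1 + e) = n" and A_eq: "n / A = A + 1 + e"
proof -
  have eq: "A = (- (e + 1) + sqrt ((e + 1)\<^sup>2 + 4 * n)) / 2"
    by (simp add: ptA_def add_ac)
  show pos: "A > 0"
    unfolding eq using n_pos by (rule positive_quadratic_root)
  have "A * (A + (e + 1)) = n"
    unfolding eq using n_pos by (rule positive_quadratic_root)
  then show 1: "A * (A + 1 + e) = n"
    by (simp add: algebra_simps)
  show "n / A = A + 1 + e"
    unfolding 1[symmetric] using pos by simp
qed

lemma B_eq1: "(B + 1) * (B + d') = n" and B_pos: "B > 0"
proof -
  have eq: "B + 1 = (- (d' - 1) + sqrt ((d' - 1)\<^sup>2 + 4 * n)) / 2"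
    by (simp add: ptB_def field_simps)
  have pos: "B + 1 > 0"
    unfolding eq using n_pos by (rule positive_quadratic_root)
  have "(B + 1) * ((B + 1) + (d' - 1)) = n"
    unfolding eq using n_pos by (rule positive_quadratic_root)
  then show 1: "(B + 1) * (B + d') = n"
    by simp
  show "B > 0"
  proof (rule ccontr)
    assume "\<not> B > 0"
    then have "(B + 1) * (B + d') \<le> 1 * d'"
      using pos d_pos n_pos 1 by (intro mult_mono) (auto simp: zero_less_mult_iff)
    then show False
      using 1 n_gt_d by simp
  qed
qed

lemma F_eq: "n / (B + 1) = d' + B"
  using B_eq1 B_pos by (simp add: field_simps)

lemma C_eq: "n / C = e + A" "C = n / (e + A)"
proof -
  have "C = n * (A + 1) / (e + n)"
    by (simp add: ptC_def ptA_def field_simps)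
  moreover have "e + n = (A + 1) * (A + e)"
    using A_eq A_pos by (simp add: field_simps)
  ultimately show "C = n / (e + A)"
    using A_pos by (simp add: add_ac)
  then show "n / C = e + A"
    using n_pos by simp
qed

lemma D_eq: "n / D = d' + 1 + B" "D = n / (d' + 1 + B)"
proof -
  have "D = n * B / (n - d')"
    by (simp add: ptD_def ptB_def field_simps)
  moreover have "n - d' = B * (d' + 1 + B)"
    using B_eq1 by (simp add: algebra_simps)
  ultimately show "D = n / (d' + 1 + B)"
    using B_pos by simp
  then show "n / D = d' + 1 + B"
    using n_pos by simp
qed

lemma C_pos: "C > 0" and D_pos: "D > 0"
  using n_pos A_pos B_pos d_pos e_gt by (auto simp: C_eq(2) D_eq(2))

text \<open>If \<open>k = e - d'\<close>, then \<open>B (B + 1 + e) = n + k B - d'\<close>, so the claim amounts to \<open>k B > d'\<close>. At the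
  value \<open>d' / k\<close> the quadratic that defines \<open>B\<close> equals \<open>(1 - 1 / k\<^sup>2) n < n\<close>.\<close>

lemma A_less_B: "A < B"
proof -
  define k where "k = e - d'"
  have k: "k \<ge> 2" "e = d' + k"
    using e_gt by (auto simp: k_def)
  have "k * B > d'"
  proof (rule ccontr)
    assume "\<not> k * B > d'"
    then have "(k * B + k) * (k * B + k * d') \<le> (d' + k) * (d' + k * d')"
      using k B_pos d_pos by (intro mult_mono) auto
    moreover have "(k * B + k) * (k * B + k * d') = k\<^sup>2 * n"
      by (simp add: B_eq1[symmetric] power2_eq_square algebra_simps)
    moreover have "(d' + k) * (d' + k * d') = (k\<^sup>2 - 1) * n"
      using matching_real k(2) by algebra
    ultimately show False
      using n_pos by (simp add: algebra_simps)
  qed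
  moreover have "B * (B + 1 + e) = (B + 1) * (B + d') + (k * B - d')"
    by (simp add: k(2) algebra_simps)
  ultimately have "A * (A + 1 + e) < B * (B + 1 + e)"
    unfolding A_eq1 B_eq1 by simp
  then show ?thesis
    using A_pos B_pos d_pos e_gt mult_mono[of B A "B + 1 + e" "A + 1 + e"] by linarith
qed

lemma E_eq: "n / (A + 1) = d' + C"
proof -
  have "(A + 1) * (d' * (e + A) + n) = n * (e + A)"
    using matching_real A_eq1 by algebra
  then have "(A + 1) * (d' + C) = n"
    using A_pos d_pos e_gt by (simp add: C_eq(2) field_simps)
  then show ?thesis
    using A_pos by (simp add: field_simps)
qed

lemma B_eq: "n / B = e + D"
proof -
  have "B * (e * (d' + 1 + B) + n) = n * (d' + 1 + B)"
    using matching_real B_eq1 by algebra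
  then have "B * (e + D) = n"
    using B_pos d_pos by (simp add: D_eq(2) field_simps)
  then show ?thesis
    using B_pos by (simp add: field_simps)
qed

lemma constants_order: "A < B" "B < C" "C < D" "D < A + 1"
proof -
  show AB: "A < B"
    by (rule A_less_B)
  have "n / D < n / B"
  proof -
    have "(d' + 1 + B) * B < n"
      using B_eq1 d_pos by (simp add: algebra_simps)
    then show ?thesis
      using B_pos by (simp add: D_eq(1) pos_less_divide_eq)
  qed
  then have BD: "B < D"
    using reciprocal_antimono n_pos B_pos D_pos by blast
  then have "n / C < n / B"
    using AB by (simp add: B_eq C_eq(1))
  then show BC: "B < C"
    using reciprocal_antimono n_pos B_pos C_pos by blast
  have "n < (A + 1) * (e + A)"
    using A_eq1 A_pos d_pos e_gt by (simp add: algebra_simps)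
  then have CE: "C < A + 1"
    using A_pos d_pos e_gt by (simp add: C_eq(2) pos_divide_less_eq)
  have "n / D < n / C"
    using e_gt BC CE by (simp add: C_eq(1) D_eq(1))
  then show "C < D"
    using reciprocal_antimono n_pos C_pos D_pos by blast
  have "n / (A + 1) < n / D"
    using AB CE by (simp add: D_eq(1) E_eq)
  then show "D < A + 1"
    using reciprocal_antimono(1)[OF n_pos, of "A + 1" D] A_pos D_pos by simp
qed

lemma window_quadratic:
  assumes "A \<le> s" "s \<le> B"
  shows "n \<le> s * (s + 1 + e)" "(s + 1) * (s + d') \<le> n"
proof -
  have "A * (A + 1 + e) \<le> s * (s + 1 + e)"
    using assms A_pos e_gt d_pos by (intro mult_mono) auto
  then show "n \<le> s * (s + 1 + e)"
    by (simp only: A_eq1)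
  have "(s + 1) * (s + d') \<le> (B + 1) * (B + d')"
    using assms A_pos d_pos by (intro mult_mono) auto
  then show "(s + 1) * (s + d') \<le> n"
    by (simp only: B_eq1)
qed

lemma window_quadratic_strict:
  assumes "A < s" "s < B"
  shows "n < s * (s + 1 + e)" "(s + 1) * (s + d') < n"
proof -
  have "A * (A + 1 + e) < s * (s + 1 + e)"
    using assms A_pos e_gt d_pos by (intro mult_strict_mono) auto
  then show "n < s * (s + 1 + e)"
    by (simp only: A_eq1)
  have "(s + 1) * (s + d') < (B + 1) * (B + d')"
    using assms A_pos d_pos by (intro mult_strict_mono) auto
  then show "(s + 1) * (s + d') < n"
    by (simp only: B_eq1)
qed

abbreviation "l1 \<equiv> lo1 N d i"
abbreviation "l2 \<equiv> lo2 N d i"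
abbreviation "h1 \<equiv> hi1 N d i"
abbreviation "h2 \<equiv> hi2 N d i"

lemma orbit_reciprocals:
  shows "n / s = l1 s + e" "n / (s + 1) = h1 s + d'" "n / l1 s = l2 s + d'" "n / h1 s = h2 s + e"
  by (simp_all add: lo1_def lo2_def hi1_def hi2_def)

lemma less_iff_reciprocal: "0 < x \<Longrightarrow> 0 < y \<Longrightarrow> x < y \<longleftrightarrow> n / y < n / x"
  using reciprocal_antimono(1)[OF n_pos, of y x] by simp

text \<open>Both right-hand sides are nonnegative for \<open>A \<le> s \<le> B\<close>, since \<open>A\<close> and \<open>B\<close> are the positive
  roots of the two quadratics. This turns the position of the second iterates \<open>h2 s\<close> and \<open>l2 s\<close>
  relative to \<open>s\<close> and \<open>s + 1\<close> into a sign.\<close>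

lemma orbit_defect:
  assumes "s > 0"
  shows "(s + 1) * (n - h1 s * (s + e)) = d' * (s * (s + 1 + e) - n)"
    "s * (l1 s * (s + 1 + d') - n) = e * (n - (s + 1) * (s + d'))"
proof -
  have "(s + 1) * h1 s = n - d' * (s + 1)" "s * l1 s = n - e * s"
    using assms by (simp_all add: hi1_def lo1_def right_diff_distrib mult.commute)
  then show "(s + 1) * (n - h1 s * (s + e)) = d' * (s * (s + 1 + e) - n)"
    "s * (l1 s * (s + 1 + d') - n) = e * (n - (s + 1) * (s + d'))"
    using matching_real by algebra+
qed

lemma orbit_bounds:
  assumes s: "A \<le> s" "s \<le> B"
  shows "D \<le> l1 s" "l1 s \<le> A + 1" "B \<le> h1 s" "h1 s \<le> C" "C \<le> l2 s" "l2 s \<le> B + 1"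
    "A \<le> h2 s" "h2 s \<le> D" "s \<le> h2 s" "l2 s \<le> s + 1"
proof -
  have pos: "s > 0"
    using s A_pos by simp
  have "n / B \<le> n / s" "n / s \<le> n / A" "n / (B + 1) \<le> n / (s + 1)" "n / (s + 1) \<le> n / (A + 1)"
    using s pos A_pos B_pos n_pos by (auto intro!: divide_left_mono)
  then show l1: "D \<le> l1 s" "l1 s \<le> A + 1" and h1: "B \<le> h1 s" "h1 s \<le> C"
    unfolding A_eq B_eq E_eq F_eq orbit_reciprocals[of s] by auto
  have "n / (A + 1) \<le> n / l1 s" "n / l1 s \<le> n / D" "n / C \<le> n / h1 s" "n / h1 s \<le> n / B"
    using l1 h1 A_pos D_pos B_pos n_pos C_pos by (auto intro!: divide_left_mono mult_pos_pos)
  then show "C \<le> l2 s" "l2 s \<le> B + 1" "A \<le> h2 s" "h2 s \<le> D"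
    unfolding B_eq C_eq(1) D_eq(1) E_eq orbit_reciprocals(3,4) by auto
  have "0 \<le> (s + 1) * (n - h1 s * (s + e))" "0 \<le> s * (l1 s * (s + 1 + d') - n)"
    unfolding orbit_defect[OF pos]
    using window_quadratic[OF s] d_pos e_gt by (auto intro!: mult_nonneg_nonneg)
  then have "h1 s * (s + e) \<le> n" "n \<le> l1 s * (s + 1 + d')"
    using pos by (simp_all add: zero_le_mult_iff)
  then have "s + e \<le> n / h1 s" "n / l1 s \<le> s + 1 + d'"
    using h1 l1 B_pos D_pos by (simp_all add: pos_le_divide_eq pos_divide_le_eq mult.commute)
  then show "s \<le> h2 s" "l2 s \<le> s + 1"
    by (simp_all add: orbit_reciprocals(3,4))
qed

lemma orbit_bounds_strict:
  assumes s: "A < s" "s < B"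
  shows "s < h2 s" "l2 s < s + 1"
proof -
  have pos: "s > 0" "h1 s > 0" "l1 s > 0"
    using orbit_bounds[of s] s A_pos B_pos D_pos by auto
  have "0 < (s + 1) * (n - h1 s * (s + e))" "0 < s * (l1 s * (s + 1 + d') - n)"
    unfolding orbit_defect[OF pos(1)]
    using window_quadratic_strict[OF s] d_pos e_gt by (auto intro!: mult_pos_pos)
  then have "h1 s * (s + e) < n" "n < l1 s * (s + 1 + d')"
    using pos by (auto simp: zero_less_mult_iff)
  then have "s + e < n / h1 s" "n / l1 s < s + 1 + d'"
    using pos by (simp_all add: pos_less_divide_eq pos_divide_less_eq mult.commute)
  then show "s < h2 s" "l2 s < s + 1"
    by (simp_all add: orbit_reciprocals(3,4))
qed

text \<open>With \<open>a = n - e s\<close>, \<open>b = n - d' - d' s\<close> and \<open>c = (e - d') s - d'\<close> the family condition gives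
  \<open>l2 s = n c / a\<close> and \<open>h2 s = n c / b\<close>, while \<open>b = a + c\<close> always holds.\<close>

lemma orbit_matching:
  assumes s: "A \<le> s" "s \<le> B"
  shows "n / h2 s = n / l2 s + 1"
proof -
  have pos: "s > 0" "l1 s > 0" "h1 s > 0" "l2 s > 0" "h2 s > 0"
    using orbit_bounds[OF s] s A_pos B_pos C_pos D_pos by auto
  define a b c where "a = n - e * s" and "b = n - d' - d' * s" and "c = (e - d') * s - d'"
  have l1: "l1 s = a / s" and h1: "h1 s = b / (s + 1)"
    using pos by (simp_all add: lo1_def hi1_def a_def b_def field_simps)
  have ab: "a > 0" "b > 0"
    using pos l1 h1 by (auto simp: zero_less_divide_iff)
  have "n * s - d' * a = n * c"
    using matching_real unfolding a_def c_def by algebra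
  then have l2: "l2 s = n * c / a"
    using ab pos orbit_reciprocals(3)[of s] by (simp add: l1 field_simps)
  have "n * (s + 1) - e * b = n * c"
    using matching_real unfolding b_def c_def by algebra
  then have h2: "h2 s = n * c / b"
    using ab pos orbit_reciprocals(4)[of s] by (simp add: h1 field_simps)
  have "c > 0"
    using pos(4) ab n_pos by (simp add: l2 zero_less_divide_iff zero_less_mult_iff)
  moreover have "b = a + c"
    by (simp add: a_def b_def c_def algebra_simps)
  ultimately show ?thesis
    using n_pos ab by (simp add: l2 h2 field_simps)
qed

text \<open>With \<open>T\<^sub>k = S\<^sup>-\<^sup>k J\<close> the words \<open>T\<^sub>e T\<^sub>d S\<close> and \<open>J S J T\<^sub>d T\<^sub>e\<close> are equal. This is their equality in the
  second coordinate; \<open>orbit_matching\<close> is their equality in the first.\<close>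

lemma dual_matching:
  assumes t: "0 < t" "t < n"
  shows "n / (e + n / (d' + n / (n / t - 1))) = n / (d' + n / (e + t)) - 1"
proof -
  have 1: "n / (n / t - 1) = n * t / (n - t)"
    using t by (simp add: field_simps)
  have p: "d' * n - d' * t + n * t > 0" "n + e * d' + d' * t > 0" "d' * e + d' * t + n > 0"
  proof -
    have "d' * (n - t) > 0" "n * t > 0" "e * d' > 0" "d' * t > 0"
      using t d_pos e_gt n_pos by auto
    then show "d' * n - d' * t + n * t > 0" "n + e * d' + d' * t > 0" "d' * e + d' * t + n > 0"
      using n_pos by (auto simp: algebra_simps)
  qed
  have 2: "n / (d' + n * t / (n - t)) = n * (n - t) / (d' * n - d' * t + n * t)"
    using t p by (simp add: field_simps)
  have 3: "n / (e + n * (n - t) / (d' * n - d' * t + n * t)) =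
      n * (d' * n - d' * t + n * t) / (e * (d' * n - d' * t + n * t) + n * (n - t))"
    using p by (simp add: field_simps)
  have 4: "e * (d' * n - d' * t + n * t) + n * (n - t) = n * (n + e * d' + d' * t)"
    using matching_real by algebra
  have 5: "n / (d' + n / (e + t)) - 1 = (n * (e + t) - (d' * e + d' * t + n)) / (d' * e + d' * t + n)"
    using t p e_gt d_pos by (simp add: field_simps)
  have 6: "n * (e + t) - (d' * e + d' * t + n) = d' * n - d' * t + n * t"
    using matching_real by algebra
  show ?thesis
    unfolding 1 2 3 4 5 6 using n_pos by (simp add: mult.commute add_ac)
qed

end

section \<open>The parameter interval\<close>

context matching_family begin

text \<open>If \<open>n / x - \<gamma>\<close> lies strictly between two integers, then the exceptional convention for the left
  endpoint does not apply.\<close>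

lemma digit_eqI:
  assumes "\<gamma> < n / x - of_int k" "n / x - of_int k < \<gamma> + 1"
  shows "digit N \<gamma> x = k"
proof -
  have floor: "\<lfloor>n / x - \<gamma>\<rfloor> = k"
    using assms by (intro floor_unique) auto
  have "n / x - \<gamma> \<notin> \<int>"
  proof
    assume "n / x - \<gamma> \<in> \<int>"
    then obtain m where "n / x - \<gamma> = of_int m"
      by (elim Ints_cases)
    then have "k < m" "m < k + 1"
      using assms by linarith+
    then show False
      by simp
  qed
  then show ?thesis
    using floor by (auto simp: digit_def)
qed

text \<open>Strictness in \<open>orbit_bounds_strict\<close> keeps the first iterates of \<open>\<alpha>\<close> and \<open>\<alpha> + 1\<close> away from the ends
  of the outer cylinders.\<close>

lemma open_interval_subset_X: "{A<..<B} \<subseteq> X_set N d i"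
proof
  fix \<alpha> assume "\<alpha> \<in> {A<..<B}"
  then have \<alpha>: "A < \<alpha>" "\<alpha> < B"
    by auto
  note bounds = orbit_bounds[OF less_imp_le[OF \<alpha>(1)] less_imp_le[OF \<alpha>(2)]] orbit_bounds_strict[OF \<alpha>]
    constants_order
  have pos: "\<alpha> > 0" "l1 \<alpha> > 0" "h1 \<alpha> > 0"
    using \<alpha> bounds A_pos B_pos D_pos by auto
  have digit_lo: "digit N \<alpha> \<alpha> = d + i" and digit_hi: "digit N \<alpha> (\<alpha> + 1) = d"
    using bounds \<alpha> orbit_reciprocals(1,2)[of \<alpha>] by (auto intro!: digit_eqI)
  have T_lo: "Tmap N \<alpha> \<alpha> = l1 \<alpha>" and T_hi: "Tmap N \<alpha> (\<alpha> + 1) = h1 \<alpha>"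
    by (simp_all add: Tmap_def digit_lo digit_hi lo1_def hi1_def)
  have image: "digit N \<alpha> ` {\<alpha>..\<alpha> + 1} = {d..d + i}"
  proof
    show "digit N \<alpha> ` {\<alpha>..\<alpha> + 1} \<subseteq> {d..d + i}"
    proof (rule image_subsetI)
      fix x assume "x \<in> {\<alpha>..\<alpha> + 1}"
      then show "digit N \<alpha> x \<in> {d..d + i}"
        using digit_antimono[of N \<alpha> \<alpha> x] digit_antimono[of N \<alpha> x "\<alpha> + 1"] N pos digit_lo digit_hi
        by auto
    qed
    show "{d..d + i} \<subseteq> digit N \<alpha> ` {\<alpha>..\<alpha> + 1}"
    proof
      fix k assume k: "k \<in> {d..d + i}"
      then consider "k = d" | "k = d + i" | "d + 1 \<le> k" "k + 1 \<le> d + i"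
        by fastforce
      then show "k \<in> digit N \<alpha> ` {\<alpha>..\<alpha> + 1}"
      proof cases
        case 1
        then show ?thesis
          using digit_hi by (intro image_eqI[of _ _ "\<alpha> + 1"]) auto
      next
        case 2
        then show ?thesis
          using digit_lo by (intro image_eqI[of _ _ \<alpha>]) auto
      next
        case 3
        then have k': "d' + 1 \<le> of_int k" "of_int k + 1 \<le> e"
          by linarith+
        \<comment> \<open>A preimage, with digit \<open>k\<close>, of the midpoint of the window.\<close>
        define u where "u = of_int k + \<alpha> + 1 / 2"
        have u: "u \<le> n / \<alpha>" "n / (\<alpha> + 1) \<le> u" "u > 0"
          using k' bounds \<alpha> pos d_pos unfolding u_def orbit_reciprocals(1,2)[of \<alpha>] by linarith+
        have "\<alpha> \<le> n / u" "n / u \<le> \<alpha> + 1"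
          using u pos by (simp_all add: pos_le_divide_eq pos_divide_le_eq mult.commute)
        then have "n / u \<in> {\<alpha>..\<alpha> + 1}"
          by simp
        moreover have "digit N \<alpha> (n / u) = k"
          using n_pos by (intro digit_eqI) (auto simp: u_def)
        ultimately show ?thesis
          by blast
      qed
    qed
  qed
  have "(\<alpha> + 1)\<^sup>2 \<le> (\<alpha> + 1) * (\<alpha> + d')"
    using pos d_pos by (simp add: power2_eq_square)
  also have "\<dots> < n"
    using \<alpha> by (rule window_quadratic_strict)
  finally have "\<alpha> + 1 \<le> sqrt n"
    by (intro real_le_rsqrt) simp
  then have "\<alpha> \<in> digit_params N d i"
    using image pos by (auto simp: digit_params_def)
  moreover have "Tmap N \<alpha> \<alpha> \<in> interior (cylinder N \<alpha> d)"
  proof (rule interiorI)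
    show "open {n / (d' + 1 + \<alpha>)<..<\<alpha> + 1}"
      by simp
    have "n / (d' + 1 + \<alpha>) < l1 \<alpha>"
    proof -
      have "n / l1 \<alpha> < d' + 1 + \<alpha>"
        using bounds unfolding orbit_reciprocals(3) by linarith
      then show ?thesis
        using pos d_pos by (simp add: pos_divide_less_eq mult.commute)
    qed
    then show "Tmap N \<alpha> \<alpha> \<in> {n / (d' + 1 + \<alpha>)<..<\<alpha> + 1}"
      using bounds \<alpha> by (simp add: T_lo)
    show "{n / (d' + 1 + \<alpha>)<..<\<alpha> + 1} \<subseteq> cylinder N \<alpha> d"
    proof
      fix x assume x: "x \<in> {n / (d' + 1 + \<alpha>)<..<\<alpha> + 1}"
      have "n / (d' + 1 + \<alpha>) > 0"
        using n_pos d_pos pos by simp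
      then have "x > 0"
        using x by auto
      then have "n / x < d' + 1 + \<alpha>" "n / (\<alpha> + 1) < n / x"
        using x pos d_pos n_pos less_iff_reciprocal[of x "\<alpha> + 1"]
        by (auto simp: pos_divide_less_eq mult.commute)
      then have "digit N \<alpha> x = d"
        using bounds \<alpha> unfolding orbit_reciprocals(2)[of \<alpha>] by (intro digit_eqI) auto
      moreover have "\<alpha> \<le> x"
      proof (rule ccontr)
        assume "\<not> \<alpha> \<le> x"
        then have "n / \<alpha> < n / x"
          using less_iff_reciprocal[of x \<alpha>] pos \<open>x > 0\<close> by simp
        then show False
          using \<open>n / x < d' + 1 + \<alpha>\<close> bounds \<alpha> e_gt unfolding orbit_reciprocals(1)[of \<alpha>] by simp
      qed
      ultimately show "x \<in> cylinder N \<alpha> d"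
        using x by (simp add: cylinder_def)
    qed
  qed
  moreover have "Tmap N \<alpha> (\<alpha> + 1) \<in> interior (cylinder N \<alpha> (d + i))"
  proof (rule interiorI)
    show "open {\<alpha><..<n / (e + \<alpha>)}"
      by simp
    have "h1 \<alpha> < n / (e + \<alpha>)"
    proof -
      have "e + \<alpha> < n / h1 \<alpha>"
        using bounds unfolding orbit_reciprocals(4) by linarith
      then show ?thesis
        using pos d_pos e_gt by (simp add: pos_less_divide_eq mult.commute)
    qed
    then show "Tmap N \<alpha> (\<alpha> + 1) \<in> {\<alpha><..<n / (e + \<alpha>)}"
      using bounds \<alpha> by (simp add: T_hi)
    show "{\<alpha><..<n / (e + \<alpha>)} \<subseteq> cylinder N \<alpha> (d + i)"
    proof
      fix x assume x: "x \<in> {\<alpha><..<n / (e + \<alpha>)}"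
      then have "e + \<alpha> < n / x" "n / x < n / \<alpha>"
        using pos d_pos e_gt n_pos less_iff_reciprocal[of \<alpha> x]
        by (auto simp: pos_less_divide_eq mult.commute)
      then have "digit N \<alpha> x = d + i"
        using bounds \<alpha> unfolding orbit_reciprocals(1)[of \<alpha>] by (intro digit_eqI) auto
      moreover have "x \<le> \<alpha> + 1"
      proof -
        have "n / (e + \<alpha>) \<le> n / (e + A)"
          using \<alpha> pos A_pos d_pos e_gt n_pos by (intro divide_left_mono) auto
        then show ?thesis
          using x bounds \<alpha> by (simp flip: C_eq(2))
      qed
      ultimately show "x \<in> cylinder N \<alpha> (d + i)"
        using x by (simp add: cylinder_def)
    qed
  qed
  ultimately show "\<alpha> \<in> X_set N d i"
    by (simp add: X_set_def)
qed

text \<open>That the first iterate of \<open>\<alpha>\<close> does not exceed \<open>\<alpha> + 1\<close> is the quadratic inequality for \<open>A \<le> \<alpha>\<close>, and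
  that the first iterate of \<open>\<alpha> + 1\<close> is not below \<open>\<alpha>\<close> is the one for \<open>\<alpha> \<le> B\<close>.\<close>

lemma X_subset_closed_interval: "X_set N d i \<subseteq> {A..B}"
proof
  fix \<alpha> assume \<alpha>: "\<alpha> \<in> X_set N d i"
  then have pos: "\<alpha> > 0"
    by (auto simp: X_set_def digit_params_def)
  have "Tmap N \<alpha> \<alpha> \<in> cylinder N \<alpha> d" "Tmap N \<alpha> (\<alpha> + 1) \<in> cylinder N \<alpha> (d + i)"
    using \<alpha> interior_subset unfolding X_set_def by blast+
  then have "l1 \<alpha> \<le> \<alpha> + 1" "\<alpha> \<le> h1 \<alpha>"
    using orbit_points_X[OF _ \<alpha>] N by (auto simp: cylinder_def)
  then have "n / \<alpha> \<le> \<alpha> + 1 + e" "\<alpha> + d' \<le> n / (\<alpha> + 1)"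
    using orbit_reciprocals(1,2)[of \<alpha>] by linarith+
  then have le: "n \<le> \<alpha> * (\<alpha> + 1 + e)" "(\<alpha> + 1) * (\<alpha> + d') \<le> n"
    using pos by (simp_all add: pos_divide_le_eq pos_le_divide_eq mult.commute)
  have "A \<le> \<alpha>"
  proof (rule ccontr)
    assume "\<not> A \<le> \<alpha>"
    then have "\<alpha> * (\<alpha> + 1 + e) < A * (A + 1 + e)"
      using pos e_gt d_pos by (intro mult_strict_mono) auto
    then show False
      using le A_eq1 by simp
  qed
  moreover have "\<alpha> \<le> B"
  proof (rule ccontr)
    assume "\<not> \<alpha> \<le> B"
    then have "(B + 1) * (B + d') < (\<alpha> + 1) * (\<alpha> + d')"
      using B_pos d_pos by (intro mult_strict_mono) auto
    then show False
      using le B_eq1 by simp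
  qed
  ultimately show "\<alpha> \<in> {A..B}"
    by simp
qed

lemma closure_X: "closure (X_set N d i) = {A..B}"
proof
  show "closure (X_set N d i) \<subseteq> {A..B}"
    using X_subset_closed_interval by (intro closure_minimal) auto
  show "{A..B} \<subseteq> closure (X_set N d i)"
    using closure_mono[OF open_interval_subset_X] A_less_B by (simp add: closure_greaterThanLessThan)
qed

end

section \<open>The base system\<close>

text \<open>The set \<open>K\<close> of coordinates that are discarded.\<close>

locale matching_grid = matching_family +
  fixes K :: "real set"
  assumes countable_K: "countable K"
    and K_succ: "x + 1 \<in> K \<longleftrightarrow> x \<in> K"
    and K_reciprocal: "n / x \<in> K \<longleftrightarrow> x \<in> K"
    and AB_in_K: "A \<in> K" "B \<in> K"
begin

lemma K_add_nat: "x + real k \<in> K \<longleftrightarrow> x \<in> K"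
proof (induction k)
  case (Suc k)
  then show ?case
    using K_succ[of "x + real k"] by (simp add: add_ac)
qed simp

lemma K_add:
  assumes "k \<in> \<int>"
  shows "x + k \<in> K \<longleftrightarrow> x \<in> K" "k + x \<in> K \<longleftrightarrow> x \<in> K" "x - k \<in> K \<longleftrightarrow> x \<in> K"
proof -
  have *: "x + real_of_int m \<in> K \<longleftrightarrow> x \<in> K" for x m
  proof (cases "m \<ge> 0")
    case True
    then show ?thesis
      using K_add_nat[of x "nat m"] by simp
  next
    case False
    then show ?thesis
      using K_add_nat[of "x + real_of_int m" "nat (- m)"] by simp
  qed
  obtain m where m: "k = real_of_int m"
    using assms by (elim Ints_cases)
  show "x + k \<in> K \<longleftrightarrow> x \<in> K" "k + x \<in> K \<longleftrightarrow> x \<in> K"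
    using *[of x m] by (simp_all add: m add.commute)
  show "x - k \<in> K \<longleftrightarrow> x \<in> K"
    using *[of "x - k" m] by (simp add: m)
qed

lemma K_simps [simp]:
  "n / x \<in> K \<longleftrightarrow> x \<in> K"
  "x + 1 \<in> K \<longleftrightarrow> x \<in> K" "x - 1 \<in> K \<longleftrightarrow> x \<in> K"
  "x + d' \<in> K \<longleftrightarrow> x \<in> K" "d' + x \<in> K \<longleftrightarrow> x \<in> K" "x - d' \<in> K \<longleftrightarrow> x \<in> K"
  "x + e \<in> K \<longleftrightarrow> x \<in> K" "e + x \<in> K \<longleftrightarrow> x \<in> K" "x - e \<in> K \<longleftrightarrow> x \<in> K"
  "x + of_int k \<in> K \<longleftrightarrow> x \<in> K" "of_int k + x \<in> K \<longleftrightarrow> x \<in> K" "x - of_int k \<in> K \<longleftrightarrow> x \<in> K"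
  by (rule K_reciprocal K_add; simp)+

lemma constants_in_K: "A \<in> K" "B \<in> K" "C \<in> K" "D \<in> K"
proof -
  have "d' + C \<in> K" "e + D \<in> K"
    unfolding E_eq[symmetric] B_eq[symmetric] by (simp_all add: AB_in_K)
  then show "A \<in> K" "B \<in> K" "C \<in> K" "D \<in> K"
    by (simp_all add: AB_in_K)
qed

text \<open>For \<open>\<gamma> = A\<close> the orbit points are \<open>l1 A = A + 1\<close>, \<open>h2 A = A\<close> and \<open>l2 A = h1 A = C\<close>, so that only
  one corner of the polygon is left.\<close>

definition base_domain :: "(real \<times> real) set" where
  "base_domain = {(x, y). x \<notin> K \<and> y \<notin> K \<and> A < x \<and> x < A + 1 \<and> B < y \<and> y < B + 1 \<and> (C < x \<or> y < D)}"

definition branch :: "int \<Rightarrow> real \<times> real \<Rightarrow> real \<times> real" where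
  "branch k = (\<lambda>(x, y). (n / x - of_int k, n / (of_int k + y)))"

text \<open>Comparing \<open>x\<close> with a corner coordinate is comparing \<open>n / x\<close> with another expression that is linear
  in the corner coordinates. These equivalences reduce the case analyses below to linear arithmetic.\<close>

lemma reciprocal_constants:
  assumes "0 < x"
  shows "x < A \<longleftrightarrow> A + 1 + e < n / x" "A < x \<longleftrightarrow> n / x < A + 1 + e"
    "x < B \<longleftrightarrow> e + D < n / x" "B < x \<longleftrightarrow> n / x < e + D"
    "x < C \<longleftrightarrow> e + A < n / x" "C < x \<longleftrightarrow> n / x < e + A"
    "x < D \<longleftrightarrow> d' + 1 + B < n / x" "D < x \<longleftrightarrow> n / x < d' + 1 + B"
    "x < A + 1 \<longleftrightarrow> d' + C < n / x" "A + 1 < x \<longleftrightarrow> n / x < d' + C"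
    "x < B + 1 \<longleftrightarrow> d' + B < n / x" "B + 1 < x \<longleftrightarrow> n / x < d' + B"
  using assms less_iff_reciprocal[of x A] less_iff_reciprocal[of A x]
    less_iff_reciprocal[of x B] less_iff_reciprocal[of B x]
    less_iff_reciprocal[of x C] less_iff_reciprocal[of C x]
    less_iff_reciprocal[of x D] less_iff_reciprocal[of D x]
    less_iff_reciprocal[of x "A + 1"] less_iff_reciprocal[of "A + 1" x]
    less_iff_reciprocal[of x "B + 1"] less_iff_reciprocal[of "B + 1" x]
    A_pos B_pos C_pos D_pos
  by (simp_all add: A_eq B_eq C_eq(1) D_eq(1) E_eq F_eq)

lemmas constants_facts = A_pos constants_order d_pos e_gt

text \<open>The digit is recovered from the second coordinate: \<open>n / y - k\<close> has to lie between \<open>B\<close> and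
  \<open>B + 1\<close>.\<close>

definition base_inverse :: "real \<times> real \<Rightarrow> real \<times> real" where
  "base_inverse = (\<lambda>(x, y). let k = \<lfloor>n / y - B\<rfloor> in (n / (x + of_int k), n / y - of_int k))"

lemma natext_eq_branch:
  assumes "\<gamma> < n / x - of_int k" "n / x - of_int k < \<gamma> + 1"
  shows "natext N \<gamma> (x, y) = branch k (x, y)"
  using digit_eqI[OF assms] by (simp add: natext_def Tmap_def branch_def)

lemma natext_branch_exists:
  assumes "x \<notin> K" "\<gamma> \<in> K"
  obtains k where "\<gamma> < n / x - of_int k" "n / x - of_int k < \<gamma> + 1"
    "\<And>y. natext N \<gamma> (x, y) = branch k (x, y)"
proof
  define k where "k = \<lfloor>n / x - \<gamma>\<rfloor>"
  have "n / x - of_int k \<notin> K"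
    using assms by simp
  then have "n / x - of_int k \<noteq> \<gamma>"
    using assms by metis
  moreover have "of_int k \<le> n / x - \<gamma>" "n / x - \<gamma> < of_int k + 1"
    by (auto simp: k_def)
  ultimately show 1: "\<gamma> < n / x - of_int k" "n / x - of_int k < \<gamma> + 1"
    by auto
  show "natext N \<gamma> (x, y) = branch k (x, y)" for y
    using 1 assms by (intro natext_eq_branch) auto
qed

text \<open>The corner condition is what makes the two extreme digits fit: digit \<open>d + i\<close> needs \<open>x < C\<close> and
  then \<open>y < D\<close>, which keeps the image above \<open>B\<close>; digit \<open>d\<close> moves \<open>x\<close> to the right of \<open>C\<close>.\<close>

lemma base_step:
  assumes "(x, y) \<in> base_domain"
  shows "natext N A (x, y) \<in> base_domain" "base_inverse (natext N A (x, y)) = (x, y)"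
    "\<exists>k\<ge>0. (x, y) \<in> quadrant \<and> of_int k < n / x \<and> natext N A (x, y) = branch k (x, y)"
proof -
  have xy: "x \<notin> K" "y \<notin> K" "A < x" "x < A + 1" "B < y" "y < B + 1" "C < x \<or> y < D"
    using assms by (auto simp: base_domain_def)
  have pos: "0 < x" "0 < y"
    using xy A_pos B_pos by auto
  obtain k where k: "A < n / x - of_int k" "n / x - of_int k < A + 1"
    "\<And>y. natext N A (x, y) = branch k (x, y)"
    using natext_branch_exists[OF xy(1) AB_in_K(1)] by blast
  have "of_int k < e + 1" "d' - 1 < of_int k"
    using k reciprocal_constants[OF pos(1)] xy constants_facts by argo+
  then have k_range: "d \<le> k" "k \<le> d + i"
    by linarith+
  define v where "v = of_int k + y"
  have v: "v > 0" "n / (n / v) = v" "n / v > 0"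
    using k_range pos d n_pos by (auto simp: v_def)
  have "d' + B < v"
    using k_range xy by (simp add: v_def)
  moreover have "v < e + D"
  proof (cases "k = d + i")
    case True
    then have "x < C"
      using k reciprocal_constants[OF pos(1)] by (simp add: add_ac)
    then show ?thesis
      using xy True by (simp add: v_def)
  next
    case False
    then have "k + 1 \<le> d + i"
      using k_range by simp
    then have "of_int k + 1 \<le> e"
      by linarith
    then show ?thesis
      using xy constants_order unfolding v_def by linarith
  qed
  moreover have "C < n / x - of_int k \<or> d' + 1 + B < v"
  proof (cases "k = d")
    case True
    then show ?thesis
      using reciprocal_constants[OF pos(1)] xy by simp
  next
    case False
    then have "d + 1 \<le> k"
      using k_range by simp
    then have "d' + 1 \<le> of_int k"
      by linarith
    then show ?thesis
      using xy unfolding v_def by linarith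
  qed
  ultimately have "B < n / v" "n / v < B + 1" "C < n / x - of_int k \<or> n / v < D"
    using reciprocal_constants[OF v(3)] v(2) by auto
  then show "natext N A (x, y) \<in> base_domain"
    using k xy by (simp add: branch_def base_domain_def v_def)
  have "\<lfloor>v - B\<rfloor> = k"
    using xy by (intro floor_unique) (auto simp: v_def)
  then show "base_inverse (natext N A (x, y)) = (x, y)"
    using v n_pos pos unfolding k(3) by (simp add: base_inverse_def Let_def branch_def v_def)
  show "\<exists>k\<ge>0. (x, y) \<in> quadrant \<and> of_int k < n / x \<and> natext N A (x, y) = branch k (x, y)"
    using k k_range d pos A_pos by (intro exI[of _ k]) (auto simp: quadrant_def)
qed

lemma base_step_inverse:
  assumes "(x, y) \<in> base_domain"
  shows "base_inverse (x, y) \<in> base_domain" "natext N A (base_inverse (x, y)) = (x, y)"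
proof -
  have xy: "x \<notin> K" "y \<notin> K" "A < x" "x < A + 1" "B < y" "y < B + 1" "C < x \<or> y < D"
    using assms by (auto simp: base_domain_def)
  have pos: "0 < x" "0 < y"
    using xy A_pos B_pos by auto
  define k where "k = \<lfloor>n / y - B\<rfloor>"
  define v where "v = n / y - of_int k"
  have "v \<notin> K"
    using xy by (simp add: v_def)
  then have "v \<noteq> B"
    using constants_in_K by metis
  then have v: "B < v" "v < B + 1"
    by (auto simp: v_def k_def) linarith+
  have "d' - 1 < of_int k" "of_int k < e + 1"
    using v reciprocal_constants[OF pos(2)] xy constants_facts unfolding v_def by argo+
  then have k_range: "d \<le> k" "k \<le> d + i"
    by linarith+
  define u where "u = x + of_int k"
  have u: "u > 0" "n / (n / u) = u" "n / u > 0"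
    using k_range pos d n_pos by (auto simp: u_def)
  have "u < A + 1 + e"
    using k_range xy by (auto simp: u_def)
  moreover have "d' + C < u"
  proof (cases "k = d")
    case True
    then show ?thesis
      using v reciprocal_constants[OF pos(2)] xy by (auto simp: u_def v_def)
  next
    case False
    then have "d + 1 \<le> k"
      using k_range by simp
    then have "d' + 1 \<le> of_int k"
      by linarith
    then show ?thesis
      using xy constants_order unfolding u_def by linarith
  qed
  moreover have "u < e + A \<or> v < D"
  proof (cases "k = d + i")
    case True
    then show ?thesis
      using v reciprocal_constants[OF pos(2)] xy by (auto simp: v_def)
  next
    case False
    then have "k + 1 \<le> d + i"
      using k_range by simp
    then have "of_int k + 1 \<le> e"
      by linarith
    then show ?thesis
      using xy unfolding u_def by linarith
  qed
  ultimately have nu: "A < n / u" "n / u < A + 1" "C < n / u \<or> v < D"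
    using reciprocal_constants[OF u(3)] u(2) by auto
  have eq: "base_inverse (x, y) = (n / u, v)"
    by (simp add: base_inverse_def Let_def u_def v_def k_def)
  show "base_inverse (x, y) \<in> base_domain"
    using nu v xy unfolding eq by (simp add: base_domain_def u_def v_def)
  have "natext N A (n / u, v) = branch k (n / u, v)"
    using nu xy u(2) by (intro natext_eq_branch) (auto simp: u_def)
  then show "natext N A (base_inverse (x, y)) = (x, y)"
    using u(2) n_pos unfolding eq by (simp add: branch_def u_def v_def)
qed

lemma N_nonzero [simp]: "N \<noteq> 0"
  using N by simp

lemma double_reciprocal [simp]: "n / (n / x) = x"
  using n_pos by simp

end

section \<open>The change of domain\<close>

text \<open>The bijection for a parameter \<open>\<gamma>\<close>. The case \<open>\<gamma> = A\<close> is included and gives the identity.\<close>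

locale matching_parameter = matching_grid +
  fixes \<gamma> :: real
  assumes \<gamma>: "A \<le> \<gamma>" "\<gamma> \<le> B" "\<gamma> \<in> K"
begin

abbreviation "L1 \<equiv> l1 \<gamma>"
abbreviation "L2 \<equiv> l2 \<gamma>"
abbreviation "H1 \<equiv> h1 \<gamma>"
abbreviation "H2 \<equiv> h2 \<gamma>"

lemma orbit_in_K: "L1 \<in> K" "L2 \<in> K" "H1 \<in> K" "H2 \<in> K"
proof -
  show "L1 \<in> K" "H1 \<in> K"
    using \<gamma>(3) unfolding lo1_def hi1_def by simp_all
  then show "L2 \<in> K" "H2 \<in> K"
    unfolding lo2_def hi2_def by simp_all
qed

lemma not_in_K:
  assumes "x \<notin> K"
  shows "x \<noteq> A \<and> x \<noteq> B \<and> x \<noteq> C \<and> x \<noteq> D \<and> x \<noteq> A + 1 \<and> x \<noteq> B + 1 \<and>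
    x \<noteq> \<gamma> \<and> x \<noteq> \<gamma> + 1 \<and> x \<noteq> L1 \<and> x \<noteq> L2 \<and> x \<noteq> H1 \<and> x \<noteq> H2"
  using assms constants_in_K orbit_in_K \<gamma>(3) K_succ by metis

lemma parameter_facts:
  "0 < A" "A < B" "B < C" "C < D" "D < A + 1" "1 \<le> d'" "d' + 2 \<le> e"
  "A \<le> \<gamma>" "\<gamma> \<le> B" "D \<le> L1" "L1 \<le> A + 1" "B \<le> H1" "H1 \<le> C" "C \<le> L2" "L2 \<le> B + 1"
  "A \<le> H2" "H2 \<le> D" "\<gamma> \<le> H2" "L2 \<le> \<gamma> + 1"
  using constants_facts \<gamma> orbit_bounds[OF \<gamma>(1,2)] by auto

lemma reciprocal_parameter:
  assumes "0 < x"
  shows "x < \<gamma> \<longleftrightarrow> L1 + e < n / x" "\<gamma> < x \<longleftrightarrow> n / x < L1 + e"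
    "x < \<gamma> + 1 \<longleftrightarrow> H1 + d' < n / x" "\<gamma> + 1 < x \<longleftrightarrow> n / x < H1 + d'"
    "x < L1 \<longleftrightarrow> L2 + d' < n / x" "L1 < x \<longleftrightarrow> n / x < L2 + d'"
    "x < H1 \<longleftrightarrow> H2 + e < n / x" "H1 < x \<longleftrightarrow> n / x < H2 + e"
    "x < H2 \<longleftrightarrow> n / L2 + 1 < n / x" "H2 < x \<longleftrightarrow> n / x < n / L2 + 1"
    "x < L2 \<longleftrightarrow> n / L2 < n / x" "L2 < x \<longleftrightarrow> n / x < n / L2"
  using assms less_iff_reciprocal[of x \<gamma>] less_iff_reciprocal[of \<gamma> x]
    less_iff_reciprocal[of x "\<gamma> + 1"] less_iff_reciprocal[of "\<gamma> + 1" x]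
    less_iff_reciprocal[of x L1] less_iff_reciprocal[of L1 x]
    less_iff_reciprocal[of x H1] less_iff_reciprocal[of H1 x]
    less_iff_reciprocal[of x H2] less_iff_reciprocal[of H2 x]
    less_iff_reciprocal[of x L2] less_iff_reciprocal[of L2 x]
    parameter_facts orbit_reciprocals(1,2)[of \<gamma>] orbit_reciprocals(3,4)[of \<gamma>] orbit_matching[OF \<gamma>(1,2)]
  by simp_all

lemmas reciprocals = reciprocal_constants reciprocal_parameter

lemma L2_reciprocal: "n / L2 + 1 \<le> L1 + e" "n / L2 \<le> e + A" "d' + B \<le> n / L2"
proof -
  have "n / H2 \<le> n / \<gamma>" "n / L2 \<le> n / C" "n / (B + 1) \<le> n / L2"
    using parameter_facts n_pos by (auto intro!: divide_left_mono)
  then show "n / L2 + 1 \<le> L1 + e" "n / L2 \<le> e + A" "d' + B \<le> n / L2"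
    using orbit_matching[OF \<gamma>(1,2)] orbit_reciprocals(1)[of \<gamma>] C_eq(1) F_eq by simp_all
qed

text \<open>The points of \<open>Omega N d i \<gamma>\<close> off the grid \<open>K\<close>.\<close>

definition target_domain :: "(real \<times> real) set" where
  "target_domain = {(x, y). x \<notin> K \<and> y \<notin> K \<and> \<gamma> < x \<and> x < \<gamma> + 1 \<and> A < y \<and> y < B + 1 \<and>
     (x < H2 \<or> B < y) \<and> (x < L1 \<or> C < y) \<and> (L2 < x \<or> y < A + 1) \<and> (H1 < x \<or> y < D)}"

text \<open>The moves \<open>S\<close>, \<open>S\<^sup>-\<^sup>d J S J S\<^sup>e\<close> and \<open>J S J\<close>. The middle one undoes a step with digit \<open>e\<close>, translates,
  and takes a step with digit \<open>d\<close>, so it carries the first image of the strip to the first image of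
  the translated strip.\<close>

definition move0 :: "real \<times> real \<Rightarrow> real \<times> real" where
  "move0 = (\<lambda>(x, y). (x + 1, n / (n / y - 1)))"

definition move0_inv :: "real \<times> real \<Rightarrow> real \<times> real" where
  "move0_inv = (\<lambda>(x, y). (x - 1, n / (n / y + 1)))"

definition move1 :: "real \<times> real \<Rightarrow> real \<times> real" where
  "move1 = (\<lambda>(x, y). (n / (n / (x + e) + 1) - d', n / (d' + n / (n / (n / y - e) - 1))))"

definition move1_inv :: "real \<times> real \<Rightarrow> real \<times> real" where
  "move1_inv = (\<lambda>(x, y). (n / (n / (x + d') - 1) - e, n / (e + n / (n / (n / y - d') + 1))))"

definition move2 :: "real \<times> real \<Rightarrow> real \<times> real" where
  "move2 = (\<lambda>(x, y). (n / (n / x + 1), y - 1))"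

definition move2_inv :: "real \<times> real \<Rightarrow> real \<times> real" where
  "move2_inv = (\<lambda>(x, y). (n / (n / x - 1), y + 1))"

text \<open>The strip \<open>x < \<gamma>\<close> is moved by \<open>S\<close>, its first image \<open>L1 < x, y < C\<close> by \<open>move1\<close> and its second image
  \<open>C < x < L2, y > A + 1\<close> by \<open>J S J\<close>. These regions can overlap with the
  regions to be filled: a translated point may land in the continuation of the second image beyond
  \<open>x = A + 1\<close>, and a point moved by \<open>J S J\<close> may land to the left of \<open>\<gamma>\<close>. Such points are moved once
  more. A third move never occurs.\<close>

definition psi :: "real \<times> real \<Rightarrow> real \<times> real" where
  "psi = (\<lambda>(x, y).
     if x < \<gamma> then
       (if x + 1 < L2 \<and> A + 1 < n / (n / y - 1) then move2 (move0 (x, y)) else move0 (x, y))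
     else if L1 < x \<and> y < C then move1 (x, y)
     else if C < x \<and> x < L2 \<and> A + 1 < y then
       (if n / (n / x + 1) < \<gamma> then move0 (move2 (x, y)) else move2 (x, y))
     else (x, y))"

definition psi_inv :: "real \<times> real \<Rightarrow> real \<times> real" where
  "psi_inv = (\<lambda>(x, y).
     if x < H2 \<and> y < B then
       (if A + 1 < n / (n / x - 1) then move0_inv (move2_inv (x, y)) else move2_inv (x, y))
     else if x < C \<and> D < y then move1_inv (x, y)
     else if A + 1 < x then
       (if n / (n / y + 1) < B then move2_inv (move0_inv (x, y)) else move0_inv (x, y))
     else (x, y))"

text \<open>Each nested quotient is built up through auxiliary quantities \<open>n / u\<close>, and the bounds for these come from the reciprocal equivalences.\<close>

lemma psi_correct:
  assumes "(x, y) \<in> base_domain"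
  shows "psi (x, y) \<in> target_domain \<and> psi_inv (psi (x, y)) = (x, y)"
proof -
  have xyK: "x \<notin> K" "y \<notin> K"
    and xy: "A < x" "x < A + 1" "B < y" "y < B + 1" "C < x \<or> y < D"
    using assms by (auto simp: base_domain_def)
  have pos: "0 < x" "0 < y"
    using xy A_pos B_pos by auto
  note neq = not_in_K[OF xyK(1)] not_in_K[OF xyK(2)]
  note facts = parameter_facts L2_reciprocal
  consider "x < \<gamma>" | "\<gamma> < x" "L1 < x" "y < C"
    | "\<gamma> < x" "C < x" "x < L2" "A + 1 < y"
    | "\<gamma> < x" "x < L1 \<or> C < y" "x < C \<or> L2 < x \<or> y < A + 1"
    using neq facts by argo
  then show ?thesis
  proof cases
    case 1
    define u where "u = n / y - 1"
    have u: "d' + B < u" "u < e + D - 1"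
      using reciprocals[OF pos(2)] xy 1 facts unfolding u_def by argo+
    then have upos: "0 < n / u"
      using facts n_pos by simp
    have y1: "C < n / u" "n / u < B + 1"
      using reciprocals[OF upos] u facts unfolding double_reciprocal by argo+
    have yu: "n / (u + 1) = y"
      by (simp add: u_def)
    have uK: "n / u \<notin> K"
      using xyK by (simp add: u_def)
    show ?thesis
    proof (cases "x + 1 < L2 \<and> A + 1 < n / u")
      case False
      then have psi: "psi (x, y) = (x + 1, n / u)"
        using 1 by (auto simp: psi_def move0_def u_def)
      have "(x + 1, n / u) \<in> target_domain"
        using False y1 1 xy facts xyK uK not_in_K[OF uK] not_in_K[of "x + 1"]
        unfolding target_domain_def by auto
      moreover have "psi_inv (x + 1, n / u) = (x, y)"
        using y1 xy facts by (simp add: psi_inv_def move0_inv_def yu)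
      ultimately show ?thesis
        by (simp add: psi)
    next
      case True
      define v where "v = n / (x + 1) + 1"
      have v: "v < L1 + e" "n / L2 + 1 < v"
        using reciprocals[of "x + 1"] pos 1 xy True facts unfolding v_def by argo+
      have vpos: "0 < n / v"
        using n_pos pos by (auto simp: v_def intro!: divide_pos_pos add_pos_pos)
      have x2: "\<gamma> < n / v" "n / v < H2"
        using reciprocals[OF vpos] v facts unfolding double_reciprocal by argo+
      have psi: "psi (x, y) = (n / v, n / u - 1)"
        using 1 True by (simp add: psi_def move0_def move2_def u_def v_def)
      have vK: "n / v \<notin> K"
        using xyK by (simp add: v_def)
      have "(n / v, n / u - 1) \<in> target_domain"
        using x2 True y1 facts vK uK unfolding target_domain_def by auto
      moreover have "psi_inv (n / v, n / u - 1) = (x, y)"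
        using x2 y1 True xy facts
        by (simp add: psi_inv_def move0_inv_def move2_inv_def yu) (simp add: v_def)
      ultimately show ?thesis
        by (simp add: psi)
    qed
  next
    case 2
    define s where "s = n / (x + e)"
    define t where "t = n / y - e"
    have spos: "0 < s"
      using pos n_pos facts by (simp add: s_def)
    have s: "A < s" "s < \<gamma>"
      using reciprocals[OF spos] 2 xy facts unfolding s_def double_reciprocal by argo+
    have t: "A < t" "t < D"
      using reciprocals[OF pos(2)] 2 xy facts unfolding t_def by argo+
    define h where "h = n / (s + 1) - d'"
    have h: "H1 < h" "h < C"
      using reciprocals[of "s + 1"] s facts unfolding h_def by argo+
    define u where "u = n / t - 1"
    have u: "d' + B < u" "u < A + e"
      using reciprocals[of t] t facts unfolding u_def by argo+
    have upos: "0 < n / u"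
      using u facts n_pos by simp
    define w where "w = d' + n / u"
    have w: "d' + C < w" "w < d' + 1 + B"
      using reciprocals[OF upos] u facts unfolding w_def double_reciprocal by argo+
    have wpos: "0 < n / w"
      using w facts n_pos by simp
    have y1: "D < n / w" "n / w < A + 1"
      using reciprocals[OF wpos] w facts unfolding double_reciprocal by argo+
    have psi: "psi (x, y) = (h, n / w)"
      using 2 by (simp add: psi_def move1_def s_def t_def u_def w_def h_def)
    have "(h, n / w) \<in> target_domain"
      using h y1 facts xyK
      unfolding target_domain_def by (auto simp: h_def w_def u_def t_def s_def)
    moreover have "psi_inv (h, n / w) = (x, y)"
    proof -
      have "n / (h + d') - 1 = s" "n / s - e = x"
        by (simp_all add: h_def s_def)
      moreover have "n / w = n / w" "w - d' = n / u" "n / (u + 1) = t" "n / (e + t) = y"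
        by (simp_all add: w_def u_def t_def)
      ultimately show ?thesis
        using h y1 facts by (simp add: psi_inv_def move1_inv_def)
    qed
    ultimately show ?thesis
      by (simp add: psi)
  next
    case 3
    define v where "v = n / x + 1"
    have v: "v < A + 1 + e" "n / L2 + 1 < v"
      using reciprocals[OF pos(1)] xy 3 facts unfolding v_def by argo+
    have vpos: "0 < n / v"
      using n_pos pos by (auto simp: v_def intro!: divide_pos_pos add_pos_pos)
    have x2: "A < n / v" "n / v < H2"
      using reciprocals[OF vpos] v facts unfolding double_reciprocal by argo+
    have xv: "n / (v - 1) = x"
      by (simp add: v_def)
    have vK: "n / v \<notin> K"
      using xyK by (simp add: v_def)
    show ?thesis
    proof (cases "n / v < \<gamma>")
      case False
      then have "\<gamma> < n / v"
        using not_in_K[OF vK] by argo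
      have psi: "psi (x, y) = (n / v, y - 1)"
        using 3 False facts by (simp add: psi_def move2_def v_def)
      have "(n / v, y - 1) \<in> target_domain"
        using x2 xy facts 3 vK xyK \<open>\<gamma> < n / v\<close> unfolding target_domain_def by auto
      moreover have "psi_inv (n / v, y - 1) = (x, y)"
        using x2 xy facts by (simp add: psi_inv_def move2_inv_def xv)
      ultimately show ?thesis
        by (simp add: psi)
    next
      case True
      define u where "u = n / (y - 1) - 1"
      have u: "d' + C < u" "u < e + A"
        using reciprocals[of "y - 1"] 3 xy facts unfolding u_def by argo+
      have upos: "0 < n / u"
        using u facts n_pos by simp
      have y3: "C < n / u" "n / u < A + 1"
        using reciprocals[OF upos] u facts unfolding double_reciprocal by argo+
      have psi: "psi (x, y) = (n / v + 1, n / u)"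
        using 3 True facts by (simp add: psi_def move0_def move2_def v_def u_def)
      have yu: "n / (u + 1) = y - 1"
        by (simp add: u_def)
      have uK: "n / u \<notin> K"
        using xyK by (simp add: u_def)
      have "(n / v + 1, n / u) \<in> target_domain"
        using x2 True y3 xy facts vK uK unfolding target_domain_def by auto
      moreover have "psi_inv (n / v + 1, n / u) = (x, y)"
        using x2 y3 xy facts by (simp add: psi_inv_def move0_inv_def move2_inv_def yu xv)
      ultimately show ?thesis
        by (simp add: psi)
    qed
  next
    case 4
    then have psi: "psi (x, y) = (x, y)"
      by (auto simp: psi_def)
    have "(x, y) \<in> target_domain"
      using 4 xy facts xyK neq unfolding target_domain_def by auto
    moreover have "psi_inv (x, y) = (x, y)"
      using xy by (auto simp: psi_inv_def)
    ultimately show ?thesis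
      by (simp add: psi)
  qed
qed

lemma psi_inv_correct:
  assumes "(x, y) \<in> target_domain"
  shows "psi_inv (x, y) \<in> base_domain \<and> psi (psi_inv (x, y)) = (x, y)"
proof -
  have xyK: "x \<notin> K" "y \<notin> K"
    and xy: "\<gamma> < x" "x < \<gamma> + 1" "A < y" "y < B + 1" "x < H2 \<or> B < y" "x < L1 \<or> C < y"
      "L2 < x \<or> y < A + 1" "H1 < x \<or> y < D"
    using assms by (auto simp: target_domain_def)
  note facts = parameter_facts L2_reciprocal
  have pos: "0 < x" "0 < y"
    using xy facts by argo+
  note neq = not_in_K[OF xyK(1)] not_in_K[OF xyK(2)]
  consider "x < H2" "y < B" | "B < y" "x < C" "D < y" | "B < y" "A + 1 < x"
    | "B < y" "x < A + 1" "C < x \<or> y < D"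
    using neq facts xy by argo
  then show ?thesis
  proof cases
    case 1
    define v where "v = n / x - 1"
    have v: "n / L2 < v" "v < L1 + e - 1"
      using reciprocals[OF pos(1)] xy 1 facts unfolding v_def by argo+
    have vpos: "0 < n / v"
      using v facts n_pos by (intro divide_pos_pos) auto
    have x1: "C < n / v" "n / v < L2"
      using reciprocals[OF vpos] v facts unfolding double_reciprocal by argo+
    have xv: "n / (v + 1) = x"
      by (simp add: v_def)
    have vK: "n / v \<notin> K"
      using xyK by (simp add: v_def)
    show ?thesis
    proof (cases "A + 1 < n / v")
      case False
      then have psi: "psi_inv (x, y) = (n / v, y + 1)"
        using 1 by (simp add: psi_inv_def move2_inv_def v_def)
      have "(n / v, y + 1) \<in> base_domain"
        using False not_in_K[OF vK] x1 1 xy facts vK xyK unfolding base_domain_def by auto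
      moreover have "psi (n / v, y + 1) = (x, y)"
        using x1 1 xy facts by (simp add: psi_def move2_def xv)
      ultimately show ?thesis
        by (simp add: psi)
    next
      case True
      define u where "u = n / (y + 1) + 1"
      have u: "d' + 1 + B < u" "u < d' + 1 + C"
        using reciprocals[of "y + 1"] xy 1 facts unfolding u_def by argo+
      have upos: "0 < n / u"
        using u facts n_pos by (intro divide_pos_pos) auto
      have y1: "B < n / u" "n / u < D"
        using reciprocals[OF upos] u facts unfolding double_reciprocal by argo+
      have yu: "n / (u - 1) = y + 1"
        by (simp add: u_def)
      have uK: "n / u \<notin> K"
        using xyK by (simp add: u_def)
      have psi: "psi_inv (x, y) = (n / v - 1, n / u)"
        using 1 True by (simp add: psi_inv_def move2_inv_def move0_inv_def v_def u_def)
      have "(n / v - 1, n / u) \<in> base_domain"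
        using True x1 y1 facts vK uK unfolding base_domain_def by auto
      moreover have "psi (n / v - 1, n / u) = (x, y)"
        using True x1 1 xy facts by (simp add: psi_def move0_def move2_def yu xv)
      ultimately show ?thesis
        by (simp add: psi)
    qed
  next
    case 2
    define s where "s = n / (x + d') - 1"
    have xd: "H1 < x" "y < A + 1" "0 < x + d'"
      using 2 xy facts pos by argo+
    have s: "A < s" "s < \<gamma>"
    proof -
      have "0 < n / (x + d')"
        using xd n_pos by simp
      from reciprocals[OF this] show "A < s" "s < \<gamma>"
        using 2 xd facts unfolding s_def double_reciprocal by argo+
    qed
    define l where "l = n / s - e"
    have l: "L1 < l" "l < A + 1"
      using reciprocals[of s] s facts unfolding l_def by argo+
    define u where "u = n / y - d'"
    have u: "C < u" "u < B + 1"
      using reciprocals[OF pos(2)] 2 xd facts unfolding u_def by argo+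
    define t where "t = n / (n / u + 1)"
    have t: "A < t" "t < D"
    proof -
      have "0 < n / u"
        using u facts n_pos by simp
      then have "0 < t"
        using n_pos by (simp add: t_def)
      from reciprocals[OF this] show "A < t" "t < D"
        using reciprocals[of u] u facts unfolding t_def double_reciprocal by argo+
    qed
    have y1: "B < n / (e + t)" "n / (e + t) < C"
    proof -
      have "0 < n / (e + t)"
        using t facts n_pos by simp
      from reciprocals[OF this] show "B < n / (e + t)" "n / (e + t) < C"
        using t facts unfolding double_reciprocal by argo+
    qed
    have psi: "psi_inv (x, y) = (l, n / (e + t))"
      using 2 by (simp add: psi_inv_def move1_inv_def s_def t_def u_def l_def)
    have "(l, n / (e + t)) \<in> base_domain"
      using l y1 facts xyK unfolding base_domain_def by (auto simp: l_def t_def u_def s_def)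
    moreover have "psi (l, n / (e + t)) = (x, y)"
    proof -
      have "n / (l + e) + 1 = n / (x + d')" "e + t - e = t" "n / t - 1 = n / u" "d' + u = n / y"
        by (simp_all add: l_def s_def t_def u_def)
      then show ?thesis
        using l y1 facts by (simp add: psi_def move1_def)
    qed
    ultimately show ?thesis
      by (simp add: psi)
  next
    case 3
    define u where "u = n / y + 1"
    have y: "C < y" "H1 < x" "H2 < x"
      using 3 xy facts by argo+
    have u: "d' + B + 1 < u" "u < e + A + 1"
      using reciprocals[OF pos(2)] xy y facts unfolding u_def by argo+
    have upos: "0 < n / u"
      using u facts n_pos by (intro divide_pos_pos) auto
    have y1: "A < n / u" "n / u < D"
      using reciprocals[OF upos] u facts unfolding double_reciprocal by argo+
    have yu: "n / (u - 1) = y"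
      by (simp add: u_def)
    have uK: "n / u \<notin> K"
      using xyK by (simp add: u_def)
    show ?thesis
    proof (cases "n / u < B")
      case False
      then have psi: "psi_inv (x, y) = (x - 1, n / u)"
        using 3 y facts by (auto simp: psi_inv_def move0_inv_def u_def)
      have "(x - 1, n / u) \<in> base_domain"
        using False not_in_K[OF uK] y1 3 xy facts uK xyK unfolding base_domain_def by auto
      moreover have "psi (x - 1, n / u) = (x, y)"
        using 3 xy facts by (auto simp: psi_def move0_def yu)
      ultimately show ?thesis
        by (simp add: psi)
    next
      case True
      define v where "v = n / (x - 1) - 1"
      have v: "L1 + e - 1 < v" "v < A + e"
        using reciprocals[of "x - 1"] xy 3 facts unfolding v_def by argo+
      have vpos: "0 < n / v"
        using v facts n_pos by (intro divide_pos_pos) auto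
      have x1: "C < n / v" "n / v < L2" "n / v < A + 1"
        using reciprocals[OF vpos] v facts unfolding double_reciprocal by argo+
      have xv: "n / (v + 1) = x - 1"
        by (simp add: v_def)
      have vK: "n / v \<notin> K"
        using xyK by (simp add: v_def)
      have psi: "psi_inv (x, y) = (n / v, n / u + 1)"
        using 3 y True facts by (auto simp: psi_inv_def move0_inv_def move2_inv_def u_def v_def)
      have "(n / v, n / u + 1) \<in> base_domain"
        using True x1 y1 facts vK uK unfolding base_domain_def by auto
      moreover have "psi (n / v, n / u + 1) = (x, y)"
        using x1 y1 xy facts by (simp add: psi_def move0_def move2_def yu xv)
      ultimately show ?thesis
        by (simp add: psi)
    qed
  next
    case 4
    then have psi: "psi_inv (x, y) = (x, y)"
      by (auto simp: psi_inv_def)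
    have "(x, y) \<in> base_domain"
      using 4 xy facts xyK unfolding base_domain_def by auto
    moreover have "psi (x, y) = (x, y)"
      using xy by (auto simp: psi_def)
    ultimately show ?thesis
      by (simp add: psi)
  qed
qed

end

section \<open>The conjugacy\<close>

context matching_parameter begin

lemma natext_parameter:
  assumes "\<gamma> < n / x - of_int k" "n / x - of_int k < \<gamma> + 1"
  shows "natext N \<gamma> (x, y) = (n / x - of_int k, n / (of_int k + y))"
  using natext_eq_branch[OF assms] by (simp add: branch_def)

text \<open>After the translation the digit is always \<open>d\<close>, because \<open>\<gamma> \<le> B \<le> H1\<close>.\<close>

lemma natext_move0:
  assumes "A < x" "x < \<gamma>"
  shows "natext N \<gamma> (x + 1, y) = (n / (x + 1) - d', n / (d' + y))"
proof (rule natext_parameter)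
  have "0 < x + 1"
    using assms A_pos by simp
  from reciprocals[OF this] show "\<gamma> < n / (x + 1) - d'" "n / (x + 1) - d' < \<gamma> + 1"
    using assms parameter_facts by argo+
qed

text \<open>Let \<open>(x', y')\<close> be the image of a fixed point of \<open>\<psi>\<close> under the base map. If \<open>\<gamma> < x'\<close>, then both systems
  use the same digit. If \<open>x' < \<gamma>\<close>, then the digit for \<open>\<gamma>\<close> is smaller by one, and its image is the
  translate of \<open>(x', y')\<close>, which is what \<open>\<psi>\<close> prescribes. One must also exclude that \<open>(x', y')\<close>,
  respectively its translate, lies in one of the other two strips; this holds since these are the
  images of strips that \<open>\<psi>\<close> moves.
  On the moved strips the digits are known, up to the same ambiguity of one, and the claim becomes
  one of the matching identities.\<close>

lemma conjugacy:
  assumes "(x, y) \<in> base_domain"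
  shows "psi (natext N A (x, y)) = natext N \<gamma> (psi (x, y))"
proof -
  have xyK: "x \<notin> K" "y \<notin> K"
    and xy: "A < x" "x < A + 1" "B < y" "y < B + 1" "C < x \<or> y < D"
    using assms by (auto simp: base_domain_def)
  have pos: "0 < x" "0 < y"
    using xy A_pos B_pos by auto
  note neq = not_in_K[OF xyK(1)] not_in_K[OF xyK(2)]
  note facts = parameter_facts L2_reciprocal
  obtain k where k: "A < n / x - of_int k" "n / x - of_int k < A + 1"
    and natext_A: "natext N A (x, y) = (n / x - of_int k, n / (of_int k + y))"
    using natext_branch_exists[OF xyK(1) AB_in_K(1)] unfolding branch_def
    by (metis (no_types, lifting) case_prod_conv)
  have "of_int k < e + 1" "d' - 1 < of_int k"
    using k reciprocals[OF pos(1)] xy facts by argo+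
  then have k_range: "d \<le> k" "k \<le> d + i"
    by linarith+
  define x' where "x' = n / x - of_int k"
  define b where "b = of_int k + y"
  have bpos: "0 < n / b"
    using k_range pos d n_pos unfolding b_def by (intro divide_pos_pos) auto
  note y' = reciprocals[OF bpos, unfolded double_reciprocal]
  have x'K: "x' \<notin> K"
    using xyK by (simp add: x'_def)
  have natext_A': "natext N A (x, y) = (x', n / b)"
    by (simp add: natext_A x'_def b_def)
  consider "x < \<gamma>" | "\<gamma> < x" "L1 < x" "y < C"
    | "\<gamma> < x" "C < x" "x < L2" "A + 1 < y"
    | "\<gamma> < x" "x < L1 \<or> C < y" "x < C \<or> L2 < x \<or> y < A + 1"
    using neq facts by argo
  then show ?thesis
  proof cases
    case 1
    have "of_int k < e + 1" "e - 1 < of_int k"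
      using k reciprocals[OF pos(1)] 1 xy facts by argo+
    then have ke: "k = d + i"
      by linarith
    have "L1 < x'" "n / b < C"
      using reciprocals[OF pos(1)] y' 1 xy facts by (auto simp: x'_def b_def ke)
    then have "psi (x', n / b) = move1 (x', n / b)"
      using facts by (simp add: psi_def)
    also have "\<dots> = (n / (x + 1) - d', n / (d' + n / (n / y - 1)))"
      by (simp add: move1_def x'_def b_def ke)
    finally have lhs: "psi (x', n / b) = \<dots>" .
    show ?thesis
    proof (cases "x + 1 < L2 \<and> A + 1 < n / (n / y - 1)")
      case False
      then have "psi (x, y) = (x + 1, n / (n / y - 1))"
        using 1 by (auto simp: psi_def move0_def)
      then show ?thesis
        using natext_move0[OF xy(1) 1] by (simp add: natext_A' lhs)
    next
      case True
      define v where "v = n / (x + 1) + 1"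
      have psi: "psi (x, y) = (n / v, n / (n / y - 1) - 1)"
        using 1 True by (simp add: psi_def move0_def move2_def v_def)
      have "\<gamma> < v - 1 - d'" "v - 1 - d' < \<gamma> + 1"
        using reciprocals[of "x + 1"] pos xy 1 facts unfolding v_def by argo+
      then have "natext N \<gamma> (psi (x, y)) =
          (n / (n / v) - of_int (d + 1), n / (of_int (d + 1) + (n / (n / y - 1) - 1)))"
        unfolding psi by (intro natext_parameter) auto
      then show ?thesis
        by (simp add: natext_A' lhs v_def)
    qed
  next
    case 2
    define s where "s = n / (x + e)"
    define t where "t = n / y - e"
    define h where "h = n / (s + 1) - d'"
    define p where "p = n / x - d'"
    \<comment> \<open>In the notation of \<open>orbit_matching\<close>, \<open>x = l1 s\<close>, \<open>p = l2 s\<close>, \<open>h = h1 s\<close> and \<open>q = h2 s\<close>.\<close>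
    define q where "q = n / (n / p + 1)"
    have spos: "0 < s"
      using pos n_pos facts by (simp add: s_def)
    have s: "A < s" "s < \<gamma>"
      using reciprocals[OF spos] 2 xy facts unfolding s_def double_reciprocal by argo+
    have t: "A < t" "t < D"
      using reciprocals[OF pos(2)] 2 xy facts unfolding t_def by argo+
    have p: "p < L2" "C < p" "p < B + 1"
      using reciprocals[OF pos(1)] 2 xy facts unfolding p_def by argo+
    have ppos: "0 < p"
      using p facts by argo
    have l1: "l1 s = x" "l2 s = p" "h1 s = h" "h2 s = n / h - e"
      by (simp_all add: lo1_def lo2_def hi1_def hi2_def s_def p_def h_def)
    have s': "A \<le> s" "s \<le> B"
      using s facts by auto
    have q: "n / h - e = q"
      using orbit_matching[OF s'] unfolding l1 q_def by (metis double_reciprocal)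
    have q_bounds: "A \<le> q" "q \<le> D"
      using orbit_bounds[OF s'] unfolding l1 q by auto
    have qK: "q \<notin> K"
      using xyK by (simp add: q_def p_def)
    define w where "w = n / (d' + n / (n / t - 1))"
    define r where "r = n / (d' + y) - 1"
    have "t < n"
    proof -
      have "1 < n / D"
        using facts by (simp add: D_eq(1))
      then show ?thesis
        using t D_pos by (simp add: less_divide_eq)
    qed
    then have "n / (e + w) = r"
      using dual_matching[of t] t facts by (simp add: w_def r_def t_def)
    then have ew: "e + w = n / r"
      by (metis double_reciprocal)
    have psi: "psi (x, y) = (h, w)"
      using 2 by (simp add: psi_def move1_def s_def t_def h_def w_def)
    have rhs: "natext N \<gamma> (psi (x, y)) = (if q < \<gamma> then move0 (q, r) else (q, r))"
    proof (cases "q < \<gamma>")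
      case True
      have "natext N \<gamma> (psi (x, y)) = (n / h - of_int (d + i - 1), n / (of_int (d + i - 1) + w))"
        unfolding psi using True q q_bounds facts by (intro natext_parameter) auto
      moreover have "of_int (d + i - 1) + w = n / r - 1" "n / h - of_int (d + i - 1) = q + 1"
        using ew q by simp_all
      ultimately show ?thesis
        using True by (simp add: move0_def)
    next
      case False
      then have "\<gamma> < q"
        using not_in_K[OF qK] by argo
      have "natext N \<gamma> (psi (x, y)) = (n / h - of_int (d + i), n / (of_int (d + i) + w))"
        unfolding psi using \<open>\<gamma> < q\<close> q q_bounds facts by (intro natext_parameter) auto
      moreover have "of_int (d + i) + w = n / r" "n / h - of_int (d + i) = q"
        using ew q by simp_all
      ultimately show ?thesis
        using False by simp
    qed
    have Y: "A + 1 < n / (d' + y)"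
    proof -
      have "0 < n / (d' + y)"
        using pos facts n_pos by simp
      from reciprocals[OF this, unfolded double_reciprocal] show ?thesis
        using 2 by simp
    qed
    show ?thesis
    proof (cases "p < A + 1")
      case True
      have "of_int k < d' + 1" "d' - 1 < of_int k"
        using k True p facts unfolding p_def by argo+
      then have kd: "k = d"
        by linarith
      have "psi (p, n / (d' + y)) = (if q < \<gamma> then move0 (q, r) else (q, r))"
        using p Y facts by (simp add: psi_def move2_def q_def r_def)
      then show ?thesis
        using rhs by (simp add: natext_A kd p_def)
    next
      case False
      have "p \<notin> K"
        using xyK by (simp add: p_def)
      then have p1: "A + 1 < p"
        using False not_in_K[of p] by argo
      have "of_int k < d' + 2" "d' < of_int k"
        using k p1 p facts unfolding p_def by argo+
      then have kd: "k = d + 1"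
        by linarith
      have "\<not> q < \<gamma>"
      proof -
        have "0 < n / p + 1"
          using ppos n_pos by (simp add: add_pos_pos)
        then have "0 < q"
          using n_pos by (simp add: q_def)
        from reciprocals[OF this] show ?thesis
          using reciprocals[OF ppos] p1 facts unfolding q_def double_reciprocal by argo
      qed
      have "psi (p - 1, n / (d' + 1 + y)) = (q, r)"
        using p Y facts by (simp add: psi_def move0_def move2_def q_def r_def)
      then show ?thesis
        using rhs \<open>\<not> q < \<gamma>\<close> by (simp add: natext_A kd p_def diff_diff_eq)
    qed
  next
    case 3
    define v where "v = n / x + 1"
    have v: "v < A + 1 + e" "n / L2 + 1 < v" "n / x < e + A"
      using reciprocals[OF pos(1)] xy 3 facts unfolding v_def by argo+
    have vpos: "0 < n / v"
      using n_pos pos by (auto simp: v_def intro!: divide_pos_pos add_pos_pos)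
    have vK: "n / v \<notin> K"
      using xyK by (simp add: v_def)
    have "of_int k < e"
      using k v facts by argo
    then have k_le: "k \<le> d + i - 1"
      by linarith
    show ?thesis
    proof (cases "n / v < \<gamma>")
      case False
      then have q: "\<gamma> < n / v"
        using not_in_K[OF vK] by argo
      have v_less: "v < L1 + e"
        using q reciprocal_parameter(2)[OF vpos] by simp
      have psi: "psi (x, y) = (n / v, y - 1)"
        using 3 False facts by (simp add: psi_def move2_def v_def)
      have d_le: "d' \<le> of_int k"
        using k_range by simp
      show ?thesis
      proof (cases "x' < \<gamma>")
        case False
        then have x': "\<gamma> < x'"
          using not_in_K[OF x'K] by argo
        have "natext N \<gamma> (psi (x, y)) = (v - of_int (k + 1), n / (of_int (k + 1) + (y - 1)))"
          unfolding psi using x' k q facts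
          by (subst natext_parameter[where k = "k + 1"]) (auto simp: v_def x'_def)
        then have rhs: "natext N \<gamma> (psi (x, y)) = (x', n / b)"
          by (simp add: x'_def b_def v_def)
        have "\<not> (L1 < x' \<and> n / b < C)"
        proof
          assume less: "L1 < x' \<and> n / b < C"
          then have "e + A < b"
            using reciprocal_constants(5,6)[OF bpos] by simp
          then have "e - 2 < of_int k"
            using xy facts unfolding b_def by linarith
          then have "k = d + i - 1"
            using k_le by linarith
          then show False
            using less v_less by (simp add: x'_def v_def)
        qed
        moreover have "\<not> A + 1 < n / b"
        proof -
          have "d' + C \<le> b"
            using d_le 3 facts unfolding b_def by linarith
          then show ?thesis
            using reciprocal_constants(10)[OF bpos] by simp
        qed
        ultimately have "psi (x', n / b) = (x', n / b)"
          using x' by (auto simp: psi_def)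
        then show ?thesis
          by (simp add: natext_A' rhs)
      next
        case True
        have "natext N \<gamma> (psi (x, y)) = (v - of_int k, n / (of_int k + (y - 1)))"
          unfolding psi using True k q facts
          by (subst natext_parameter[where k = k]) (auto simp: v_def x'_def)
        then have rhs: "natext N \<gamma> (psi (x, y)) = (x' + 1, n / (b - 1))"
          by (simp add: x'_def b_def v_def add_diff_eq)
        have "d' < of_int k"
        proof (rule ccontr)
          assume "\<not> d' < of_int k"
          then show False
            using d_le True v facts unfolding x'_def v_def by argo
        qed
        then have "d + 1 \<le> k"
          by simp
        then have "d' + 1 \<le> of_int k"
          by linarith
        moreover have "0 < n / (b - 1)"
          using calculation xy facts n_pos unfolding b_def by (intro divide_pos_pos) auto
        ultimately have "\<not> A + 1 < n / (b - 1)"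
          using reciprocals[of "n / (b - 1)"] 3 facts unfolding b_def double_reciprocal by argo
        then have "psi (x', n / b) = (x' + 1, n / (b - 1))"
          using True by (simp add: psi_def move0_def)
        then show ?thesis
          by (simp add: natext_A' rhs)
      qed
    next
      case True
      have q: "L1 + e < v" "A < n / v"
        using True v reciprocal_parameter(1)[OF vpos] reciprocal_constants(2)[OF vpos] by simp_all
      have "e - 2 < of_int k"
        using k q facts unfolding v_def by linarith
      then have ke: "k = d + i - 1"
        using k_le by linarith
      have psi: "psi (x, y) = (n / v + 1, n / (n / (y - 1) - 1))"
        using 3 True facts by (simp add: psi_def move0_def move2_def v_def)
      have "L1 < x'" "n / b < C"
        using q y' 3 by (auto simp: x'_def b_def v_def ke)
      then have "psi (x', n / b) = move1 (x', n / b)"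
        using facts by (simp add: psi_def)
      also have "\<dots> = (n / (n / v + 1) - d', n / (d' + n / (n / (y - 1) - 1)))"
      proof -
        have "x' + e = v" "b - e = y - 1"
          by (simp_all add: x'_def b_def v_def ke)
        then show ?thesis
          by (simp add: move1_def)
      qed
      finally show ?thesis
        using natext_move0[OF q(2) True] by (simp add: natext_A' psi)
    qed
  next
    case 4
    then have psi: "psi (x, y) = (x, y)"
      by (auto simp: psi_def)
    show ?thesis
    proof (cases "x' < \<gamma>")
      case False
      then have x': "\<gamma> < x'"
        using not_in_K[OF x'K] by argo
      have rhs: "natext N \<gamma> (psi (x, y)) = (x', n / b)"
        unfolding psi using x' k 4 facts
        by (subst natext_parameter[where k = k]) (auto simp: x'_def b_def)
      have "\<not> (L1 < x' \<and> n / b < C)"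
      proof
        assume less: "L1 < x' \<and> n / b < C"
        then have b: "e + A < b"
          using reciprocal_constants(5)[OF bpos] by simp
        have "x' + of_int k < L1 + e"
          using reciprocal_parameter(2)[OF pos(1)] 4 by (simp add: x'_def)
        then have "of_int k < e"
          using less by linarith
        moreover have "e - 2 < of_int k"
          using b xy facts unfolding b_def by linarith
        ultimately have "k = d + i - 1"
          by linarith
        then have "of_int k = e - 1"
          by simp
        moreover from this have "C < x"
          using reciprocal_constants(6)[OF pos(1)] k(2) by simp
        moreover from calculation have "x < L2"
          using reciprocal_parameter(11)[OF pos(1)] less facts unfolding x'_def by linarith
        ultimately show False
          using b 4 unfolding b_def by linarith
      qed
      moreover have "\<not> (x' < L2 \<and> A + 1 < n / b)"
      proof
        assume less: "x' < L2 \<and> A + 1 < n / b"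
        then have b: "b < d' + C"
          using reciprocal_constants(10)[OF bpos] by simp
        then have "of_int k < d' + 1"
          using xy facts unfolding b_def by linarith
        then have "k = d"
          using k_range by linarith
        then show False
          using reciprocal_parameter(5)[OF pos(1)] b less 4 unfolding b_def x'_def by auto
      qed
      ultimately have "psi (x', n / b) = (x', n / b)"
        using x' by (auto simp: psi_def)
      then show ?thesis
        by (simp add: natext_A' rhs)
    next
      case True
      have rhs: "natext N \<gamma> (psi (x, y)) = (x' + 1, n / (b - 1))"
        unfolding psi using True k 4 facts
        by (subst natext_parameter[where k = "k - 1"]) (auto simp: x'_def b_def algebra_simps)
      have "d' < of_int k"
      proof (rule ccontr)
        assume "\<not> d' < of_int k"
        then have "of_int k = d'"
          using k_range by simp
        moreover have "d' + C < n / x"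
          using reciprocal_constants(9)[OF pos(1)] xy by simp
        ultimately show False
          using True facts unfolding x'_def by linarith
      qed
      then have dk': "d + 1 \<le> k"
        by simp
      then have dk: "d' + 1 \<le> of_int k"
        by linarith
      then have "0 < n / (b - 1)"
        using xy facts n_pos unfolding b_def by (intro divide_pos_pos) auto
      note y1 = reciprocal_constants(10)[OF this, unfolded double_reciprocal]
      have "\<not> (x' + 1 < L2 \<and> A + 1 < n / (b - 1))"
      proof
        assume less: "x' + 1 < L2 \<and> A + 1 < n / (b - 1)"
        then have b: "b - 1 < d' + C"
          using y1 by simp
        then have "of_int k < d' + 2"
          using xy facts unfolding b_def by linarith
        then have "k = d + 1"
          using dk' by linarith
        then have "of_int k = d' + 1"
          by simp
        then show False
          using reciprocal_parameter(5)[OF pos(1)] b less 4 unfolding b_def x'_def by auto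
      qed
      then have "psi (x', n / b) = (x' + 1, n / (b - 1))"
        using True by (auto simp: psi_def move0_def)
      then show ?thesis
        by (simp add: natext_A' rhs)
    qed
  qed
qed

end

section \<open>Invariance of the measure\<close>

lemma measurable_digit [measurable]: "digit N \<gamma> \<in> borel \<rightarrow>\<^sub>M count_space UNIV"
  unfolding digit_def by measurable

lemma measurable_natext: "natext N \<gamma> \<in> borel_measurable borel"
  unfolding natext_def Tmap_def case_prod_beta by measurable

context matching_grid begin

lemma K_borel [measurable]: "K \<in> sets borel"
  by (rule sets.countable[OF _ countable_K]) simp

lemma off_grid_borel: "{z. fst z \<notin> K \<and> snd z \<notin> K} \<in> sets borel"
proof -
  have K: "- K \<in> sets borel"
    using K_borel by (rule borel_comp)
  have eq: "{z. fst z \<notin> K \<and> snd z \<notin> K} =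
      fst -` (- K) \<inter> space borel \<inter> (snd -` (- K) \<inter> space borel)"
    by fastforce
  show ?thesis
    unfolding eq
    by (intro sets.Int measurable_sets[OF measurable_fst_snd_plane(1) K]
        measurable_sets[OF measurable_fst_snd_plane(2) K])
qed

lemma base_domain_borel: "base_domain \<in> sets borel"
proof -
  have eq: "base_domain = {z. fst z \<notin> K \<and> snd z \<notin> K} \<inter>
      ({A<..<A + 1} \<times> {B<..<B + 1} \<inter> ({C<..} \<times> UNIV \<union> UNIV \<times> {..<D}))"
    by (auto simp: base_domain_def)
  show ?thesis
    unfolding eq
    by (intro sets.Int off_grid_borel borel_open open_Int open_Un open_Times) auto
qed

lemma base_inverse_borel: "base_inverse \<in> borel_measurable borel"
  unfolding base_inverse_def Let_def case_prod_beta by measurable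

lemma nu_local_inversion: "nu_local n quadrant (inversion n)"
  using nu_isomorphism_inversion[OF n_pos] by (auto simp: nu_local_def)

lemma nu_local_shift: "nu_local n (shift_dom n k) (shift n k)"
  using nu_isomorphism_shift[OF n_pos] by (auto simp: nu_local_def)

lemma nu_isomorphism_base: "nu_isomorphism n base_domain (natext N A) base_domain base_inverse"
proof -
  define \<P> where "\<P> = range (\<lambda>k :: int. (quadrant \<inter> inversion n -` shift_dom n (- of_int k),
    \<lambda>z. shift n (- of_int k) (inversion n z)))"
  have countable: "countable \<P>"
    by (simp add: \<P>_def)
  have pieces: "nu_local n P g" if "(P, g) \<in> \<P>" for P g
    using that nu_local_comp[OF nu_local_inversion nu_local_shift] by (auto simp: \<P>_def)
  have cover: "\<exists>(P, g)\<in>\<P>. z \<in> P \<and> natext N A z = g z" if "z \<in> base_domain" for z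
  proof -
    obtain x y where z: "z = (x, y)"
      by (cases z)
    have "\<exists>k. k \<ge> 0 \<and> (x, y) \<in> quadrant \<and> of_int k < n / x \<and> natext N A (x, y) = branch k (x, y)"
      using base_step(3)[of x y] that unfolding z by simp
    then obtain k where k: "k \<ge> 0" "(x, y) \<in> quadrant" "of_int k < n / x"
        "natext N A (x, y) = branch k (x, y)"
      by (elim exE conjE)
    have "0 < x" "0 < y"
      using k(2) by (auto simp: quadrant_def)
    then have "z \<in> quadrant \<inter> inversion n -` shift_dom n (- of_int k)"
      using k(1-3) n_pos by (simp add: z quadrant_def inversion_def shift_dom_def)
    moreover have "natext N A z = shift n (- of_int k) (inversion n z)"
      using k(4) by (simp add: z inversion_def shift_def branch_def add.commute)
    ultimately show ?thesis
      unfolding \<P>_def by (intro bexI[OF _ rangeI[of _ k]]) simp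
  qed
  have inverse: "natext N A z \<in> base_domain \<and> base_inverse (natext N A z) = z"
    "base_inverse z \<in> base_domain \<and> natext N A (base_inverse z) = z" if "z \<in> base_domain" for z
    using that base_step base_step_inverse by (cases z; simp)+
  show ?thesis
    by (rule nu_isomorphism_countable_pieces[OF countable pieces base_domain_borel measurable_natext
        base_domain_borel base_inverse_borel inverse cover])
qed

end

context matching_parameter begin

lemma target_domain_borel: "target_domain \<in> sets borel"
proof -
  have eq: "target_domain = {z. fst z \<notin> K \<and> snd z \<notin> K} \<inter>
      ({\<gamma><..<\<gamma> + 1} \<times> {A<..<B + 1} \<inter> ({..<H2} \<times> UNIV \<union> UNIV \<times> {B<..}) \<inter>
      ({..<L1} \<times> UNIV \<union> UNIV \<times> {C<..}) \<inter> ({L2<..} \<times> UNIV \<union> UNIV \<times> {..<A + 1}) \<inter>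
      ({H1<..} \<times> UNIV \<union> UNIV \<times> {..<D}))"
    by (auto simp: target_domain_def)
  show ?thesis
    unfolding eq
    by (intro sets.Int off_grid_borel borel_open open_Int open_Un open_Times) auto
qed

lemma moves_borel [measurable]:
  "move0 \<in> borel_measurable borel" "move0_inv \<in> borel_measurable borel"
  "move1 \<in> borel_measurable borel" "move1_inv \<in> borel_measurable borel"
  "move2 \<in> borel_measurable borel" "move2_inv \<in> borel_measurable borel"
  unfolding move0_def move1_def move2_def move0_inv_def move1_inv_def move2_inv_def case_prod_beta
  by measurable
lemma psi_borel: "psi \<in> borel_measurable borel" and psi_inv_borel: "psi_inv \<in> borel_measurable borel"
  unfolding psi_def psi_inv_def case_prod_beta prod.collapse
  by measurable

text \<open>Each case of \<open>\<psi>\<close> is a word in \<open>inversion\<close> and \<open>shift\<close>. The domains of these words are the sets on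
  which all intermediate points stay in the quadrant.\<close>

lemma nu_isomorphism_psi: "nu_isomorphism n base_domain psi target_domain psi_inv"
proof -
  \<comment> \<open>\<open>tau\<close> is the step with digit \<open>d\<close>, and \<open>tau_inv\<close> undoes the step with digit \<open>e\<close>.\<close>
  define Q0 where "Q0 = shift_dom n 1"
  define Q2 where "Q2 = (quadrant \<inter> inversion n -` Q0) \<inter> (\<lambda>z. shift n 1 (inversion n z)) -` quadrant"
  define tau_inv where "tau_inv = (\<lambda>z. inversion n (shift n e z))"
  define T where "T = shift_dom n e \<inter> shift n e -` quadrant"
  define tau where "tau = (\<lambda>z. shift n (- d') (inversion n z))"
  define U where "U = quadrant \<inter> inversion n -` shift_dom n (- d')"
  define Q1 where "Q1 = (T \<inter> tau_inv -` Q0) \<inter> (\<lambda>z. shift n 1 (tau_inv z)) -` U"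
  have move0: "move0 = shift n 1"
    by (auto simp: move0_def shift_def)
  have move2: "move2 = (\<lambda>z. inversion n (shift n 1 (inversion n z)))"
    by (auto simp: move2_def shift_def inversion_def)
  have move1: "move1 = (\<lambda>z. tau (shift n 1 (tau_inv z)))"
    by (auto simp: move1_def shift_def inversion_def tau_def tau_inv_def add_ac)
  have loc0: "nu_local n Q0 move0"
    unfolding Q0_def move0 by (rule nu_local_shift)
  have loc2: "nu_local n Q2 move2"
    unfolding Q2_def Q0_def move2
    by (intro nu_local_comp[of n _ "\<lambda>z. shift n 1 (inversion n z)"]
        nu_local_comp[of n _ "inversion n"] nu_local_shift nu_local_inversion)
  have loc1: "nu_local n Q1 move1"
  proof -
    have "nu_local n T tau_inv" "nu_local n U tau"
      unfolding T_def U_def tau_def tau_inv_def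
      by (intro nu_local_comp nu_local_shift nu_local_inversion)+
    then show ?thesis
      unfolding Q1_def Q0_def move1
      by (intro nu_local_comp[of n _ "\<lambda>z. shift n 1 (tau_inv z)"] nu_local_comp[of n _ tau_inv] nu_local_shift)
  qed
  have id: "nu_local n UNIV (\<lambda>z. z)"
    using nu_isomorphism_id[of UNIV n] by (auto simp: nu_local_def)
  define \<P> where "\<P> = {(UNIV, \<lambda>z. z), (Q0, move0), (Q1, move1), (Q2, move2),
    (Q0 \<inter> move0 -` Q2, \<lambda>z. move2 (move0 z)), (Q2 \<inter> move2 -` Q0, \<lambda>z. move0 (move2 z))}"
  have in_Q0: "(x, y) \<in> Q0" if "0 < x" "0 < y" "1 < n / y" for x y
    using that by (simp add: Q0_def shift_dom_def)
  have in_Q2: "(x, y) \<in> Q2" if "0 < x" "1 < y" for x y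
  proof -
    have "0 < n / x"
      using that n_pos by simp
    then have "- 1 < n / x" "0 < n / x + 1"
      by linarith+
    then show ?thesis
      using that n_pos
      by (auto simp: Q2_def Q0_def quadrant_def inversion_def shift_dom_def shift_def intro!: divide_pos_pos)
  qed
  have in_Q1: "(x, y) \<in> Q1" if "0 < x" "0 < y" "d' < n / (n / (x + e) + 1)" "e < n / y"
      "1 < n / (n / y - e)" for x y
  proof -
    have "0 < x + e"
      using that parameter_facts by simp
    moreover have "0 < n / (x + e)" "0 < n / (n / (n / y - e) - 1)"
      using that calculation n_pos by (auto intro!: divide_pos_pos)
    moreover from this have "- 1 < n / (x + e)" "- d' < n / (n / (n / y - e) - 1)"
      using d_pos by linarith+
    ultimately show ?thesis
      using that n_pos parameter_facts
      by (auto simp: Q1_def Q0_def T_def U_def tau_inv_def quadrant_def inversion_def shift_dom_def shift_def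
          intro!: divide_pos_pos add_pos_pos)
  qed
  show ?thesis
  proof (rule nu_isomorphism_countable_pieces[of \<P>])
    show "countable \<P>"
      by (simp add: \<P>_def)
    show "nu_local n P g" if "(P, g) \<in> \<P>" for P g
      using that unfolding \<P>_def using loc0 loc1 loc2 id nu_local_comp[OF loc0 loc2] nu_local_comp[OF loc2 loc0] by auto
    show "\<exists>(P, g)\<in>\<P>. z \<in> P \<and> psi z = g z" if z: "z \<in> base_domain" for z
    proof -
      obtain x y where xy: "z = (x, y)"
        by (cases z)
      have b: "A < x" "x < A + 1" "B < y" "y < B + 1" "C < x \<or> y < D"
        using z by (auto simp: xy base_domain_def)
      note facts = parameter_facts L2_reciprocal
      have pos: "0 < x" "0 < y"
        using b facts by auto
      have y1: "1 < n / y"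
        using reciprocal_constants(11)[OF pos(2)] b facts by linarith
      consider "x < \<gamma>" | "\<not> x < \<gamma>" "L1 < x \<and> y < C"
        | "\<not> x < \<gamma>" "\<not> (L1 < x \<and> y < C)" "C < x \<and> x < L2 \<and> A + 1 < y"
        | "\<not> x < \<gamma>" "\<not> (L1 < x \<and> y < C)" "\<not> (C < x \<and> x < L2 \<and> A + 1 < y)"
        by blast
      then show ?thesis
      proof cases
        case 1
        have "z \<in> Q0"
          using pos y1 in_Q0 by (simp add: xy)
        moreover have "move0 z \<in> Q2" if "A + 1 < n / (n / y - 1)"
          using that pos facts in_Q2[of "x + 1"] by (simp add: xy move0_def)
        ultimately show ?thesis
          using 1 by (auto simp: psi_def xy \<P>_def)
      next
        case 2
        have "e + A < n / y" "n / y < e + D"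
          using reciprocal_constants(4,5)[OF pos(2)] 2 b by simp_all
        then have t: "0 < n / y - e" "n / y - e < D" "e < n / y"
          using facts by auto
        then have "d' + 1 + B < n / (n / y - e)"
          using reciprocal_constants(7)[OF t(1)] by simp
        then have t1: "1 < n / (n / y - e)"
          using facts by linarith
        have "0 < n / (x + e)"
          using pos facts n_pos by simp
        then have "n / (x + e) < \<gamma>"
          using reciprocal_parameter(1)[of "n / (x + e)"] 2 by simp
        then have "d' < n / (n / (x + e) + 1)"
          using reciprocal_parameter(3)[of "n / (x + e) + 1"] \<open>0 < n / (x + e)\<close> facts by simp
        then have "z \<in> Q1"
          using pos t t1 in_Q1 by (simp add: xy)
        then show ?thesis
          using 2 by (auto simp: psi_def xy \<P>_def)
      next
        case 3
        have "z \<in> Q2"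
          using pos 3 facts in_Q2 by (simp add: xy)
        moreover have "move2 z \<in> Q0"
        proof -
          have "0 < y - 1"
            using 3 facts by simp
          then have "e + D < n / (y - 1)"
            using reciprocal_constants(3)[of "y - 1"] b by simp
          then have "1 < n / (y - 1)"
            using facts by linarith
          moreover have "0 < n / (n / x + 1)"
            using pos n_pos by (intro divide_pos_pos add_pos_pos) auto
          ultimately show ?thesis
            using \<open>0 < y - 1\<close> in_Q0 by (simp add: xy move2_def)
        qed
        ultimately show ?thesis
          using 3 by (auto simp: psi_def xy \<P>_def)
      next
        case 4
        then show ?thesis
          by (auto simp: psi_def xy \<P>_def)
      qed
    qed
    show "psi z \<in> target_domain \<and> psi_inv (psi z) = z" if "z \<in> base_domain" for z
      using that psi_correct by (cases z) blast
    show "psi_inv z \<in> base_domain \<and> psi (psi_inv z) = z" if "z \<in> target_domain" for z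
      using that psi_inv_correct by (cases z) blast
  qed (fact base_domain_borel target_domain_borel psi_borel psi_inv_borel)+
qed

lemma natext_conjugate:
  assumes "z \<in> target_domain"
  shows "natext N \<gamma> z = psi (natext N A (psi_inv z))"
proof -
  have "psi_inv z \<in> base_domain" "psi (psi_inv z) = z"
    using psi_inv_correct assms by (cases z; simp)+
  then show ?thesis
    using conjugacy[of "fst (psi_inv z)" "snd (psi_inv z)"] by simp
qed

lemma nu_isomorphism_target:
  "nu_isomorphism n target_domain (natext N \<gamma>) target_domain (\<lambda>z. psi (base_inverse (psi_inv z)))"
proof (rule nu_isomorphism_cong)
  have "nu_isomorphism n target_domain psi_inv base_domain psi"
    by (rule nu_isomorphism_sym[OF nu_isomorphism_psi])
  from nu_isomorphism_comp_exact[OF nu_isomorphism_comp_exact[OF this nu_isomorphism_base] nu_isomorphism_psi]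
  show "nu_isomorphism n target_domain (\<lambda>z. psi (natext N A (psi_inv z))) target_domain
      (\<lambda>z. psi (base_inverse (psi_inv z)))" .
qed (fact measurable_natext natext_conjugate)+

end

section \<open>The probability spaces\<close>

lemma emeasure_Un_null_eq:
  assumes "S \<in> sets M" "S' \<in> sets M" "S' \<subseteq> S" "S - S' \<subseteq> Z" "Z \<in> null_sets M"
  shows "emeasure M S = emeasure M S'"
proof -
  have "S - S' \<in> null_sets M"
    by (rule null_sets_subset[OF assms(5) _ assms(4)]) (rule sets.Diff[OF assms(1,2)])
  from emeasure_Un_null_set[OF assms(2) this] show ?thesis
    using assms(3) by (simp only: Un_Diff_cancel Un_absorb1)
qed

context matching_grid begin

lemma grid_null: "K \<times> UNIV \<union> UNIV \<times> K \<in> null_sets (nu n)"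
proof -
  have K: "emeasure lborel K = 0" "K \<in> sets lborel"
    using emeasure_lborel_countable[OF countable_K] K_borel unfolding sets_lborel by blast+
  have U: "UNIV \<in> sets (lborel :: real measure)"
    by simp
  have "emeasure (lborel \<Otimes>\<^sub>M lborel) (K \<times> (UNIV :: real set)) = 0" "emeasure (lborel \<Otimes>\<^sub>M lborel) ((UNIV :: real set) \<times> K) = 0"
    by (simp_all only: lborel.emeasure_pair_measure_Times[OF K(2) U]
        lborel.emeasure_pair_measure_Times[OF U K(2)] K(1) mult_zero_left mult_zero_right)
  then have "K \<times> (UNIV :: real set) \<in> null_sets (lborel \<Otimes>\<^sub>M lborel)" "(UNIV :: real set) \<times> K \<in> null_sets (lborel \<Otimes>\<^sub>M lborel)"
    using pair_measureI[OF K(2) U] pair_measureI[OF U K(2)] by (auto intro: null_setsI)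
  then have "K \<times> (UNIV :: real set) \<union> (UNIV :: real set) \<times> K \<in> null_sets lborel"
    unfolding lborel_prod by (rule null_sets.Un)
  then show ?thesis
    by (rule nu_null)
qed

text \<open>The domain contains the rectangle \<open>(A, C) \<times> (B, D)\<close> up to grid points.\<close>

lemma base_domain_positive: "emeasure (nu n) base_domain > 0"
proof (rule ccontr)
  assume "\<not> emeasure (nu n) base_domain > 0"
  then have base: "base_domain \<in> null_sets (nu n)"
    using base_domain_borel by (auto simp: null_sets_def)
  define R where "R = {A<..<C} \<times> {B<..<D}"
  have R: "R \<in> sets borel"
    unfolding R_def by (intro borel_open open_Times) auto
  have "R \<subseteq> base_domain \<union> (K \<times> UNIV \<union> UNIV \<times> K)"
    using constants_order by (auto simp: R_def base_domain_def)
  then have "R \<in> null_sets (nu n)"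
    using R by (intro null_sets_subset[OF null_sets.Un[OF base grid_null]]) auto
  then have zero: "AE z\<in>R in lborel. (\<lambda>(x, y). ennreal (n / (n + x * y)\<^sup>2)) z = 0"
    unfolding nu_def by (subst (asm) null_sets_density_iff) (use nu_density_borel in auto)
  have pos: "(\<lambda>(x, y). ennreal (n / (n + x * y)\<^sup>2)) z \<noteq> 0" if "z \<in> R" for z
  proof -
    obtain x y where z: "z = (x, y)"
      by (cases z)
    have "0 < n + x * y"
      using that A_pos B_pos n_pos by (auto simp: R_def z intro!: add_pos_pos mult_pos_pos)
    then show ?thesis
      using n_pos by (simp add: z)
  qed
  have "AE z in lborel. z \<notin> R"
    using zero by (rule AE_mp) (use pos in \<open>intro AE_I2 impI notI; blast\<close>)
  then have "R \<in> null_sets lborel"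
    using R by (simp add: AE_iff_null_sets)
  then have "emeasure (lborel \<Otimes>\<^sub>M lborel) R = 0"
    by (simp add: lborel_prod null_setsD1)
  moreover have "emeasure (lborel \<Otimes>\<^sub>M lborel) R = ennreal (C - A) * ennreal (D - B)"
    unfolding R_def using constants_order by (subst lborel.emeasure_pair_measure_Times) auto
  ultimately show False
    using constants_order by simp
qed

end

context matching_parameter begin

lemma Omega_staircase:
  "Omega N d i \<gamma> = staircase \<gamma> (\<gamma> + 1) H2 L1 L2 H1 A B C D (A + 1) (B + 1)"
  "compact (Omega N d i \<gamma>)"
proof -
  note facts = parameter_facts
  have "0 < H2" "0 < L2"
    using facts by linarith+
  then have "H2 < L2"
    using reciprocal_parameter(9)[of L2] less_iff_reciprocal[of H2 L2] orbit_matching[OF \<gamma>(1,2)] by simp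
  then have eq: "Omega N d i \<gamma> = staircase \<gamma> (\<gamma> + 1) H2 L1 L2 H1 A B C D (A + 1) (B + 1)"
    and "compact (staircase \<gamma> (\<gamma> + 1) H2 L1 L2 H1 A B C D (A + 1) (B + 1))"
    unfolding Omega_def vertices_def ptE_def ptF_def
    by (intro polygon_region_staircase; use facts in linarith)+
  then show "Omega N d i \<gamma> = staircase \<gamma> (\<gamma> + 1) H2 L1 L2 H1 A B C D (A + 1) (B + 1)"
    "compact (Omega N d i \<gamma>)"
    by simp_all
qed

lemma Omega_borel: "Omega N d i \<gamma> \<in> sets borel"
  using Omega_staircase(2) by (intro borel_closed compact_imp_closed)

lemma target_domain_subset: "target_domain \<subseteq> Omega N d i \<gamma>"
proof (rule subsetI)
  fix z assume z: "z \<in> target_domain"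
  obtain x y where xy: "z = (x, y)"
    by (cases z)
  have "\<gamma> < x \<and> x < \<gamma> + 1 \<and> A < y \<and> y < B + 1 \<and> (x < H2 \<or> B < y) \<and> (x < L1 \<or> C < y) \<and>
      (L2 < x \<or> y < A + 1) \<and> (H1 < x \<or> y < D)"
    using z unfolding xy target_domain_def by simp
  then have "\<gamma> \<le> x \<and> x \<le> \<gamma> + 1 \<and> A \<le> y \<and> y \<le> B + 1 \<and> (H2 < x \<longrightarrow> B \<le> y) \<and> (L1 < x \<longrightarrow> C \<le> y) \<and>
      (x < L2 \<longrightarrow> y \<le> A + 1) \<and> (x < H1 \<longrightarrow> y \<le> D)"
    by argo
  then show "z \<in> Omega N d i \<gamma>"
    unfolding xy Omega_staircase(1) staircase_def by simp
qed

text \<open>Off the grid the weak inequalities of the staircase are strict.\<close>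

lemma Omega_minus_target_domain: "Omega N d i \<gamma> - target_domain \<subseteq> K \<times> UNIV \<union> UNIV \<times> K"
proof
  fix z assume z: "z \<in> Omega N d i \<gamma> - target_domain"
  obtain x y where xy: "z = (x, y)"
    by (cases z)
  show "z \<in> K \<times> UNIV \<union> UNIV \<times> K"
  proof (rule ccontr)
    assume "z \<notin> K \<times> UNIV \<union> UNIV \<times> K"
    then have K: "x \<notin> K" "y \<notin> K"
      by (auto simp: xy)
    have O: "\<gamma> \<le> x" "x \<le> \<gamma> + 1" "A \<le> y" "y \<le> B + 1" "H2 < x \<longrightarrow> B \<le> y" "L1 < x \<longrightarrow> C \<le> y"
        "x < L2 \<longrightarrow> y \<le> A + 1" "x < H1 \<longrightarrow> y \<le> D"
      using z unfolding xy Omega_staircase(1) staircase_def by simp_all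
    have neq: "x \<noteq> \<gamma>" "x \<noteq> \<gamma> + 1" "x \<noteq> H2" "x \<noteq> L1" "x \<noteq> L2" "x \<noteq> H1"
        "y \<noteq> A" "y \<noteq> B + 1" "y \<noteq> B" "y \<noteq> C" "y \<noteq> A + 1" "y \<noteq> D"
      using not_in_K[OF K(1)] not_in_K[OF K(2)] by blast+
    have "\<gamma> < x" "x < \<gamma> + 1" "A < y" "y < B + 1"
      using O(1-4) neq(1,2,7,8) by argo+
    moreover have "x < H2 \<or> B < y" "x < L1 \<or> C < y" "L2 < x \<or> y < A + 1" "H1 < x \<or> y < D"
      using O(5-8) neq(3-6,9-12) by argo+
    ultimately have "(x, y) \<in> target_domain"
      using K by (simp add: target_domain_def)
    then show False
      using z by (simp add: xy)
  qed
qed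

lemma nu_ignore_grid:
  assumes "S \<in> sets borel" "S \<subseteq> Omega N d i \<gamma>"
  shows "emeasure (nu n) S = emeasure (nu n) (S \<inter> target_domain)"
proof -
  have diff: "S - S \<inter> target_domain \<subseteq> K \<times> UNIV \<union> UNIV \<times> K"
    using assms(2) by (intro subset_trans[OF _ Omega_minus_target_domain]) blast
  have S: "S \<in> sets (nu n)" "S \<inter> target_domain \<in> sets (nu n)"
    unfolding sets_nu by (fact assms(1), fact sets.Int[OF assms(1) target_domain_borel])
  show ?thesis
    by (rule emeasure_Un_null_eq[OF S Int_lower1 diff grid_null])
qed

text \<open>The total mass does not depend on the parameter, hence neither does the normalising constant.\<close>

lemma nu_Omega: "emeasure (nu n) (Omega N d i \<gamma>) = emeasure (nu n) base_domain"
proof -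
  have "emeasure (nu n) (Omega N d i \<gamma>) = emeasure (nu n) target_domain"
    using nu_ignore_grid[OF Omega_borel order_refl] target_domain_subset by (simp add: Int_absorb1)
  also have "\<dots> = emeasure (nu n) base_domain"
    by (rule nu_isomorphism_emeasure[OF nu_isomorphism_psi, symmetric])
  finally show ?thesis .
qed

lemma nu_Omega_finite: "emeasure (nu n) (Omega N d i \<gamma>) < \<infinity>"
proof -
  have "0 \<le> x * y" if "(x, y) \<in> Omega N d i \<gamma>" for x y
  proof -
    have "\<gamma> \<le> x" "A \<le> y"
      using that unfolding Omega_staircase(1) staircase_def by simp_all
    then show ?thesis
      using \<gamma>(1) A_pos by (intro mult_nonneg_nonneg) linarith+
  qed
  then have "emeasure (nu n) (Omega N d i \<gamma>) \<le> ennreal (1 / n) * emeasure lborel (Omega N d i \<gamma>)"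
    by (rule emeasure_nu_le[OF Omega_borel n_pos])
  also have "\<dots> < \<infinity>"
    using emeasure_bounded_finite[OF compact_imp_bounded[OF Omega_staircase(2)]]
    by (simp add: ennreal_mult_less_top)
  finally show ?thesis .
qed

lemma norm_const_eq: "norm_const N d i \<gamma> = 1 / enn2real (emeasure (nu n) base_domain)"
  unfolding norm_const_def lebesgue_integral_nu[OF Omega_borel less_imp_le[OF n_pos]] nu_Omega ..

lemma emeasure_mu:
  assumes "S \<in> sets borel" "S \<subseteq> Omega N d i \<gamma>"
  shows "emeasure (mu N d i \<gamma>) S =
    ennreal (1 / enn2real (emeasure (nu n) base_domain)) * emeasure (nu n) S"
proof -
  let ?O = "Omega N d i \<gamma>"
  define c where "c = 1 / enn2real (emeasure (nu n) base_domain)"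
  have c: "0 \<le> c"
    by (simp add: c_def)
  let ?h = "\<lambda>z :: real \<times> real. (\<lambda>(x, y). ennreal (n / (n + x * y)\<^sup>2)) z"
  let ?H = "\<lambda>z :: real \<times> real. (\<lambda>(x, y). ennreal (c * (n / (n + x * y)\<^sup>2))) z"
  have [measurable]: "?O \<in> sets borel" "S \<in> sets borel"
    using Omega_borel assms by auto
  have H: "?H \<in> borel_measurable borel"
    unfolding case_prod_beta by measurable
  have "emeasure (mu N d i \<gamma>) S = (\<integral>\<^sup>+z. ?H z * indicator S z \<partial>restrict_space lborel ?O)"
    unfolding mu_def norm_const_eq c_def[symmetric]
  proof (rule emeasure_density)
    show "?H \<in> borel_measurable (restrict_space lborel ?O)"
      using H by (intro measurable_restrict_space1) simp
    show "S \<in> sets (restrict_space lborel ?O)"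
      using assms Omega_borel by (simp add: sets_restrict_space_iff)
  qed
  also have "\<dots> = (\<integral>\<^sup>+z. ?H z * indicator S z * indicator ?O z \<partial>lborel)"
    using Omega_borel by (subst nn_integral_restrict_space) auto
  also have "\<dots> = (\<integral>\<^sup>+z. ennreal c * (?h z * indicator S z) \<partial>lborel)"
    using assms n_pos c by (intro nn_integral_cong) (auto simp: indicator_def ennreal_mult'[OF c] simp del: times_divide_eq_right)
  also have "\<dots> = ennreal c * (\<integral>\<^sup>+z. ?h z * indicator S z \<partial>lborel)"
    using nu_density_borel[of n] by (intro nn_integral_cmult) measurable
  also have "(\<integral>\<^sup>+z. ?h z * indicator S z \<partial>lborel) = emeasure (nu n) S"
    by (rule emeasure_nu[OF assms(1), symmetric])
  finally show ?thesis
    unfolding c_def .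
qed

lemma sets_mu_iff: "S \<in> sets (mu N d i \<gamma>) \<longleftrightarrow> S \<in> sets borel \<and> S \<subseteq> Omega N d i \<gamma>"
  using Omega_borel by (auto simp: sets_mu sets_restrict_space_iff)

lemma natext_target_domain: "z \<in> target_domain \<Longrightarrow> natext N \<gamma> z \<in> target_domain"
  using nu_isomorphism_target unfolding nu_isomorphism_def by blast

lemma dynamical_system_mu: "dynamical_system (mu N d i \<gamma>) (natext N \<gamma>)"
  unfolding dynamical_system_def
proof (intro conjI ballI)
  let ?c = "emeasure (nu n) base_domain"
  have c: "0 < enn2real ?c" "ennreal (enn2real ?c) = ?c"
    using base_domain_positive nu_Omega nu_Omega_finite by (auto simp: enn2real_positive_iff)
  have "emeasure (mu N d i \<gamma>) (Omega N d i \<gamma>) = ennreal (1 / enn2real ?c) * ennreal (enn2real ?c)"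
    using emeasure_mu[OF Omega_borel order_refl] by (simp add: nu_Omega c(2))
  also have "\<dots> = 1"
    using c(1) by (simp flip: ennreal_mult)
  finally show "prob_space (mu N d i \<gamma>)"
    by (intro prob_spaceI) (simp add: space_mu)
  fix S assume "S \<in> sets (mu N d i \<gamma>)"
  then have S: "S \<in> sets borel" "S \<subseteq> Omega N d i \<gamma>"
    by (auto simp: sets_mu_iff)
  let ?P = "natext N \<gamma> -` S \<inter> Omega N d i \<gamma>"
  have P: "?P \<in> sets borel"
    using measurable_sets[OF measurable_natext S(1)] Omega_borel by auto
  then show "natext N \<gamma> -` S \<inter> space (mu N d i \<gamma>) \<in> sets (mu N d i \<gamma>)"
    by (simp add: sets_mu_iff space_mu)
  have "emeasure (nu n) ?P = emeasure (nu n) (?P \<inter> target_domain)"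
    using P by (intro nu_ignore_grid) auto
  also have "?P \<inter> target_domain = natext N \<gamma> -` (S \<inter> target_domain) \<inter> target_domain"
    using natext_target_domain target_domain_subset by blast
  also have "emeasure (nu n) \<dots> = emeasure (nu n) (S \<inter> target_domain)"
    using nu_isomorphism_target sets.Int[OF S(1) target_domain_borel]
    unfolding nu_isomorphism_def by (meson Int_lower2)
  also have "\<dots> = emeasure (nu n) S"
    using S by (intro nu_ignore_grid[symmetric])
  finally show "emeasure (mu N d i \<gamma>) (natext N \<gamma> -` S \<inter> space (mu N d i \<gamma>)) = emeasure (mu N d i \<gamma>) S"
    using emeasure_mu[OF P] emeasure_mu[OF S] by (simp add: space_mu)
qed

lemma sets_restrict_mu: "sets (restrict_space (mu N d i \<gamma>) target_domain) = sets (restrict_space borel target_domain)"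
proof -
  have "sets (restrict_space (mu N d i \<gamma>) target_domain) =
      sets (restrict_space (restrict_space borel (Omega N d i \<gamma>)) target_domain)"
    by (intro sets_restrict_space_cong sets_mu)
  then show ?thesis
    using target_domain_subset by (simp add: sets_restrict_restrict_space Int_absorb1)
qed

lemma mu_minus_target_domain: "emeasure (mu N d i \<gamma>) (space (mu N d i \<gamma>) - target_domain) = 0"
proof -
  have D: "Omega N d i \<gamma> - target_domain \<in> sets borel"
    using Omega_borel target_domain_borel by auto
  have "emeasure (nu n) (Omega N d i \<gamma> - target_domain) = 0"
    by (simp only: nu_ignore_grid[OF D Diff_subset] Diff_disjoint Int_commute[of _ target_domain] emeasure_empty)
  then show ?thesis
    using emeasure_mu[OF D Diff_subset] by (simp add: space_mu)
qed

end

context matching_grid begin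

lemma metrically_isomorphic_mu:
  assumes "matching_parameter N d i K \<alpha>" "matching_parameter N d i K \<beta>"
  shows "metrically_isomorphic (mu N d i \<alpha>) (natext N \<alpha>) (mu N d i \<beta>) (natext N \<beta>)"
proof -
  interpret a: matching_parameter N d i K \<alpha> by fact
  interpret b: matching_parameter N d i K \<beta> by fact
  define f where "f = (\<lambda>z. b.psi (a.psi_inv z))"
  define g where "g = (\<lambda>z. a.psi (b.psi_inv z))"
  have iso: "nu_isomorphism n a.target_domain f b.target_domain g"
    unfolding f_def g_def
    by (rule nu_isomorphism_comp_exact[OF nu_isomorphism_sym[OF a.nu_isomorphism_psi] b.nu_isomorphism_psi])
  then have f: "\<And>z. z \<in> a.target_domain \<Longrightarrow> f z \<in> b.target_domain \<and> g (f z) = z"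
    and g: "\<And>z. z \<in> b.target_domain \<Longrightarrow> g z \<in> a.target_domain \<and> f (g z) = z"
    and borel: "f \<in> borel_measurable borel" "g \<in> borel_measurable borel"
    unfolding nu_isomorphism_def by blast+
  have bij: "bij_betw f a.target_domain b.target_domain"
    using f g by (intro bij_betw_byWitness[of _ g]) auto
  have inv: "inv_into a.target_domain f z = g z" if "z \<in> b.target_domain" for z
    using bij g[OF that] by (intro inv_into_f_eq) (auto simp: bij_betw_def)
  have meas: "f \<in> restrict_space (mu N d i \<alpha>) a.target_domain \<rightarrow>\<^sub>M restrict_space (mu N d i \<beta>) b.target_domain"
    unfolding measurable_cong_sets[OF a.sets_restrict_mu b.sets_restrict_mu]
    using f borel
    by (intro measurable_restrict_space2 measurable_restrict_space1) (auto simp: space_restrict_space)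
  have "g \<in> restrict_space (mu N d i \<beta>) b.target_domain \<rightarrow>\<^sub>M restrict_space (mu N d i \<alpha>) a.target_domain"
    unfolding measurable_cong_sets[OF b.sets_restrict_mu a.sets_restrict_mu]
    using g borel
    by (intro measurable_restrict_space2 measurable_restrict_space1) (auto simp: space_restrict_space)
  then have meas_inv: "inv_into a.target_domain f \<in>
      restrict_space (mu N d i \<beta>) b.target_domain \<rightarrow>\<^sub>M restrict_space (mu N d i \<alpha>) a.target_domain"
    by (rule measurable_cong[THEN iffD1, rotated]) (simp add: inv space_restrict_space)
  have measure: "emeasure (mu N d i \<alpha>) (f -` S \<inter> a.target_domain) = emeasure (mu N d i \<beta>) S"
    if S: "S \<in> sets (mu N d i \<beta>)" "S \<subseteq> b.target_domain" for S
  proof -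
    have S': "S \<in> sets borel" "S \<subseteq> Omega N d i \<beta>"
      using S by (auto simp: b.sets_mu_iff)
    have P: "f -` S \<inter> a.target_domain \<in> sets borel" "f -` S \<inter> a.target_domain \<subseteq> Omega N d i \<alpha>"
      using measurable_sets[OF borel(1) S'(1)] a.target_domain_borel a.target_domain_subset by auto
    have "emeasure (nu n) (f -` S \<inter> a.target_domain) = emeasure (nu n) S"
      using iso S' S unfolding nu_isomorphism_def by blast
    then show ?thesis
      by (simp add: a.emeasure_mu[OF P] b.emeasure_mu[OF S'])
  qed
  have conj: "f (natext N \<alpha> z) = natext N \<beta> (f z)" if z: "z \<in> a.target_domain" for z
  proof -
    have w: "a.psi_inv z \<in> base_domain"
      using a.psi_inv_correct z by (cases z) simp
    then have "natext N A (a.psi_inv z) \<in> base_domain"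
      using base_step(1) by (cases "a.psi_inv z") simp
    then have "a.psi_inv (a.psi (natext N A (a.psi_inv z))) = natext N A (a.psi_inv z)"
      using a.psi_correct by (cases "natext N A (a.psi_inv z)") simp
    then have "f (natext N \<alpha> z) = b.psi (natext N A (a.psi_inv z))"
      by (simp add: f_def a.natext_conjugate[OF z])
    also have "\<dots> = natext N \<beta> (f z)"
      using b.conjugacy[of "fst (a.psi_inv z)" "snd (a.psi_inv z)"] w by (simp add: f_def)
    finally show ?thesis .
  qed
  show ?thesis
    unfolding metrically_isomorphic_def
  proof (intro conjI exI)
    show "dynamical_system (mu N d i \<alpha>) (natext N \<alpha>)" "dynamical_system (mu N d i \<beta>) (natext N \<beta>)"
      by (rule a.dynamical_system_mu b.dynamical_system_mu)+
    show "a.target_domain \<in> sets (mu N d i \<alpha>)" "b.target_domain \<in> sets (mu N d i \<beta>)"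
      using a.target_domain_borel a.target_domain_subset b.target_domain_borel b.target_domain_subset
      by (simp_all add: a.sets_mu_iff b.sets_mu_iff)
    show "emeasure (mu N d i \<alpha>) (space (mu N d i \<alpha>) - a.target_domain) = 0"
      "emeasure (mu N d i \<beta>) (space (mu N d i \<beta>) - b.target_domain) = 0"
      by (rule a.mu_minus_target_domain b.mu_minus_target_domain)+
    show "natext N \<alpha> ` a.target_domain \<subseteq> a.target_domain" "natext N \<beta> ` b.target_domain \<subseteq> b.target_domain"
      using a.natext_target_domain b.natext_target_domain by auto
    show "\<forall>S\<in>sets (mu N d i \<beta>). S \<subseteq> b.target_domain \<longrightarrow>
        emeasure (mu N d i \<alpha>) (f -` S \<inter> a.target_domain) = emeasure (mu N d i \<beta>) S"
      using measure by blast
    show "\<forall>z\<in>a.target_domain. f (natext N \<alpha> z) = natext N \<beta> (f z)"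
      using conj by blast
  qed (fact bij meas meas_inv)+
qed

end

section \<open>A countable grid\<close>

text \<open>Closing a countable set under the three operations in countably many rounds keeps it countable.\<close>

definition grid_step :: "real \<Rightarrow> real set \<Rightarrow> real set" where
  "grid_step n S = S \<union> (\<lambda>x. x + 1) ` S \<union> (\<lambda>x. x - 1) ` S \<union> (\<lambda>x. n / x) ` S"

definition grid :: "real \<Rightarrow> real set \<Rightarrow> real set" where
  "grid n S = (\<Union>k. (grid_step n ^^ k) S)"

lemma countable_grid: "countable S \<Longrightarrow> countable (grid n S)"
proof -
  assume S: "countable S"
  have "countable ((grid_step n ^^ k) S)" for k
    by (induction k) (use S in \<open>auto simp: grid_step_def\<close>)
  then show ?thesis
    by (simp add: grid_def)
qed

lemma grid_superset: "S \<subseteq> grid n S"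
  unfolding grid_def using UN_upper[of 0 UNIV "\<lambda>k. (grid_step n ^^ k) S"] by simp

lemma grid_closed:
  assumes "x \<in> grid n S"
  shows "x + 1 \<in> grid n S" "x - 1 \<in> grid n S" "n / x \<in> grid n S"
proof -
  obtain k where "x \<in> (grid_step n ^^ k) S"
    using assms by (auto simp: grid_def)
  then have "x + 1 \<in> (grid_step n ^^ Suc k) S" "x - 1 \<in> (grid_step n ^^ Suc k) S"
    "n / x \<in> (grid_step n ^^ Suc k) S"
    by (auto simp: grid_step_def)
  then show "x + 1 \<in> grid n S" "x - 1 \<in> grid n S" "n / x \<in> grid n S"
    unfolding grid_def by blast+
qed

theorem theorem7:
  fixes N d i :: int and \<alpha> \<beta> :: real
  assumes "N \<ge> 2" and "d \<ge> 1" and "i \<ge> 2"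
    and "real_of_int N = real_of_int (d * (d + i)) / real_of_int (i - 1)"
    and "\<alpha> \<in> {ptA N d i..ptB N d i}" and "\<beta> \<in> {ptA N d i..ptB N d i}" and "\<alpha> < \<beta>"
  shows "{ptA N d i..ptB N d i} = closure (X_set N d i) \<and>
    metrically_isomorphic (mu N d i \<alpha>) (natext N \<alpha>) (mu N d i \<beta>) (natext N \<beta>)"
proof -
  have "real_of_int (N * (i - 1)) = real_of_int (d * (d + i))"
    using assms(3,4) by (simp add: nonzero_eq_divide_eq)
  then have "N * (i - 1) = d * (d + i)"
    by (simp only: of_int_eq_iff)
  then interpret matching_family N d i
    using assms by unfold_locales
  define K where "K = grid n {A, B, \<alpha>, \<beta>}"
  have K: "{A, B, \<alpha>, \<beta>} \<subseteq> K"
    unfolding K_def by (rule grid_superset)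
  interpret matching_grid N d i K
  proof
    show "countable K"
      unfolding K_def by (intro countable_grid) simp
    show "x + 1 \<in> K \<longleftrightarrow> x \<in> K" for x
      using grid_closed(1)[of x] grid_closed(2)[of "x + 1"] by (auto simp: K_def)
    show "n / x \<in> K \<longleftrightarrow> x \<in> K" for x
      using grid_closed(3)[of x n] grid_closed(3)[of "n / x" n] n_pos by (auto simp: K_def)
  qed (use K in auto)
  have "matching_parameter N d i K \<alpha>" "matching_parameter N d i K \<beta>"
    using assms K by unfold_locales auto
  then show ?thesis
    using closure_X metrically_isomorphic_mu by auto
qed

end
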